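(* Let $R$ be a non-trivial rational link (one or two components), and let $D$ be its determinant. Then every Schubert Normal Form of $R$ admits a non-trivial $D$-coloring which uses all $D$ available colors, i.e., every integer modulo $D$ is the color of at least one arc.
   Context: Rational links are the $2$-bridge links, i.e., links admitting diagrams with exactly two over-arcs (bridges); such a link has one or two components. A non-trivial rational link is a rational link which is neither the trivial knot nor the trivial $2$-component link. A Schubert Normal Form (SNF) of such a link is the standard $2$-bridge diagram of Schubert (Math. Z. 65 (1956)): it consists of two disjoint embedded segments in the plane (the bridges) and two disjoint embedded curves (the under-strands) joining the endpoints of the bridges, such that every crossing is one of an under-strand passing under the interior of a bridge; traveling along an under-strand starting from an end of a bridge, one first passes under the other bridge and thereafter passes under the two bridges alternately; and traveling along each bridge, one meets the two under-strands alternately. For an integer $m>1$, an $m$-coloring of a link diagram is an assignment of integers modulo $m$ (colors) to the arcs of the diagram such that at each crossing, twice the color of the over-arc equals the sum of the colors of the two under-arcs, modulo $m$; it is non-trivial if it uses more than one color. *)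

theory Defs
  imports
    "HOL-Combinatorics.Orbits"
    "HOL-Combinatorics.Transposition"
    "HOL-Number_Theory.Cong"
    "Jordan_Normal_Form.Determinant"
begin

section \<open>Link diagrams as combinatorial maps\<close>

text \<open>A link diagram on the sphere is a plane graph encoded by a rotation system. A dart is an edge
  together with one of its two ends; \<open>opp\<close> exchanges the two ends of an edge, and \<open>nxt\<close> is the
  counterclockwise successor among the darts at the same vertex. A vertex is either a crossing (four
  darts, \<open>over\<close> marking the two opposite darts of its upper strand) or a point (two darts), that is,
  a marked point in the interior of a strand. Points carry no topological information; they represent
  circles without crossings and the ends of bridges.\<close>

record diagram =
  darts :: "nat set"
  opp :: "nat \<Rightarrow> nat"
  nxt :: "nat \<Rightarrow> nat"
  over :: "nat set"

definition vertices :: "diagram \<Rightarrow> nat set set" where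
  "vertices d = orbit (nxt d) ` darts d"

definition edges :: "diagram \<Rightarrow> nat set set" where
  "edges d = orbit (opp d) ` darts d"

definition face_succ :: "diagram \<Rightarrow> nat \<Rightarrow> nat" where
  "face_succ d x = nxt d (opp d x)"

definition faces :: "diagram \<Rightarrow> nat set set" where
  "faces d = orbit (face_succ d) ` darts d"

text \<open>The connected components of the underlying graph (not of the link).\<close>

definition graph_components :: "diagram \<Rightarrow> nat set set" where
  "graph_components d =
     (\<lambda>x. {(y, z). y \<in> darts d \<and> (z = opp d y \<or> z = nxt d y)}\<^sup>* `` {x}) ` darts d"

definition crossing_at :: "diagram \<Rightarrow> nat \<Rightarrow> bool" where
  "crossing_at d x \<longleftrightarrow> x \<in> darts d \<and> card (orbit (nxt d) x) = 4"

definition crossings :: "diagram \<Rightarrow> nat set set" where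
  "crossings d = {v \<in> vertices d. card v = 4}"

text \<open>The last conjunct of the following definition is Euler's formula \<open>V - E + F = 2 C\<close>: every
  connected component is embedded in a sphere. The position of the components relative to each other
  is not recorded, as it does not affect the link type.\<close>

definition link_diagram :: "diagram \<Rightarrow> bool" where
  "link_diagram d \<longleftrightarrow>
     finite (darts d) \<and> darts d \<noteq> {} \<and>
     opp d permutes darts d \<and> (\<forall>x\<in>darts d. opp d x \<noteq> x \<and> opp d (opp d x) = x) \<and>
     nxt d permutes darts d \<and> (\<forall>v\<in>vertices d. card v = 2 \<or> card v = 4) \<and>
     over d \<subseteq> {x. crossing_at d x} \<and>
     (\<forall>x. crossing_at d x \<longrightarrow> (x \<in> over d \<longleftrightarrow> nxt d x \<notin> over d)) \<and>
     card (vertices d) + card (faces d) = card (edges d) + 2 * card (graph_components d)"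

text \<open>The other dart at the same vertex that lies on the same strand.\<close>

definition through :: "diagram \<Rightarrow> nat \<Rightarrow> nat" where
  "through d x = (if crossing_at d x then nxt d (nxt d x) else nxt d x)"


section \<open>Links\<close>

text \<open>A link is an equivalence class of diagrams under isomorphism of diagrams, insertion and deletion
  of points, and Reidemeister moves (with inverses supplied by the symmetric closure).\<close>

definition diagram_iso :: "diagram \<Rightarrow> diagram \<Rightarrow> bool" where
  "diagram_iso d d' \<longleftrightarrow>
     (\<exists>g. bij_betw g (darts d) (darts d') \<and>
       (\<forall>x\<in>darts d. g (opp d x) = opp d' (g x) \<and> g (nxt d x) = nxt d' (g x) \<and>
          (x \<in> over d \<longleftrightarrow> g x \<in> over d')))"

definition forget_point :: "diagram \<Rightarrow> nat \<Rightarrow> diagram" where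
  "forget_point d x = (let y = nxt d x in
     d\<lparr>darts := darts d - {x, y},
       opp := (\<lambda>z. if z \<in> {x, y} then z
                   else if z = opp d x then opp d y
                   else if z = opp d y then opp d x
                   else opp d z),
       nxt := (\<lambda>z. if z \<in> {x, y} then z else nxt d z)\<rparr>)"

text \<open>A circle must keep at least one point, hence the last condition.\<close>

definition point_move :: "diagram \<Rightarrow> diagram \<Rightarrow> bool" where
  "point_move d d' \<longleftrightarrow>
     (\<exists>x\<in>darts d. \<not> crossing_at d x \<and> opp d x \<noteq> nxt d x \<and> d' = forget_point d x)"

text \<open>The edges with darts \<open>K\<close> bound a 1-gon or 2-gon between crossings. They are deleted, and on
  each strand running through one of them, the two darts leaving the 1-gon or 2-gon are joined at a
  new point; the crossings disappear.\<close>

definition pull_apart :: "diagram \<Rightarrow> nat set \<Rightarrow> diagram" where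
  "pull_apart d K =
     d\<lparr>darts := darts d - K,
       opp := (\<lambda>z. if z \<in> K then z else opp d z),
       nxt := (\<lambda>z. if z \<in> K then z
                   else if z \<in> through d ` K then through d (opp d (through d z))
                   else nxt d z),
       over := over d - (K \<union> through d ` K)\<rparr>"

definition reidemeister1 :: "diagram \<Rightarrow> diagram \<Rightarrow> bool" where
  "reidemeister1 d d' \<longleftrightarrow>
     (\<exists>a. crossing_at d a \<and> opp d a = nxt d a \<and> d' = pull_apart d {a, opp d a})"

definition reidemeister2 :: "diagram \<Rightarrow> diagram \<Rightarrow> bool" where
  "reidemeister2 d d' \<longleftrightarrow>
     (\<exists>a b. crossing_at d a \<and> crossing_at d b \<and> orbit (nxt d) a \<noteq> orbit (nxt d) b \<and>
       face_succ d a = b \<and> face_succ d b = a \<and>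
       (a \<in> over d \<longleftrightarrow> opp d a \<in> over d) \<and>
       d' = pull_apart d {a, opp d a, b, opp d b})"

text \<open>In a third Reidemeister move the strand through the side \<open>a\<close> of the triangle meets the same two
  crossings in the opposite order: at each of the two crossings, the dart pointing along the strand in
  one direction takes over the role of the dart of the other crossing pointing in the same direction.
  The strands are pairwise ordered by height; the last but one condition says that this order is not
  cyclic.\<close>

definition slide :: "diagram \<Rightarrow> nat \<Rightarrow> nat \<Rightarrow> nat" where
  "slide d a = transpose a (through d (opp d a)) \<circ> transpose (opp d a) (through d a)"

definition reidemeister3 :: "diagram \<Rightarrow> diagram \<Rightarrow> bool" where
  "reidemeister3 d d' \<longleftrightarrow>
     (\<exists>a b c. crossing_at d a \<and> crossing_at d b \<and> crossing_at d c \<and>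
       orbit (nxt d) a \<noteq> orbit (nxt d) b \<and> orbit (nxt d) b \<noteq> orbit (nxt d) c \<and>
       orbit (nxt d) c \<noteq> orbit (nxt d) a \<and>
       face_succ d a = b \<and> face_succ d b = c \<and> face_succ d c = a \<and>
       \<not> ((a \<in> over d \<longleftrightarrow> b \<in> over d) \<and> (b \<in> over d \<longleftrightarrow> c \<in> over d)) \<and>
       (let s = slide d a \<circ> slide d b \<circ> slide d c in d' = d\<lparr>opp := s \<circ> opp d \<circ> s\<rparr>))"

definition elementary_move :: "diagram \<Rightarrow> diagram \<Rightarrow> bool" where
  "elementary_move d d' \<longleftrightarrow> link_diagram d \<and> link_diagram d' \<and>
     (diagram_iso d d' \<or> point_move d d' \<or>
      reidemeister1 d d' \<or> reidemeister2 d d' \<or> reidemeister3 d d')"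

definition link_of :: "diagram \<Rightarrow> diagram set" where
  "link_of d = {d'. equivclp elementary_move d d'}"

definition is_link :: "diagram set \<Rightarrow> bool" where
  "is_link R \<longleftrightarrow> (\<exists>d. link_diagram d \<and> R = link_of d)"

definition trivial_knot :: "diagram set" where
  "trivial_knot = link_of
     \<lparr>darts = {0, 1}, opp = transpose 0 1, nxt = transpose 0 1, over = {}\<rparr>"

definition trivial_two_component_link :: "diagram set" where
  "trivial_two_component_link = link_of
     \<lparr>darts = {0, 1, 2, 3}, opp = transpose 0 1 \<circ> transpose 2 3,
      nxt = transpose 0 1 \<circ> transpose 2 3, over = {}\<rparr>"


section \<open>Arcs, colorings and the determinant\<close>

text \<open>Arcs end at undercrossings only; an arc is represented by the set of its darts.\<close>

definition arc_of :: "diagram \<Rightarrow> nat \<Rightarrow> nat set" where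
  "arc_of d x =
     {(y, z). y \<in> darts d \<and>
        (z = opp d y \<or> (\<not> crossing_at d y \<or> y \<in> over d) \<and> z = through d y)}\<^sup>* `` {x}"

definition arcs :: "diagram \<Rightarrow> nat set set" where
  "arcs d = arc_of d ` darts d"

definition coloring :: "nat \<Rightarrow> diagram \<Rightarrow> (nat set \<Rightarrow> nat) \<Rightarrow> bool" where
  "coloring m d f \<longleftrightarrow> 1 < m \<and> f ` arcs d \<subseteq> {0..<m} \<and>
     (\<forall>x. crossing_at d x \<and> x \<notin> over d \<longrightarrow>
        [2 * f (arc_of d (nxt d x)) = f (arc_of d x) + f (arc_of d (through d x))] (mod m))"

definition nontrivial_coloring :: "diagram \<Rightarrow> (nat set \<Rightarrow> nat) \<Rightarrow> bool" where
  "nontrivial_coloring d f \<longleftrightarrow> (\<exists>a\<in>arcs d. \<exists>b\<in>arcs d. f a \<noteq> f b)"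

text \<open>The row of a crossing \<open>v\<close> in the coloring matrix is (twice the over-arc) minus (the two
  under-arcs): both darts of the upper strand lie on the over-arc.\<close>

definition coloring_matrix :: "diagram \<Rightarrow> nat set \<Rightarrow> nat set \<Rightarrow> int" where
  "coloring_matrix d v a = (\<Sum>x\<in>v \<inter> a. if x \<in> over d then 1 else -1)"

text \<open>The determinant is the nonnegative generator of the ideal generated by the minors of size
  (number of arcs) - 1 of the coloring matrix. If there are as many arcs as crossings, these are the
  first minors, which are all equal up to sign. If some component has no undercrossing, there are more
  arcs than crossings; the minors may then not exist at all (\<open>Gcd {} = 0\<close>), as for the diagram of the
  trivial link with two components and no crossings.\<close>

definition diagram_minors :: "diagram \<Rightarrow> int set" where
  "diagram_minors d = (let k = card (arcs d) - 1 in
     {det (mat k k (\<lambda>(i, j). coloring_matrix d (r i) (s j))) | r s.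
        inj_on r {0..<k} \<and> r ` {0..<k} \<subseteq> crossings d \<and>
        inj_on s {0..<k} \<and> s ` {0..<k} \<subseteq> arcs d})"

definition diagram_determinant :: "diagram \<Rightarrow> nat" where
  "diagram_determinant d = nat (Gcd (diagram_minors d))"

definition link_determinant :: "diagram set \<Rightarrow> nat" where
  "link_determinant R = (THE D. diagram_determinant ` R = {D})"


section \<open>Rational links and Schubert normal forms\<close>

text \<open>A path along a strand of the diagram, as the list of its darts pointing in the direction of
  travel, from a point to a point and through crossings in between.\<close>

definition strand_path :: "diagram \<Rightarrow> nat list \<Rightarrow> bool" where
  "strand_path d W \<longleftrightarrow> W \<noteq> [] \<and> set W \<subseteq> darts d \<and>
     \<not> crossing_at d (hd W) \<and> \<not> crossing_at d (opp d (last W)) \<and>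
     successively (\<lambda>x y. crossing_at d (opp d x) \<and> y = through d (opp d x)) W"

definition reverse_path :: "diagram \<Rightarrow> nat list \<Rightarrow> nat list" where
  "reverse_path d W = rev (map (opp d) W)"

definition path_darts :: "diagram \<Rightarrow> nat list \<Rightarrow> nat set" where
  "path_darts d W = set W \<union> opp d ` set W"

definition path_ends :: "diagram \<Rightarrow> nat list \<Rightarrow> nat set" where
  "path_ends d W = {hd W, opp d (last W)}"

text \<open>The darts by which the path enters the crossings it passes, in order.\<close>

definition passes :: "diagram \<Rightarrow> nat list \<Rightarrow> nat list" where
  "passes d W = map (opp d) (butlast W)"

text \<open>\<open>A\<close>, \<open>B\<close> are the bridges and \<open>U\<close>, \<open>V\<close> the under-strands. Together they make up the whole
  diagram, and the only points are the four ends of the bridges.\<close>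

definition two_bridge_presentation ::
  "diagram \<Rightarrow> nat list \<Rightarrow> nat list \<Rightarrow> nat list \<Rightarrow> nat list \<Rightarrow> bool" where
  "two_bridge_presentation d A B U V \<longleftrightarrow> link_diagram d \<and>
     (\<forall>W\<in>{A, B, U, V}. strand_path d W) \<and>
     distinct (concat (map (\<lambda>W. W @ reverse_path d W) [A, B, U, V])) \<and>
     path_darts d A \<union> path_darts d B \<union> path_darts d U \<union> path_darts d V = darts d \<and>
     nxt d ` (path_ends d A \<union> path_ends d B) = path_ends d U \<union> path_ends d V \<and>
     (\<forall>W\<in>{A, B}. set (passes d W) \<subseteq> over d) \<and>
     (\<forall>W\<in>{U, V}. set (passes d W) \<inter> over d = {})"

definition rational_link :: "diagram set \<Rightarrow> bool" where
  "rational_link R \<longleftrightarrow> is_link R \<and> (\<exists>d\<in>R. \<exists>A B U V. two_bridge_presentation d A B U V)"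

text \<open>Lists of truth values record which of two bridges (or which of two under-strands) is met: for an
  entering dart \<open>x\<close>, the dart \<open>nxt d x\<close> lies on the other strand of the crossing. For an under-strand
  \<open>W\<close> the first entry is the bridge from whose end it starts.\<close>

definition schubert_normal_form :: "diagram \<Rightarrow> bool" where
  "schubert_normal_form d \<longleftrightarrow> (\<exists>A B U V. two_bridge_presentation d A B U V \<and>
     (\<forall>W\<in>{U, reverse_path d U, V, reverse_path d V}.
        distinct_adj (map (\<lambda>x. nxt d x \<in> path_darts d A) (hd W # passes d W))) \<and>
     (\<forall>W\<in>{A, B}. distinct_adj (map (\<lambda>x. nxt d x \<in> path_darts d U) (passes d W))))"

end

theory Submission imports Defs
begin

text \<open>The determinant is read off from numbers of colorings. Color the darts instead of the arcs, so that
  no arc has to be followed through a move: each elementary move then matches the colorings modulo \<open>m\<close>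
  of the two diagrams one to one (\<open>card_dart_colorings_link\<close>). The number of colorings modulo every
  \<open>m\<close> in turn knows enough of the coloring matrix: if it is \<open>m * gcd m \<alpha>\<close> for all \<open>m > 0\<close>, then the
  cokernel of the matrix is \<open>\<int> \<oplus> \<int>/\<alpha>\<close> and the minors of corank one generate the ideal of \<open>\<alpha>\<close>
  (\<open>Gcd_corank_1_minors\<close>). Hence it suffices to color the Schubert normal form itself, and the
  determinants of all other diagrams of the link follow.

  In a Schubert normal form a coloring is determined by the colors \<open>u\<close> and \<open>v\<close> of the two bridges. An
  under-strand passes below the bridges alternately; if it starts at the bridge of color \<open>u\<close>, then with
  \<open>w = v - u\<close> its successive colors are \<open>u\<close>, \<open>u + 2 w\<close>, \<open>u - 2 w\<close>, \<open>u + 4 w\<close>, \<open>u - 4 w\<close>, and so on, and its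
  arrival at the last bridge amounts to the single condition \<open>l * w = 0\<close>, where \<open>l\<close> is the number of
  its edges. So the determinant \<open>D\<close> is the greatest common divisor of the lengths of the two
  under-strands, where an under-strand that returns to its bridge without passing below any bridge counts as 0
  (\<open>card_dart_colorings_schubert\<close>). Now take \<open>u = 0\<close> and \<open>v = 1\<close>. If the under-strands join
  different bridges, then \<open>D\<close> is odd and the multiples of \<open>2\<close> met along one under-strand exhaust all
  residues; otherwise \<open>D\<close> is even, one under-strand takes the even colors and the other one the odd
  colors (\<open>surjective_coloring\<close>).

  This is a non-trivial coloring as soon as \<open>D \<ge> 2\<close>, which follows from planarity and the
  hypothesis on the link. In the case of odd \<open>D\<close>, Euler's formula leaves no room for faces other than quadrilaterals
  (\<open>face_succ_4\<close>): outside of the two bridges the sphere is an annulus, cut by the edges of the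
  under-strands into quadrilaterals. Its rotation by half a turn maps the diagram to itself and
  exchanges the two under-strands, which therefore have the same length \<open>D\<close>
  (\<open>joined_strands_same_length\<close>). So \<open>D < 2\<close> leaves no crossing at all, and a diagram of this kind
  without crossings represents the trivial knot or the trivial link with two components
  (\<open>crossingless_trivial\<close>).\<close>


section \<open>Minors of integer matrices and solutions modulo m\<close>

definition minors :: "('r \<Rightarrow> 'c \<Rightarrow> int) \<Rightarrow> 'r set \<Rightarrow> 'c set \<Rightarrow> nat \<Rightarrow> int set" where
  "minors a R C k = {det (mat k k (\<lambda>(i, j). a (r i) (s j))) | r s.
     inj_on r {0..<k} \<and> r ` {0..<k} \<subseteq> R \<and> inj_on s {0..<k} \<and> s ` {0..<k} \<subseteq> C}"

definition solutions :: "int \<Rightarrow> ('r \<Rightarrow> 'c \<Rightarrow> int) \<Rightarrow> 'r set \<Rightarrow> 'c set \<Rightarrow> ('c \<Rightarrow> int) set" where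
  "solutions m a R C = {x \<in> C \<rightarrow>\<^sub>E {0..<m}. \<forall>r\<in>R. m dvd (\<Sum>c\<in>C. a r c * x c)}"

lemma minorsI:
  assumes "inj_on r {0..<k}" "r ` {0..<k} \<subseteq> R" "inj_on s {0..<k}" "s ` {0..<k} \<subseteq> C"
  shows "det (mat k k (\<lambda>(i, j). a (r i) (s j))) \<in> minors a R C k"
  using assms unfolding minors_def by blast

lemma inj_on_extend:
  assumes "inj_on r {0..<k}" "i \<notin> r ` {0..<k}"
  shows "inj_on (r(k := i)) {0..<Suc k}"
  unfolding atLeast0_lessThan_Suc inj_on_insert using assms by (auto intro: inj_on_fun_updI)

text \<open>Cramer's rule: multiplying the system by the adjugate matrix isolates each unknown.\<close>

lemma det_dvd_solution:
  fixes a :: "'r \<Rightarrow> 'c \<Rightarrow> int"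
  assumes s: "bij_betw s {0..<k} C" and c: "c \<in> C"
    and r: "\<And>i. i < k \<Longrightarrow> m dvd (\<Sum>c\<in>C. a (r i) c * x c)"
  shows "m dvd det (mat k k (\<lambda>(i, j). a (r i) (s j))) * x c"
proof -
  define M where "M = mat k k (\<lambda>(i, j). a (r i) (s j))"
  have M: "M \<in> carrier_mat k k" by (simp add: M_def)
  obtain l where l: "l < k" "s l = c" using s c by (auto simp: bij_betw_def)
  have adj: "adj_mat M \<in> carrier_mat k k" "adj_mat M * M = det M \<cdot>\<^sub>m 1\<^sub>m k"
    using adj_mat[OF M] by auto
  have row: "m dvd (\<Sum>j<k. M $$ (i, j) * x (s j))" if "i < k" for i
  proof -
    have "(\<Sum>c\<in>C. a (r i) c * x c) = (\<Sum>j\<in>{0..<k}. a (r i) (s j) * x (s j))"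
      by (rule sum.reindex_bij_betw[OF s, symmetric])
    also have "\<dots> = (\<Sum>j<k. M $$ (i, j) * x (s j))"
      using that by (intro sum.cong) (auto simp: M_def)
    finally show ?thesis using r[OF that] by simp
  qed
  have "det M * x c = (\<Sum>j<k. (det M \<cdot>\<^sub>m 1\<^sub>m k) $$ (l, j) * x (s j))"
    using l by (simp add: if_distrib if_distribR cong: if_cong)
  also have "\<dots> = (\<Sum>j<k. (\<Sum>i<k. adj_mat M $$ (l, i) * M $$ (i, j)) * x (s j))"
    using l M adj(1) unfolding adj(2)[symmetric]
    by (intro sum.cong) (auto simp: scalar_prod_def atLeast0LessThan)
  also have "\<dots> = (\<Sum>i<k. adj_mat M $$ (l, i) * (\<Sum>j<k. M $$ (i, j) * x (s j)))"
    by (simp add: sum_distrib_left sum_distrib_right mult.assoc) (rule sum.swap)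
  finally show ?thesis unfolding M_def[symmetric] using row by (auto intro!: dvd_sum)
qed

text \<open>Expand the minor that is obtained by bordering the given one with a row \<open>i\<close> and the column \<open>c\<close>
  along the new row. The cofactors do not depend on \<open>i\<close>; they are the vector \<open>y\<close>. If all larger minors
  vanish modulo some number, then \<open>y\<close> is a solution of the whole system, and its entry at \<open>c\<close> is the
  given minor.\<close>

lemma bordered_minor_vector:
  fixes a :: "'r \<Rightarrow> 'c \<Rightarrow> int"
  assumes C: "finite C" and s: "inj_on s {0..<k}" "s ` {0..<k} \<subseteq> C" and c: "c \<in> C" "c \<notin> s ` {0..<k}"
  obtains y where "y c = det (mat k k (\<lambda>(i, j). a (r i) (s j)))"
    and "\<And>c'. c' \<noteq> c \<Longrightarrow> c' \<notin> s ` {0..<k} \<Longrightarrow> y c' = 0"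
    and "\<And>i. (\<Sum>c'\<in>C. a i c' * y c') =
      det (mat (Suc k) (Suc k) (\<lambda>(i', j'). a ((r(k := i)) i') ((s(k := c)) j')))"
proof -
  define t where "t = s(k := c)"
  define M where "M i = mat (Suc k) (Suc k) (\<lambda>(i', j'). a ((r(k := i)) i') (t j'))" for i
  define w where "w j = cofactor (M undefined) k j" for j
  have w: "cofactor (M i) k j = w j" if "j < Suc k" for i j
  proof -
    have "mat_delete (M i) k j = mat_delete (M undefined) k j"
      unfolding mat_delete_def M_def by (rule cong_mat) (use that in simp_all)
    then show ?thesis by (simp add: w_def cofactor_def)
  qed
  have det: "det (M i) = (\<Sum>j<Suc k. a i (t j) * w j)" for i
  proof -
    have "M i \<in> carrier_mat (Suc k) (Suc k)" by (simp add: M_def)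
    from laplace_expansion_row[OF this, of k]
    have "det (M i) = (\<Sum>j<Suc k. M i $$ (k, j) * cofactor (M i) k j)" by simp
    also have "\<dots> = (\<Sum>j<Suc k. a i (t j) * w j)"
      by (rule sum.cong[OF refl]) (simp only: lessThan_iff w, simp add: M_def)
    finally show ?thesis .
  qed
  have inj: "inj_on t {..<Suc k}"
    using inj_on_extend[OF s(1) c(2)] by (simp add: t_def atLeast0LessThan)
  have tC: "t ` {..<Suc k} \<subseteq> C" using s c by (auto simp: t_def less_Suc_eq)
  define y where "y c' = (if c' \<in> t ` {..<Suc k} then w (the_inv_into {..<Suc k} t c') else 0)" for c'
  have yt: "y (t j) = w j" if "j < Suc k" for j
    using the_inv_into_f_f[OF inj] that by (auto simp: y_def)
  have sum: "(\<Sum>c'\<in>C. a i c' * y c') = det (M i)" for i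
  proof -
    have "(\<Sum>c'\<in>C. a i c' * y c') = (\<Sum>c'\<in>t ` {..<Suc k}. a i c' * y c')"
      by (rule sum.mono_neutral_right[OF C tC]) (auto simp: y_def)
    also have "\<dots> = (\<Sum>j<Suc k. a i (t j) * y (t j))" by (simp only: sum.reindex[OF inj] o_def)
    also have "\<dots> = det (M i)" unfolding det by (intro sum.cong) (auto simp: yt)
    finally show ?thesis .
  qed
  have "y c = w k" using yt[of k] by (simp add: t_def)
  also have "w k = det (mat_delete (M undefined) k k)" by (simp add: w_def cofactor_def)
  also have "mat_delete (M undefined) k k = mat k k (\<lambda>(i, j). a (r i) (s j))"
    by (rule eq_matI) (auto simp: mat_delete_def M_def t_def)
  finally have yc: "y c = det (mat k k (\<lambda>(i, j). a (r i) (s j)))" .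
  have "y c' = 0" if "c' \<noteq> c" "c' \<notin> s ` {0..<k}" for c'
    using that by (auto simp: y_def t_def less_Suc_eq)
  with yc sum that show ?thesis unfolding M_def t_def by blast
qed

lemma bordered_det_cases:
  fixes a :: "'r \<Rightarrow> 'c \<Rightarrow> int"
  assumes r: "inj_on r {0..<k}" "r ` {0..<k} \<subseteq> R" and i: "i \<in> R"
    and s: "inj_on s {0..<k}" "s ` {0..<k} \<subseteq> C" and c: "c \<in> C" "c \<notin> s ` {0..<k}"
  defines "e \<equiv> det (mat (Suc k) (Suc k) (\<lambda>(i', j'). a ((r(k := i)) i') ((s(k := c)) j')))"
  shows "e = 0 \<or> e \<in> minors a R C (Suc k)"
proof (cases "i \<in> r ` {0..<k}")
  case True
  then obtain l where l: "l < k" "r l = i" by auto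
  have "e = 0" unfolding e_def
    by (rule det_identical_rows[of _ "Suc k" l k]) (use l in \<open>auto intro: eq_vecI\<close>)
  then show ?thesis ..
next
  case False
  have "e \<in> minors a R C (Suc k)" unfolding e_def
    using r s c i False by (intro minorsI inj_on_extend) (auto simp: less_Suc_eq)
  then show ?thesis ..
qed


lemma finite_solutions: "finite C \<Longrightarrow> finite (solutions m a R C)"
  by (rule finite_subset[of _ "C \<rightarrow>\<^sub>E {0..<m}"]) (auto simp: solutions_def intro: finite_PiE)

lemma solutionsD:
  assumes "x \<in> solutions m a R C"
  shows "r \<in> R \<Longrightarrow> m dvd (\<Sum>c\<in>C. a r c * x c)" and "c \<in> C \<Longrightarrow> 0 \<le> x c" and "c \<in> C \<Longrightarrow> x c < m"
    and "c \<notin> C \<Longrightarrow> x c = undefined"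
  using assms by (auto simp: solutions_def PiE_def extensional_def)

lemma residue_vector_solution:
  assumes "m > 0" and "\<And>r. r \<in> R \<Longrightarrow> m dvd (\<Sum>c\<in>C. a r c * y c)"
  shows "(\<lambda>c\<in>C. y c mod m) \<in> solutions m a R C"
proof -
  have "m dvd (\<Sum>c\<in>C. a r c * (y c mod m))" if "r \<in> R" for r
  proof -
    have "(\<Sum>c\<in>C. a r c * (y c mod m)) mod m = (\<Sum>c\<in>C. a r c * (y c mod m) mod m) mod m"
      by (rule mod_sum_eq[symmetric])
    also have "\<dots> = (\<Sum>c\<in>C. a r c * y c mod m) mod m" by (simp only: mod_mult_right_eq)
    also have "\<dots> = (\<Sum>c\<in>C. a r c * y c) mod m" by (rule mod_sum_eq)
    finally have "(\<Sum>c\<in>C. a r c * (y c mod m)) mod m = (\<Sum>c\<in>C. a r c * y c) mod m" .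
    then show ?thesis using assms(2)[OF that] unfolding dvd_eq_mod_eq_0 by (rule trans)
  qed
  then show ?thesis using assms(1) by (auto simp: solutions_def)
qed

text \<open>The minor of size 0 is 1, so that there is a largest size for which some minor is a unit modulo \<open>p\<close>.\<close>

lemma obtain_maximal_minor:
  fixes a :: "'r \<Rightarrow> 'c \<Rightarrow> int"
  assumes C: "finite C" and p: "prime p"
  obtains k r s where "k \<le> card C" "inj_on r {0..<k}" "r ` {0..<k} \<subseteq> R" "inj_on s {0..<k}" "s ` {0..<k} \<subseteq> C"
    "\<not> p dvd det (mat k k (\<lambda>(i, j). a (r i) (s j)))"
    "\<And>M. M \<in> minors a R C (Suc k) \<Longrightarrow> p dvd M"
proof -
  define P where "P k \<longleftrightarrow> (\<exists>M\<in>minors a R C k. \<not> p dvd M)" for k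
  have le: "k \<le> card C" if "P k" for k
  proof -
    from that obtain s :: "nat \<Rightarrow> 'c" where "inj_on s {0..<k}" "s ` {0..<k} \<subseteq> C"
      unfolding P_def minors_def by auto
    then show ?thesis using card_inj_on_le[of s "{0..<k}" C] C by simp
  qed
  have "det (mat 0 0 (\<lambda>(i, j). a (undefined i) (undefined j))) \<in> minors a R C 0"
    by (rule minorsI) auto
  then have "1 \<in> minors a R C 0" by simp
  moreover have "\<not> p dvd 1" using p by (auto simp: prime_int_iff)
  ultimately have "P 0" unfolding P_def by blast
  then have "P (GREATEST k. P k)" using le by (rule GreatestI_nat)
  moreover have "\<not> P (Suc (GREATEST k. P k))"
    using Greatest_le_nat[of P _ "card C"] le by (metis Suc_n_not_le_n)
  ultimately obtain k where k: "P k" "\<not> P (Suc k)" by blast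
  have "\<And>M. M \<in> minors a R C (Suc k) \<Longrightarrow> p dvd M" using k(2) unfolding P_def by blast
  moreover obtain r s where "inj_on r {0..<k}" "r ` {0..<k} \<subseteq> R" "inj_on s {0..<k}" "s ` {0..<k} \<subseteq> C"
    "\<not> p dvd det (mat k k (\<lambda>(i, j). a (r i) (s j)))"
    using k(1) unfolding P_def minors_def by auto
  ultimately show ?thesis using le[OF k(1)] that by blast
qed

text \<open>Two columns outside of a maximal non-zero minor would give two vectors of cofactors. Each of them
  has a unit where the other one vanishes, so that their combinations are \<open>p * p\<close> different solutions.\<close>

lemma corank_le_1_if_few_solutions:
  fixes a :: "'r \<Rightarrow> 'c \<Rightarrow> int"
  assumes C: "finite C" and p: "prime p" and few: "card (solutions (int p) a R C) \<le> p"
    and r: "inj_on r {0..<k}" "r ` {0..<k} \<subseteq> R" and s: "inj_on s {0..<k}" "s ` {0..<k} \<subseteq> C"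
    and unit: "\<not> int p dvd det (mat k k (\<lambda>(i, j). a (r i) (s j)))"
    and max: "\<And>M. M \<in> minors a R C (Suc k) \<Longrightarrow> int p dvd M"
  shows "card C \<le> Suc k"
proof (rule ccontr)
  assume "\<not> card C \<le> Suc k"
  moreover have "card (s ` {0..<k}) = k" using card_image[OF s(1)] by simp
  ultimately have "1 < card (C - s ` {0..<k})" using card_Diff_subset[of "s ` {0..<k}" C] s(2) by simp
  then have "\<not> card (C - s ` {0..<k}) \<le> Suc 0" by simp
  then have "\<not> (\<forall>c\<in>C - s ` {0..<k}. \<forall>c'\<in>C - s ` {0..<k}. c = c')"
    by (subst card_le_Suc0_iff_eq[symmetric]) (use C in simp_all)
  then obtain c1 c2 where c: "c1 \<noteq> c2" "c1 \<in> C" "c1 \<notin> s ` {0..<k}" "c2 \<in> C" "c2 \<notin> s ` {0..<k}" by blast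
  define u where "u = det (mat k k (\<lambda>(i, j). a (r i) (s j)))"
  have vec: "\<exists>y. y c = u \<and> (\<forall>c'. c' \<noteq> c \<longrightarrow> c' \<notin> s ` {0..<k} \<longrightarrow> y c' = 0) \<and>
      (\<forall>i\<in>R. int p dvd (\<Sum>c'\<in>C. a i c' * y c'))" if cc: "c \<in> C" "c \<notin> s ` {0..<k}" for c
  proof -
    obtain y where y: "y c = u" "\<And>c'. c' \<noteq> c \<Longrightarrow> c' \<notin> s ` {0..<k} \<Longrightarrow> y c' = 0"
      "\<And>i. (\<Sum>c'\<in>C. a i c' * y c') =
        det (mat (Suc k) (Suc k) (\<lambda>(i', j'). a ((r(k := i)) i') ((s(k := c)) j')))"
      by (rule bordered_minor_vector[OF C s cc, of a r, folded u_def]) (rule that)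
    have "int p dvd (\<Sum>c'\<in>C. a i c' * y c')" if "i \<in> R" for i
    proof -
      have "(\<Sum>c'\<in>C. a i c' * y c') = 0 \<or> (\<Sum>c'\<in>C. a i c' * y c') \<in> minors a R C (Suc k)"
        unfolding y(3) by (rule bordered_det_cases[OF r that s cc])
      then show ?thesis using max by (metis dvd_0_right)
    qed
    then show ?thesis using y(1,2) by (intro exI[of _ y]) simp
  qed
  obtain y1 where y1: "y1 c1 = u" "y1 c2 = 0" "\<forall>i\<in>R. int p dvd (\<Sum>c\<in>C. a i c * y1 c)"
    using vec[OF c(2,3)] by (elim exE conjE) (rule that, use c in simp_all)
  obtain y2 where y2: "y2 c2 = u" "y2 c1 = 0" "\<forall>i\<in>R. int p dvd (\<Sum>c\<in>C. a i c * y2 c)"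
    using vec[OF c(4,5)] by (elim exE conjE) (rule that, use c in simp_all)
  define F where "F = (\<lambda>(t1, t2). (\<lambda>c\<in>C. (t1 * y1 c + t2 * y2 c) mod int p))"
  have "F z \<in> solutions (int p) a R C" for z
  proof -
    obtain t1 t2 where z: "z = (t1, t2)" by force
    have "int p dvd (\<Sum>c\<in>C. a i c * (t1 * y1 c + t2 * y2 c))" if "i \<in> R" for i
    proof -
      have "(\<Sum>c\<in>C. a i c * (t1 * y1 c + t2 * y2 c)) =
          t1 * (\<Sum>c\<in>C. a i c * y1 c) + t2 * (\<Sum>c\<in>C. a i c * y2 c)"
        by (simp add: sum_distrib_left sum.distrib algebra_simps)
      then show ?thesis using y1(3) y2(3) that by simp
    qed
    then show ?thesis unfolding F_def z prod.case
      using p by (intro residue_vector_solution) (auto simp: prime_gt_0_nat)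
  qed
  moreover have "inj_on F ({0..<int p} \<times> {0..<int p})"
  proof (rule inj_onI, clarify)
    have cancel: "t = t'" if "(t * u) mod int p = (t' * u) mod int p" "t \<in> {0..<int p}" "t' \<in> {0..<int p}" for t t'
    proof -
      have "int p dvd (t - t') * u" using that(1) by (simp add: mod_eq_dvd_iff left_diff_distrib)
      then have "int p dvd t - t'" using unit[folded u_def] p prime_dvd_multD[of "int p"] by auto
      then show ?thesis using that(2,3) by (simp add: mod_eq_dvd_iff[symmetric])
    qed
    fix t1 t2 t1' t2' assume t: "t1 \<in> {0..<int p}" "t2 \<in> {0..<int p}" "t1' \<in> {0..<int p}" "t2' \<in> {0..<int p}"
      and eq: "F (t1, t2) = F (t1', t2')"
    have "(t1 * u) mod int p = (t1' * u) mod int p"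
      using fun_cong[OF eq, of c1] c(2) by (simp add: F_def y1 y2)
    moreover have "(t2 * u) mod int p = (t2' * u) mod int p"
      using fun_cong[OF eq, of c2] c(4) by (simp add: F_def y1 y2)
    ultimately show "t1 = t1' \<and> t2 = t2'" using cancel t by blast
  qed
  ultimately have "card ({0..<int p} \<times> {0..<int p}) \<le> card (solutions (int p) a R C)"
    by (intro card_inj_on_le[of F]) (auto intro: finite_solutions C)
  then have "p * p \<le> card (solutions (int p) a R C)" unfolding card_cartesian_product by simp
  with few have "p * p \<le> p" by (rule le_trans[rotated])
  then show False using prime_gt_1_nat[OF p] by simp
qed

text \<open>This is the local form of the statement that a module with \<open>gcd m \<alpha>\<close> homomorphisms to \<open>\<int>/m\<close> for
  every \<open>m\<close> is cyclic of order \<open>\<alpha>\<close>, so that its zeroth Fitting ideal is generated by \<open>\<alpha>\<close>. A Smith normal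
  form is avoided: modulo \<open>p\<close> the rank is either full, and no power of \<open>p\<close> divides all maximal
  minors, or one less than full. In the second case fix a unit minor that misses only the column \<open>c\<close>.\<close>

lemma prime_power_dvd_minors_iff:
  fixes a :: "'r \<Rightarrow> 'c \<Rightarrow> int"
  assumes C: "finite C" and p: "prime p"
    and num: "\<And>m. m > 0 \<Longrightarrow> card (solutions (int m) a R C) = gcd m \<alpha>"
  shows "(\<forall>M\<in>minors a R C (card C). int (p ^ f) dvd M) \<longleftrightarrow> p ^ f dvd \<alpha>"
proof (cases "f = 0")
  case False
  define q where "q = int (p ^ f)"
  have q0: "q > 0" using p by (simp add: q_def prime_gt_0_nat)
  have pq: "int p dvd q" using False by (simp add: q_def)
  have nump: "card (solutions (int p) a R C) = gcd p \<alpha>" using num p by (simp add: prime_gt_0_nat)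
  then have few: "card (solutions (int p) a R C) \<le> p"
    using p by (simp add: prime_gt_0_nat)
  obtain k r s where k: "k \<le> card C" and r: "inj_on r {0..<k}" "r ` {0..<k} \<subseteq> R"
    and s: "inj_on s {0..<k}" "s ` {0..<k} \<subseteq> C"
    and unit: "\<not> int p dvd det (mat k k (\<lambda>(i, j). a (r i) (s j)))"
    and max: "\<And>M. M \<in> minors a R C (Suc k) \<Longrightarrow> int p dvd M"
    by (rule obtain_maximal_minor[OF C, of "int p" R a]) (use p in simp, rule that)
  define u where "u = det (mat k k (\<lambda>(i, j). a (r i) (s j)))"
  have cop: "coprime q u" using unit p False unfolding u_def q_def
    by (simp add: prime_imp_coprime)
  have le: "card C \<le> Suc k" by (rule corank_le_1_if_few_solutions[OF C p few r s unit max])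
  have cards: "card (s ` {0..<k}) = k" using card_image[OF s(1)] by simp
  show ?thesis
  proof (cases "card C = k")
    case True
    have sC: "bij_betw s {0..<k} C" using s card_subset_eq[OF C s(2)] cards True by (auto simp: bij_betw_def)
    have "u \<in> minors a R C (card C)" unfolding u_def True by (rule minorsI[OF r s])
    then have no: "\<not> (\<forall>M\<in>minors a R C (card C). q dvd M)" using unit pq dvd_trans unfolding u_def by blast
    have "solutions (int p) a R C \<subseteq> {\<lambda>c\<in>C. 0}"
    proof
      fix x assume x: "x \<in> solutions (int p) a R C"
      have "x c = 0" if "c \<in> C" for c
      proof -
        have "int p dvd u * x c" unfolding u_def
          by (rule det_dvd_solution[OF sC that], rule solutionsD(1)[OF x]) (use r in auto)
        then have "int p dvd x c" using unit[folded u_def] p prime_dvd_multD[of "int p"] by auto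
        moreover have "0 \<le> x c" "x c < int p" using solutionsD(2,3)[OF x that] by auto
        ultimately show ?thesis using zdvd_imp_le[of "int p" "x c"] by linarith
      qed
      then show "x \<in> {\<lambda>c\<in>C. 0}" using x by (auto simp: solutions_def PiE_def extensional_def)
    qed
    then have "card (solutions (int p) a R C) \<le> 1" using card_mono[of "{\<lambda>c\<in>C. 0}"] by (metis finite.emptyI finite.insertI is_singletonI is_singleton_altdef)
    then have "gcd p \<alpha> \<noteq> p" using nump prime_gt_1_nat[OF p] by simp
    then have "\<not> p dvd \<alpha>" by (metis gcd_nat.absorb1)
    then have "\<not> p ^ f dvd \<alpha>" using False by (meson dvd_power dvd_trans neq0_conv)
    with no show ?thesis by (simp add: q_def)
  next
    case neq: False
    with le k have Ck: "card C = Suc k" by simp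
    then have "card (C - s ` {0..<k}) = 1" using card_Diff_subset[of "s ` {0..<k}" C] s(2) cards by simp
    then obtain c where c: "C - s ` {0..<k} = {c}" by (auto simp: card_1_singleton_iff)
    then have cC: "c \<in> C" "c \<notin> s ` {0..<k}" by auto
    have qf: "card (solutions q a R C) = gcd (p ^ f) \<alpha>" using num[of "p ^ f"] q0 by (simp add: q_def)
    show ?thesis
    proof
      assume all: "\<forall>M\<in>minors a R C (card C). int (p ^ f) dvd M"
      obtain y where y: "y c = u"
        "\<And>i. (\<Sum>c'\<in>C. a i c' * y c') =
          det (mat (Suc k) (Suc k) (\<lambda>(i', j'). a ((r(k := i)) i') ((s(k := c)) j')))"
        by (rule bordered_minor_vector[OF C s cC, of a r, folded u_def]) (rule that)
      have dv: "q dvd (\<Sum>c'\<in>C. a i c' * y c')" if "i \<in> R" for i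
      proof -
        have "(\<Sum>c'\<in>C. a i c' * y c') = 0 \<or> (\<Sum>c'\<in>C. a i c' * y c') \<in> minors a R C (card C)"
          unfolding y(2) Ck by (rule bordered_det_cases[OF r that s cC])
        then show ?thesis using all by (metis dvd_0_right q_def)
      qed
      \<comment> \<open>The multiples of the cofactor vector are \<open>q\<close> different solutions, which forces \<open>q\<close> to divide \<open>\<alpha>\<close>.\<close>
      define F where "F t = (\<lambda>c\<in>C. (t * y c) mod q)" for t
      have "F t \<in> solutions q a R C" for t
      proof -
        have "q dvd (\<Sum>c\<in>C. a i c * (t * y c))" if "i \<in> R" for i
        proof -
          have "(\<Sum>c\<in>C. a i c * (t * y c)) = t * (\<Sum>c\<in>C. a i c * y c)"
            by (simp add: sum_distrib_left algebra_simps)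
          then show ?thesis using dv[OF that] by simp
        qed
        then show ?thesis unfolding F_def by (rule residue_vector_solution[OF q0])
      qed
      moreover have "inj_on F {0..<q}"
      proof (rule inj_onI)
        fix t t' assume t: "t \<in> {0..<q}" "t' \<in> {0..<q}" and eq: "F t = F t'"
        have "(t * u) mod q = (t' * u) mod q" using fun_cong[OF eq, of c] cC y(1) by (simp add: F_def)
        then have "q dvd (t - t') * u" by (simp add: mod_eq_dvd_iff left_diff_distrib)
        then have "q dvd t - t'" using cop by (simp add: coprime_dvd_mult_left_iff)
        then show "t = t'" using t by (simp add: mod_eq_dvd_iff[symmetric])
      qed
      ultimately have "card {0..<q} \<le> card (solutions q a R C)"
        by (intro card_inj_on_le[of F]) (auto intro: finite_solutions C)
      then have "p ^ f \<le> gcd (p ^ f) \<alpha>" using qf by (simp add: q_def del: of_nat_power)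
      moreover have "gcd (p ^ f) \<alpha> \<le> p ^ f" using p by (intro dvd_imp_le) (auto simp: prime_gt_0_nat)
      ultimately have "gcd (p ^ f) \<alpha> = p ^ f" by simp
      then show "p ^ f dvd \<alpha>" by (metis gcd_dvd2)
    next
      assume "p ^ f dvd \<alpha>"
      then have full: "card (solutions q a R C) = p ^ f" using qf by (simp add: gcd_nat.absorb1)
      \<comment> \<open>By the unit minor, the entry at \<open>c\<close> determines a solution. There are as many solutions as residues
        modulo \<open>q\<close>, hence one with entry 1, to which Cramer's rule can be applied.\<close>
      have "inj_on (\<lambda>x. x c) (solutions q a R C)"
      proof (rule inj_onI)
        fix x x' assume x: "x \<in> solutions q a R C" "x' \<in> solutions q a R C" and eq: "x c = x' c"
        have "x d = x' d" if d: "d \<in> C" for d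
        proof (cases "d = c")
          case False
          then have dk: "d \<in> s ` {0..<k}" using d c by blast
          have "q dvd (\<Sum>d\<in>s ` {0..<k}. a i d * (x d - x' d))" if "i \<in> R" for i
          proof -
            have "q dvd (\<Sum>c\<in>C. a i c * x c) - (\<Sum>c\<in>C. a i c * x' c)"
              using x that by (auto simp: solutions_def intro: dvd_diff)
            also have "\<dots> = (\<Sum>d\<in>C. a i d * (x d - x' d))"
              by (simp add: sum_subtractf right_diff_distrib)
            also have "\<dots> = (\<Sum>d\<in>s ` {0..<k}. a i d * (x d - x' d))"
              using C s(2) c eq by (intro sum.mono_neutral_right) auto
            finally show ?thesis .
          qed
          then have "q dvd (\<Sum>d\<in>s ` {0..<k}. a (r i) d * (x d - x' d))" if "i < k" for i
            using r(2) that by (auto simp: image_subset_iff)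
          then have "q dvd u * (x d - x' d)" unfolding u_def
            by (rule det_dvd_solution[OF inj_on_imp_bij_betw[OF s(1)] dk])
          then have "q dvd x d - x' d" using cop by (simp add: coprime_dvd_mult_right_iff)
          moreover have "x d \<in> {0..<q}" "x' d \<in> {0..<q}" using x d by (auto simp: solutions_def)
          ultimately show ?thesis by (simp add: mod_eq_dvd_iff[symmetric])
        qed (use eq in simp)
        then show "x = x'" using solutionsD(4)[OF x(1)] solutionsD(4)[OF x(2)] by (intro ext) metis
      qed
      then have "card ((\<lambda>x. x c) ` solutions q a R C) = card {0..<q}"
        using full by (simp add: card_image q_def del: of_nat_power)
      moreover have "(\<lambda>x. x c) ` solutions q a R C \<subseteq> {0..<q}" using cC by (auto simp: solutions_def)
      ultimately have img: "(\<lambda>x. x c) ` solutions q a R C = {0..<q}" by (intro card_subset_eq) auto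
      have "p ^ f > 1" using prime_gt_1_nat[OF p] False by (metis one_less_power neq0_conv)
      then have "1 \<in> {0..<q}" by (simp add: q_def del: of_nat_power)
      then have "1 \<in> (\<lambda>x. x c) ` solutions q a R C" unfolding img .
      then obtain x where x: "x \<in> solutions q a R C" "x c = 1" by auto
      show "\<forall>M\<in>minors a R C (card C). int (p ^ f) dvd M"
      proof
        fix M assume "M \<in> minors a R C (card C)"
        then obtain r' s' where M: "M = det (mat (card C) (card C) (\<lambda>(i, j). a (r' i) (s' j)))"
          "inj_on r' {0..<card C}" "r' ` {0..<card C} \<subseteq> R" "inj_on s' {0..<card C}" "s' ` {0..<card C} \<subseteq> C"
          by (auto simp: minors_def)
        have "bij_betw s' {0..<card C} C"
          using M(4,5) card_subset_eq[OF C M(5)] card_image[OF M(4)] by (simp add: bij_betw_def)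
        then have "q dvd M * x c" unfolding M(1)
          by (rule det_dvd_solution[OF _ cC(1)]) (rule solutionsD(1)[OF x(1)], use M(3) in auto)
        then show "int (p ^ f) dvd M" using x by (simp add: q_def)
      qed
    qed
  qed
qed simp

lemma Gcd_minors_eq:
  fixes a :: "'r \<Rightarrow> 'c \<Rightarrow> int"
  assumes C: "finite C" and \<alpha>: "\<alpha> > 0"
    and num: "\<And>m. m > 0 \<Longrightarrow> card (solutions (int m) a R C) = gcd m \<alpha>"
  shows "Gcd (minors a R C (card C)) = int \<alpha>"
proof -
  define D where "D = nat (Gcd (minors a R C (card C)))"
  have D: "Gcd (minors a R C (card C)) = int D" by (simp add: D_def)
  have iff: "p ^ f dvd D \<longleftrightarrow> p ^ f dvd \<alpha>" if "prime p" for p f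
  proof -
    have "p ^ f dvd D \<longleftrightarrow> int (p ^ f) dvd Gcd (minors a R C (card C))" unfolding D by (simp only: int_dvd_int_iff)
    also have "\<dots> \<longleftrightarrow> (\<forall>M\<in>minors a R C (card C). int (p ^ f) dvd M)" by (simp only: dvd_Gcd_iff)
    also have "\<dots> \<longleftrightarrow> p ^ f dvd \<alpha>" by (rule prime_power_dvd_minors_iff[OF C that num])
    finally show ?thesis .
  qed
  have "D \<noteq> 0"
  proof
    assume "D = 0"
    \<comment> \<open>The number 0 is divisible by all prime powers, the positive number \<open>\<alpha>\<close> is not.\<close>
    then have "2 ^ \<alpha> dvd \<alpha>" using iff[of 2 \<alpha>] by simp
    then show False using \<alpha> dvd_imp_le[of "2 ^ \<alpha>" \<alpha>] less_exp[of \<alpha>] by simp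
  qed
  moreover have "multiplicity p D = multiplicity p \<alpha>" if "prime p" for p
    using iff[OF that] by (intro multiplicity_cong) simp
  ultimately have "D = \<alpha>" using \<alpha> by (auto intro: multiplicity_eq_nat)
  then show ?thesis using D by simp
qed

text \<open>If the rows sum to 0, then constant vectors can be added to solutions; subtracting the entry at \<open>c\<close>
  leaves a solution of the system without the column \<open>c\<close>.\<close>

lemma card_solutions_base:
  fixes a :: "'r \<Rightarrow> 'c \<Rightarrow> int"
  assumes C: "finite C" and c: "c \<in> C" and zero: "\<And>r. r \<in> R \<Longrightarrow> (\<Sum>c\<in>C. a r c) = 0" and m: "m > 0"
  shows "card (solutions m a R C) = nat m * card (solutions m a R (C - {c}))"
proof -
  define F where "F = (\<lambda>(t, x). (\<lambda>d\<in>C. ((if d = c then 0 else x d) + t) mod m))"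
  define G where "G x = (x c, \<lambda>d\<in>C - {c}. (x d - x c) mod m)" for x
  have "bij_betw G (solutions m a R C) ({0..<m} \<times> solutions m a R (C - {c}))"
  proof (rule bij_betwI[where g = F])
    show "G \<in> solutions m a R C \<rightarrow> {0..<m} \<times> solutions m a R (C - {c})"
    proof
      fix x assume x: "x \<in> solutions m a R C"
      have "m dvd (\<Sum>d\<in>C - {c}. a r d * (x d - x c))" if "r \<in> R" for r
      proof -
        have "(\<Sum>d\<in>C - {c}. a r d * (x d - x c)) = (\<Sum>d\<in>C. a r d * (x d - x c))"
          using C by (intro sum.mono_neutral_left) auto
        also have "\<dots> = (\<Sum>d\<in>C. a r d * x d) - (\<Sum>d\<in>C. a r d) * x c"
          by (simp add: sum_subtractf right_diff_distrib sum_distrib_right)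
        finally show ?thesis using zero[OF that] solutionsD(1)[OF x that] by simp
      qed
      then have "(\<lambda>d\<in>C - {c}. (x d - x c) mod m) \<in> solutions m a R (C - {c})"
        by (rule residue_vector_solution[OF m])
      then show "G x \<in> {0..<m} \<times> solutions m a R (C - {c})"
        using solutionsD(2,3)[OF x c] by (simp add: G_def)
    qed
    show "F \<in> {0..<m} \<times> solutions m a R (C - {c}) \<rightarrow> solutions m a R C"
    proof clarify
      fix t x assume x: "x \<in> solutions m a R (C - {c})"
      have "m dvd (\<Sum>d\<in>C. a r d * ((if d = c then 0 else x d) + t))" if "r \<in> R" for r
      proof -
        have "(\<Sum>d\<in>C. a r d * ((if d = c then 0 else x d) + t)) =
            (\<Sum>d\<in>C. a r d * (if d = c then 0 else x d)) + (\<Sum>d\<in>C. a r d) * t"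
          by (simp add: distrib_left sum.distrib sum_distrib_right)
        also have "(\<Sum>d\<in>C. a r d * (if d = c then 0 else x d)) = (\<Sum>d\<in>C - {c}. a r d * x d)"
          using C by (intro sum.mono_neutral_cong_right) auto
        finally show ?thesis using zero[OF that] solutionsD(1)[OF x that] by simp
      qed
      then show "F (t, x) \<in> solutions m a R C"
        unfolding F_def prod.case by (rule residue_vector_solution[OF m])
    qed
    fix x assume x: "x \<in> solutions m a R C"
    show "F (G x) = x"
    proof
      fix d
      show "F (G x) d = x d"
        using solutionsD(2,3)[OF x, of d] solutionsD(4)[OF x, of d] c
        by (cases "d \<in> C") (auto simp: F_def G_def mod_add_left_eq)
    qed
  next
    fix y assume "y \<in> {0..<m} \<times> solutions m a R (C - {c})"
    then obtain t x where y: "y = (t, x)" "0 \<le> t" "t < m" and x: "x \<in> solutions m a R (C - {c})" by auto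
    have "(\<lambda>d\<in>C - {c}. (F (t, x) d - F (t, x) c) mod m) = x"
    proof
      fix d
      show "(\<lambda>d\<in>C - {c}. (F (t, x) d - F (t, x) c) mod m) d = x d"
        using solutionsD(2,3)[OF x, of d] solutionsD(4)[OF x, of d] c y
        by (cases "d \<in> C - {c}") (auto simp: F_def mod_diff_left_eq)
    qed
    then show "G (F y) = y" using c y by (simp add: G_def) (simp add: F_def)
  qed
  then have "card (solutions m a R C) = card ({0..<m} \<times> solutions m a R (C - {c}))"
    by (rule bij_betw_same_card)
  then show ?thesis by (simp add: card_cartesian_product)
qed

text \<open>A minor of corank one misses some column \<open>c\<close>, so that it is a maximal minor of the system of the
  solutions that are normalized to be 0 at \<open>c\<close>.\<close>

lemma Gcd_corank_1_minors:
  fixes a :: "'r \<Rightarrow> 'c \<Rightarrow> int"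
  assumes C: "finite C" "C \<noteq> {}" and zero: "\<And>r. r \<in> R \<Longrightarrow> (\<Sum>c\<in>C. a r c) = 0" and \<alpha>: "\<alpha> > 0"
    and num: "\<And>m. m > 0 \<Longrightarrow> card (solutions (int m) a R C) = m * gcd m \<alpha>"
  shows "Gcd (minors a R C (card C - 1)) = int \<alpha>"
proof -
  have less: "card (C - {c}) = card C - 1" if "c \<in> C" for c using that by simp
  have each: "Gcd (minors a R (C - {c}) (card C - 1)) = int \<alpha>" if c: "c \<in> C" for c
    unfolding less[OF c, symmetric]
  proof (rule Gcd_minors_eq[OF _ \<alpha>])
    fix m :: nat assume m: "m > 0"
    have "card (solutions (int m) a R C) = nat (int m) * card (solutions (int m) a R (C - {c}))"
      by (rule card_solutions_base[OF C(1) c zero]) (use m in simp_all)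
    then have "m * card (solutions (int m) a R (C - {c})) = m * gcd m \<alpha>"
      using num[OF m] by (metis nat_int)
    then show "card (solutions (int m) a R (C - {c})) = gcd m \<alpha>" using m by simp
  qed (use C in simp)
  have sub: "minors a R (C - {c}) k \<subseteq> minors a R C k" for c k
    unfolding minors_def by blast
  have cover: "\<exists>c\<in>C. M \<in> minors a R (C - {c}) (card C - 1)" if Min: "M \<in> minors a R C (card C - 1)" for M
  proof -
    obtain r s where M: "M = det (mat (card C - 1) (card C - 1) (\<lambda>(i, j). a (r i) (s j)))"
      and r: "inj_on r {0..<card C - 1}" "r ` {0..<card C - 1} \<subseteq> R"
      and s: "inj_on s {0..<card C - 1}" "s ` {0..<card C - 1} \<subseteq> C"
      using Min unfolding minors_def by auto
    have "card (s ` {0..<card C - 1}) = card C - 1" using card_image[OF s(1)] by simp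
    moreover have "card C - 1 < card C" using C by (simp add: card_gt_0_iff)
    ultimately have "s ` {0..<card C - 1} \<noteq> C" by (metis less_irrefl)
    with s(2) obtain c where "c \<in> C" "c \<notin> s ` {0..<card C - 1}" by blast
    moreover from this s(2) have "s ` {0..<card C - 1} \<subseteq> C - {c}" by blast
    ultimately show ?thesis unfolding M using minorsI[OF r s(1)] by blast
  qed
  obtain c where c: "c \<in> C" using C by blast
  have "Gcd (minors a R C (card C - 1)) dvd int \<alpha>"
    using each[OF c] sub[of c "card C - 1"] by (metis Gcd_greatest Gcd_dvd subsetD)
  moreover have "int \<alpha> dvd Gcd (minors a R C (card C - 1))"
  proof (rule Gcd_greatest)
    fix M assume "M \<in> minors a R C (card C - 1)"
    then obtain c' where "c' \<in> C" "M \<in> minors a R (C - {c'}) (card C - 1)" using cover by blast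
    then show "int \<alpha> dvd M" using each[of c'] by (metis Gcd_dvd)
  qed
  ultimately show ?thesis by (intro zdvd_antisym_nonneg) auto
qed


section \<open>Vertices of a link diagram\<close>

lemma orbit_card:
  assumes "permutation f" "card (orbit f x) = n"
  shows "(f ^^ n) x = x" and "orbit f x = (\<lambda>i. (f ^^ i) x) ` {0..<n}" and "inj_on (\<lambda>i. (f ^^ i) x) {0..<n}"
proof -
  have self: "x \<in> orbit f x" by (rule permutation_self_in_orbit[OF assms(1)])
  have "card (orbit f x) = funpow_dist1 f x x"
    using orbit_conv_funpow_dist1[OF self] card_image[OF inj_on_funpow_dist1[OF self]] by simp
  then have n: "n = funpow_dist1 f x x" using assms(2) by simp
  show "(f ^^ n) x = x" unfolding n by (rule funpow_dist1_prop[OF self])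
  show "orbit f x = (\<lambda>i. (f ^^ i) x) ` {0..<n}" unfolding n by (rule orbit_conv_funpow_dist1[OF self])
  show "inj_on (\<lambda>i. (f ^^ i) x) {0..<n}" unfolding n by (rule inj_on_funpow_dist1[OF self])
qed

locale link_diagram_context =
  fixes d :: diagram
  assumes link_diagram: "link_diagram d"
begin

lemma finite_darts: "finite (darts d)" and darts_nonempty: "darts d \<noteq> {}"
  and opp_permutes: "opp d permutes darts d" and nxt_permutes: "nxt d permutes darts d"
  and opp_neq: "x \<in> darts d \<Longrightarrow> opp d x \<noteq> x"
  and over_crossing: "x \<in> over d \<Longrightarrow> crossing_at d x"
  and nxt_over: "crossing_at d x \<Longrightarrow> nxt d x \<in> over d \<longleftrightarrow> x \<notin> over d"
  and euler: "card (vertices d) + card (faces d) = card (edges d) + 2 * card (graph_components d)"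
  using link_diagram unfolding link_diagram_def by auto

lemma opp_opp [simp]: "opp d (opp d x) = x"
  using link_diagram opp_permutes unfolding link_diagram_def
  by (cases "x \<in> darts d") (auto simp: permutes_not_in)

lemma opp_in [simp]: "opp d x \<in> darts d \<longleftrightarrow> x \<in> darts d"
  by (rule permutes_in_image[OF opp_permutes])

lemma nxt_in [simp]: "nxt d x \<in> darts d \<longleftrightarrow> x \<in> darts d"
  by (rule permutes_in_image[OF nxt_permutes])

lemma nxt_eq_iff [simp]: "nxt d x = nxt d y \<longleftrightarrow> x = y"
  using permutes_inj[OF nxt_permutes] by (auto dest: injD)

lemma opp_eq_iff [simp]: "opp d x = opp d y \<longleftrightarrow> x = y"
  by (metis opp_opp)

lemma permutation_nxt: "permutation (nxt d)"
  using nxt_permutes finite_darts by (auto simp: permutation_permutes)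

lemma crossing_in: "crossing_at d x \<Longrightarrow> x \<in> darts d"
  by (simp add: crossing_at_def)

lemma orbit_nxt: "orbit (nxt d) (nxt d x) = orbit (nxt d) x"
  by (rule permutation_orbit_step[OF permutation_nxt])

lemma crossing_nxt [simp]: "crossing_at d (nxt d x) \<longleftrightarrow> crossing_at d x"
  by (simp add: crossing_at_def orbit_nxt)

lemma nxt4: assumes "crossing_at d x" shows "nxt d (nxt d (nxt d (nxt d x))) = x"
  using orbit_card(1)[OF permutation_nxt, of x 4] assms by (simp add: crossing_at_def eval_nat_numeral)

lemma orbit_crossing: assumes "crossing_at d x"
  shows "orbit (nxt d) x = {x, nxt d x, nxt d (nxt d x), nxt d (nxt d (nxt d x))}"
proof -
  have *: "{0..<4} = {0, 1, 2, 3::nat}" by auto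
  show ?thesis using orbit_card(2)[OF permutation_nxt, of x 4] assms
    unfolding * by (simp add: crossing_at_def eval_nat_numeral)
qed

lemma nxt_neq_crossing: assumes "crossing_at d x"
  shows "nxt d x \<noteq> x" "nxt d (nxt d x) \<noteq> x" "nxt d (nxt d (nxt d x)) \<noteq> x"
proof -
  have "card {x, nxt d x, nxt d (nxt d x), nxt d (nxt d (nxt d x))} = 4"
    using assms unfolding orbit_crossing[OF assms, symmetric] by (simp add: crossing_at_def)
  then show "nxt d x \<noteq> x" "nxt d (nxt d x) \<noteq> x" "nxt d (nxt d (nxt d x)) \<noteq> x"
    by (auto simp: card_insert_if split: if_splits)
qed

lemma card_point: assumes "x \<in> darts d" "\<not> crossing_at d x" shows "card (orbit (nxt d) x) = 2"
  using link_diagram assms unfolding link_diagram_def vertices_def crossing_at_def by auto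

lemma nxt2: assumes "\<not> crossing_at d x" shows "nxt d (nxt d x) = x"
proof (cases "x \<in> darts d")
  case True
  then show ?thesis using orbit_card(1)[OF permutation_nxt card_point[OF True assms]]
    by (simp add: eval_nat_numeral)
qed (use nxt_permutes in \<open>simp add: permutes_not_in\<close>)

lemma orbit_point: assumes "x \<in> darts d" "\<not> crossing_at d x" shows "orbit (nxt d) x = {x, nxt d x}"
proof -
  have *: "{0..<2} = {0, 1::nat}" by auto
  show ?thesis using orbit_card(2)[OF permutation_nxt card_point[OF assms]]
    unfolding * by simp
qed

lemma nxt_neq: assumes "x \<in> darts d" shows "nxt d x \<noteq> x"
proof (cases "crossing_at d x")
  case False
  have "card {x, nxt d x} = 2" using card_point[OF assms False] orbit_point[OF assms False] by simp
  then show ?thesis by (auto simp: card_insert_if split: if_splits)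
qed (rule nxt_neq_crossing(1))

lemma through_point: "\<not> crossing_at d x \<Longrightarrow> through d x = nxt d x"
  by (simp add: through_def)

lemma through_in [simp]: "through d x \<in> darts d \<longleftrightarrow> x \<in> darts d"
  by (simp add: through_def)

lemma crossing_through [simp]: "crossing_at d (through d x) \<longleftrightarrow> crossing_at d x"
  by (simp add: through_def)

lemma through_through [simp]: "through d (through d x) = x"
  by (simp add: through_def nxt4 nxt2)

lemma nxt_through: "nxt d (through d x) = through d (nxt d x)"
  by (simp add: through_def)

lemma through_over [simp]: "through d x \<in> over d \<longleftrightarrow> x \<in> over d"
proof (cases "crossing_at d x")
  case False
  then show ?thesis using over_crossing crossing_through by blast
qed (simp add: through_def nxt_over)

lemma nxt_nxt_crossing: "crossing_at d x \<Longrightarrow> nxt d (nxt d x) = through d x"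
  by (simp add: through_def)

end


section \<open>Colorings of darts\<close>

text \<open>Colors are representatives in \<open>{0..<m}\<close>, and 0 outside of the diagram, so that colorings are equal as
  functions if they are equal modulo \<open>m\<close>, and so that there are finitely many of them.\<close>

definition dart_colorings :: "int \<Rightarrow> diagram \<Rightarrow> (nat \<Rightarrow> int) set" where
  "dart_colorings m d = {x. (\<forall>z. z \<notin> darts d \<longrightarrow> x z = 0) \<and>
     (\<forall>z\<in>darts d. 0 \<le> x z \<and> x z < m \<and> x (opp d z) = x z \<and>
        (\<not> crossing_at d z \<or> z \<in> over d \<longrightarrow> x (through d z) = x z)) \<and>
     (\<forall>z. crossing_at d z \<and> z \<notin> over d \<longrightarrow> [2 * x (nxt d z) = x z + x (through d z)] (mod m))}"

lemma dart_coloringsI: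
  assumes "\<And>z. z \<notin> darts d \<Longrightarrow> x z = 0"
    and "\<And>z. z \<in> darts d \<Longrightarrow> 0 \<le> x z" "\<And>z. z \<in> darts d \<Longrightarrow> x z < m"
    and "\<And>z. z \<in> darts d \<Longrightarrow> x (opp d z) = x z"
    and "\<And>z. z \<in> darts d \<Longrightarrow> \<not> crossing_at d z \<Longrightarrow> x (through d z) = x z"
    and "\<And>z. z \<in> darts d \<Longrightarrow> z \<in> over d \<Longrightarrow> x (through d z) = x z"
    and "\<And>z. crossing_at d z \<Longrightarrow> z \<notin> over d \<Longrightarrow> [2 * x (nxt d z) = x z + x (through d z)] (mod m)"
  shows "x \<in> dart_colorings m d"
  using assms unfolding dart_colorings_def by auto

lemma dart_coloringsD:
  assumes "x \<in> dart_colorings m d"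
  shows "z \<notin> darts d \<Longrightarrow> x z = 0"
    and "z \<in> darts d \<Longrightarrow> 0 \<le> x z" and "z \<in> darts d \<Longrightarrow> x z < m"
    and "z \<in> darts d \<Longrightarrow> x (opp d z) = x z"
    and "z \<in> darts d \<Longrightarrow> \<not> crossing_at d z \<Longrightarrow> x (through d z) = x z"
    and "z \<in> darts d \<Longrightarrow> z \<in> over d \<Longrightarrow> x (through d z) = x z"
    and "crossing_at d z \<Longrightarrow> z \<notin> over d \<Longrightarrow> [2 * x (nxt d z) = x z + x (through d z)] (mod m)"
  using assms unfolding dart_colorings_def by auto

lemma finite_dart_colorings: "finite (darts d) \<Longrightarrow> finite (dart_colorings m d)"
proof -
  assume "finite (darts d)"
  then have "finite {x. \<forall>z. (z \<in> darts d \<longrightarrow> x z \<in> {0..<m}) \<and> (z \<notin> darts d \<longrightarrow> x z = 0)}"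
    by (intro finite_set_of_finite_funs) auto
  then show ?thesis by (rule finite_subset[rotated]) (auto simp: dart_colorings_def)
qed

context link_diagram_context
begin

lemma arc_of_step:
  "z \<in> darts d \<Longrightarrow> y \<in> arc_of d z \<Longrightarrow> arc_of d y = arc_of d z"
proof -
  define r where "r = {(y, z). y \<in> darts d \<and>
        (z = opp d y \<or> (\<not> crossing_at d y \<or> y \<in> over d) \<and> z = through d y)}"
  have "sym r" unfolding r_def by (auto intro!: symI)
  then have "sym (r\<^sup>*)" by (rule sym_rtrancl)
  then have "r\<^sup>* `` {y} = r\<^sup>* `` {z}" if "(z, y) \<in> r\<^sup>*"
    using that by (auto dest: symD intro: rtrancl_trans)
  then show "y \<in> arc_of d z \<Longrightarrow> arc_of d y = arc_of d z" unfolding arc_of_def r_def by auto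
qed

lemma self_in_arc: "z \<in> arc_of d z"
  by (simp add: arc_of_def)

lemma arc_of_subset: "z \<in> darts d \<Longrightarrow> arc_of d z \<subseteq> darts d"
proof
  fix y assume z: "z \<in> darts d" "y \<in> arc_of d z"
  from z(2) have "(z, y) \<in> {(y, z). y \<in> darts d \<and>
        (z = opp d y \<or> (\<not> crossing_at d y \<or> y \<in> over d) \<and> z = through d y)}\<^sup>*" by (simp add: arc_of_def)
  then show "y \<in> darts d" by (induction rule: rtrancl_induct) (use z in auto)
qed

lemma arc_of_eq: "a \<in> arcs d \<Longrightarrow> z \<in> a \<Longrightarrow> arc_of d z = a"
  unfolding arcs_def using arc_of_step by auto

lemma arc_of_in: "z \<in> darts d \<Longrightarrow> arc_of d z \<in> arcs d"
  by (simp add: arcs_def)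

lemma finite_arcs: "finite (arcs d)" and arcs_nonempty: "arcs d \<noteq> {}"
  using finite_darts darts_nonempty by (auto simp: arcs_def)

lemma arc_of_opp: "z \<in> darts d \<Longrightarrow> arc_of d (opp d z) = arc_of d z"
  by (rule arc_of_step) (auto simp: arc_of_def)

lemma arc_of_through: "z \<in> darts d \<Longrightarrow> \<not> crossing_at d z \<or> z \<in> over d \<Longrightarrow> arc_of d (through d z) = arc_of d z"
  by (rule arc_of_step) (auto simp: arc_of_def)

lemma dart_coloring_arc:
  assumes x: "x \<in> dart_colorings m d" and z: "z \<in> darts d" "y \<in> arc_of d z"
  shows "x y = x z"
proof -
  from z(2) have "(z, y) \<in> {(y, z). y \<in> darts d \<and>
        (z = opp d y \<or> (\<not> crossing_at d y \<or> y \<in> over d) \<and> z = through d y)}\<^sup>*" by (simp add: arc_of_def)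
  then show ?thesis
    by (induction rule: rtrancl_induct) (use dart_coloringsD(4,5,6)[OF x] in auto)
qed

text \<open>Every crossing is represented by a dart of its lower strand; such a dart is what the coloring condition is
  stated for.\<close>

lemma obtain_under_dart:
  assumes "v \<in> crossings d"
  obtains z where "crossing_at d z" "z \<notin> over d" "v = orbit (nxt d) z"
proof -
  obtain y where y: "y \<in> darts d" "v = orbit (nxt d) y" "card v = 4"
    using assms by (auto simp: crossings_def vertices_def)
  then have c: "crossing_at d y" by (simp add: crossing_at_def)
  show ?thesis
  proof (cases "y \<in> over d")
    case True
    then show ?thesis using that[of "nxt d y"] c y nxt_over orbit_nxt by simp
  qed (use that c y in blast)
qed

lemma coloring_matrix_row:
  assumes z: "crossing_at d z" "z \<notin> over d"
  shows "(\<Sum>a\<in>arcs d. coloring_matrix d (orbit (nxt d) z) a * g a) =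
    2 * g (arc_of d (nxt d z)) - (g (arc_of d z) + g (arc_of d (through d z)))"
proof -
  define v where "v = orbit (nxt d) z"
  have v: "v = {z, nxt d z, through d z, nxt d (through d z)}"
    using orbit_crossing[OF z(1)] z(1) unfolding v_def by (simp add: through_def)
  then have vd: "v \<subseteq> darts d" using crossing_in[OF z(1)] by auto
  have fin: "finite v" unfolding v by simp
  define s where "s y = (if y \<in> over d then 1 else - 1 :: int)" for y
  have "(\<Sum>a\<in>arcs d. coloring_matrix d v a * g a) = (\<Sum>a\<in>arcs d. \<Sum>y | y \<in> v \<and> arc_of d y = a. s y * g (arc_of d y))"
  proof (rule sum.cong[OF refl])
    fix a assume a: "a \<in> arcs d"
    have eq: "v \<inter> a = {y. y \<in> v \<and> arc_of d y = a}"
      using arc_of_eq[OF a] self_in_arc by auto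
    show "coloring_matrix d v a * g a = (\<Sum>y | y \<in> v \<and> arc_of d y = a. s y * g (arc_of d y))"
      unfolding coloring_matrix_def s_def sum_distrib_right eq by (rule sum.cong) auto
  qed
  also have "\<dots> = (\<Sum>y\<in>v. s y * g (arc_of d y))"
    using vd by (intro sum.group fin finite_arcs) (auto intro: arc_of_in)
  also have "\<dots> = 2 * g (arc_of d (nxt d z)) - (g (arc_of d z) + g (arc_of d (through d z)))"
  proof -
    have "distinct [z, nxt d z, through d z, nxt d (through d z)]"
      using nxt_neq_crossing[OF z(1)] nxt_neq_crossing[of "nxt d z"] z by (auto simp: through_def)
    moreover have "arc_of d (nxt d (through d z)) = arc_of d (nxt d z)"
      unfolding nxt_through using z by (intro arc_of_through) (auto simp: nxt_over crossing_in)
    ultimately show ?thesis unfolding v using z by (simp add: s_def nxt_over)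
  qed
  finally show ?thesis unfolding v_def .
qed

lemma coloring_matrix_row_sum: "v \<in> crossings d \<Longrightarrow> (\<Sum>a\<in>arcs d. coloring_matrix d v a) = 0"
  using coloring_matrix_row[of _ "\<lambda>_. 1"] by (elim obtain_under_dart) simp

lemma card_dart_colorings:
  assumes m: "m > 0"
  shows "card (dart_colorings m d) = card (solutions m (coloring_matrix d) (crossings d) (arcs d))"
proof -
  define F where "F x = (\<lambda>a\<in>arcs d. x (SOME z. z \<in> a))" for x :: "nat \<Rightarrow> int"
  define G where "G g z = (if z \<in> darts d then g (arc_of d z) else 0)" for g :: "nat set \<Rightarrow> int" and z
  have some: "x (SOME z. z \<in> arc_of d y) = x y" if "x \<in> dart_colorings m d" "y \<in> darts d" for x y
    using dart_coloring_arc[OF that, of "SOME z. z \<in> arc_of d y"] someI[of "\<lambda>z. z \<in> arc_of d y", OF self_in_arc] by simp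
  have Farc: "F x (arc_of d y) = x y" if "x \<in> dart_colorings m d" "y \<in> darts d" for x y
    using some[OF that] arc_of_in[OF that(2)] by (simp add: F_def)
  have "bij_betw F (dart_colorings m d) (solutions m (coloring_matrix d) (crossings d) (arcs d))"
  proof (rule bij_betwI[where g = G])
    show "F \<in> dart_colorings m d \<rightarrow> solutions m (coloring_matrix d) (crossings d) (arcs d)"
    proof
      fix x assume x: "x \<in> dart_colorings m d"
      have "m dvd (\<Sum>a\<in>arcs d. coloring_matrix d v a * F x a)" if "v \<in> crossings d" for v
      proof -
        obtain z where z: "crossing_at d z" "z \<notin> over d" "v = orbit (nxt d) z"
          using obtain_under_dart[OF \<open>v \<in> crossings d\<close>] .
        show ?thesis using dart_coloringsD(7)[OF x z(1,2)] crossing_in[OF z(1)]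
          unfolding z(3) coloring_matrix_row[OF z(1,2)] by (simp add: Farc[OF x] cong_iff_dvd_diff)
      qed
      moreover have "F x a \<in> {0..<m}" if "a \<in> arcs d" for a
        using that dart_coloringsD(2,3)[OF x] by (auto simp: arcs_def Farc[OF x])
      ultimately show "F x \<in> solutions m (coloring_matrix d) (crossings d) (arcs d)"
        unfolding solutions_def F_def by auto
    qed
    show "G \<in> solutions m (coloring_matrix d) (crossings d) (arcs d) \<rightarrow> dart_colorings m d"
    proof
      fix g assume g: "g \<in> solutions m (coloring_matrix d) (crossings d) (arcs d)"
      have "[2 * g (arc_of d (nxt d z)) = g (arc_of d z) + g (arc_of d (through d z))] (mod m)"
        if z: "crossing_at d z" "z \<notin> over d" for z
      proof -
        have "orbit (nxt d) z \<in> crossings d"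
          using z by (auto simp: crossings_def vertices_def crossing_at_def)
        from solutionsD(1)[OF g this] show ?thesis
          unfolding coloring_matrix_row[OF z] by (simp add: cong_iff_dvd_diff)
      qed
      then show "G g \<in> dart_colorings m d"
        using solutionsD(2,3)[OF g] crossing_in
        by (intro dart_coloringsI) (auto simp: G_def arc_of_in arc_of_opp arc_of_through)
    qed
    fix x assume x: "x \<in> dart_colorings m d"
    show "G (F x) = x"
      using Farc[OF x] dart_coloringsD(1)[OF x] by (auto simp: G_def)
  next
    fix g assume g: "g \<in> solutions m (coloring_matrix d) (crossings d) (arcs d)"
    show "F (G g) = g"
    proof
      fix a
      show "F (G g) a = g a"
      proof (cases "a \<in> arcs d")
        case True
        then obtain y where y: "y \<in> darts d" "a = arc_of d y" by (auto simp: arcs_def)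
        then have "(SOME z. z \<in> a) \<in> a" using self_in_arc by (metis someI)
        then have "arc_of d (SOME z. z \<in> a) = a" "(SOME z. z \<in> a) \<in> darts d"
          using arc_of_eq[OF True] arc_of_subset y by blast+
        then show ?thesis using True by (simp add: F_def G_def)
      qed (use solutionsD(4)[OF g] in \<open>simp add: F_def\<close>)
    qed
  qed
  then show ?thesis by (rule bij_betw_same_card)
qed

lemma diagram_determinant_eq:
  assumes "\<alpha> > 0" and "\<And>m. m > 0 \<Longrightarrow> card (dart_colorings (int m) d) = m * gcd m \<alpha>"
  shows "diagram_determinant d = \<alpha>"
proof -
  have "Gcd (minors (coloring_matrix d) (crossings d) (arcs d) (card (arcs d) - 1)) = int \<alpha>"
    using assms by (intro Gcd_corank_1_minors finite_arcs arcs_nonempty coloring_matrix_row_sum)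
      (auto simp: card_dart_colorings[symmetric])
  moreover have "minors (coloring_matrix d) (crossings d) (arcs d) (card (arcs d) - 1) = diagram_minors d"
    unfolding minors_def diagram_minors_def by (simp add: Let_def)
  ultimately show ?thesis by (simp add: diagram_determinant_def)
qed

lemma coloring_from_dart_coloring:
  assumes x: "x \<in> dart_colorings (int m) d" and m: "m > 1"
  obtains f where "coloring m d f" "\<And>z. z \<in> darts d \<Longrightarrow> int (f (arc_of d z)) = x z"
proof -
  define f where "f a = nat (x (SOME z. z \<in> a))" for a
  have f: "int (f (arc_of d z)) = x z" if z: "z \<in> darts d" for z
  proof -
    have "x (SOME y. y \<in> arc_of d z) = x z"
      using dart_coloring_arc[OF x z, of "SOME y. y \<in> arc_of d z"] someI[of "\<lambda>y. y \<in> arc_of d z", OF self_in_arc] by simp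
    then show ?thesis using dart_coloringsD(2)[OF x z] by (simp add: f_def)
  qed
  have "f a < m" if "a \<in> arcs d" for a
  proof -
    obtain z where "z \<in> darts d" "a = arc_of d z" using \<open>a \<in> arcs d\<close> by (auto simp: arcs_def)
    then show ?thesis using f[of z] dart_coloringsD(3)[OF x, of z] by simp
  qed
  moreover have "[2 * f (arc_of d (nxt d z)) = f (arc_of d z) + f (arc_of d (through d z))] (mod m)"
    if z: "crossing_at d z" "z \<notin> over d" for z
  proof -
    have "[int (2 * f (arc_of d (nxt d z))) = int (f (arc_of d z) + f (arc_of d (through d z)))] (mod int m)"
      using dart_coloringsD(7)[OF x z] crossing_in[OF z(1)] by (simp add: f)
    then show ?thesis by (simp only: cong_int_iff)
  qed
  ultimately have "coloring m d f" unfolding coloring_def using m by auto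
  with f that show ?thesis by blast
qed

end


section \<open>Isomorphisms and points\<close>

lemma diagram_iso_sym:
  assumes "link_diagram d" and "diagram_iso d d'"
  shows "diagram_iso d' d"
proof -
  interpret link_diagram_context d by unfold_locales fact
  obtain g where g: "bij_betw g (darts d) (darts d')"
    and eq: "\<And>x. x \<in> darts d \<Longrightarrow> g (opp d x) = opp d' (g x) \<and> g (nxt d x) = nxt d' (g x) \<and> (x \<in> over d \<longleftrightarrow> g x \<in> over d')"
    using assms(2) unfolding diagram_iso_def by blast
  define h where "h = the_inv_into (darts d) g"
  have h: "bij_betw h (darts d') (darts d)" unfolding h_def by (rule bij_betw_the_inv_into[OF g])
  have gh: "g (h x) = x" if "x \<in> darts d'" for x
    using that f_the_inv_into_f_bij_betw[OF g] unfolding h_def by blast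
  have hg: "h (g x) = x" if "x \<in> darts d" for x
    using that g the_inv_into_f_f unfolding h_def bij_betw_def by metis
  have "h (opp d' x) = opp d (h x) \<and> h (nxt d' x) = nxt d (h x) \<and> (x \<in> over d' \<longleftrightarrow> h x \<in> over d)"
    if x: "x \<in> darts d'" for x
  proof -
    have hx: "h x \<in> darts d" using bij_betwE[OF h] x by blast
    show ?thesis using eq[OF hx] hg[of "opp d (h x)"] hg[of "nxt d (h x)"] hx by (simp add: gh[OF x])
  qed
  with h show ?thesis unfolding diagram_iso_def by blast
qed

text \<open>Colorings are pulled back along the isomorphism.\<close>

lemma card_dart_colorings_iso_le:
  assumes "link_diagram d" "link_diagram d'" and iso: "diagram_iso d d'"
  shows "card (dart_colorings m d') \<le> card (dart_colorings m d)"
proof -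
  interpret link_diagram_context d by unfold_locales fact
  interpret d': link_diagram_context d' by unfold_locales fact
  obtain g where g: "bij_betw g (darts d) (darts d')"
    and eq: "\<And>x. x \<in> darts d \<Longrightarrow> g (opp d x) = opp d' (g x) \<and> g (nxt d x) = nxt d' (g x) \<and> (x \<in> over d \<longleftrightarrow> g x \<in> over d')"
    using iso unfolding diagram_iso_def by blast
  have gin: "g x \<in> darts d'" if "x \<in> darts d" for x using that bij_betwE[OF g] by blast
  have crossing: "crossing_at d' (g x) \<longleftrightarrow> crossing_at d x" if x: "x \<in> darts d" for x
  proof -
    have sub: "orbit (nxt d) x \<subseteq> darts d" by (rule permutes_orbit_subset[OF nxt_permutes x])
    have "g ` orbit (nxt d) x = orbit (nxt d') (g x)"
      by (rule orbit_inverse[OF permutation_self_in_orbit[OF permutation_nxt]]) (use sub eq in force)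
    moreover have "inj_on g (orbit (nxt d) x)" using g sub by (auto simp: bij_betw_def intro: inj_on_subset)
    ultimately show ?thesis using card_image[of g "orbit (nxt d) x"] x gin[OF x] by (simp add: crossing_at_def)
  qed
  have through: "through d' (g x) = g (through d x)" if "x \<in> darts d" for x
    using eq that crossing[OF that] by (simp add: through_def)
  define F where "F x z = (if z \<in> darts d then x (g z) else 0)" for x :: "nat \<Rightarrow> int" and z
  have "F x \<in> dart_colorings m d" if x: "x \<in> dart_colorings m d'" for x
    using dart_coloringsD[OF x] crossing_in
    by (intro dart_coloringsI) (auto simp: F_def gin eq through[symmetric] crossing)
  moreover have "inj_on F (dart_colorings m d')"
  proof (rule inj_onI, rule ext)
    fix x y z assume x: "x \<in> dart_colorings m d'" "y \<in> dart_colorings m d'" and F: "F x = F y"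
    show "x z = y z"
    proof (cases "z \<in> darts d'")
      case True
      then obtain w where "w \<in> darts d" "z = g w" using g by (auto simp: bij_betw_def)
      then show ?thesis using fun_cong[OF F, of w] by (simp add: F_def)
    qed (use x dart_coloringsD(1) in metis)
  qed
  ultimately show ?thesis by (intro card_inj_on_le[of F] finite_dart_colorings finite_darts) auto
qed

lemma card_dart_colorings_iso:
  assumes "link_diagram d" "link_diagram d'" "diagram_iso d d'"
  shows "card (dart_colorings m d) = card (dart_colorings m d')"
  using card_dart_colorings_iso_le[of d d'] card_dart_colorings_iso_le[of d' d] diagram_iso_sym[of d d'] assms
  by (intro antisym) auto

text \<open>The moves that delete darts are treated in this form: the colors of the deleted darts are determined by
  the remaining ones, and they can be filled in.\<close>

lemma card_dart_colorings_restrict: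
  assumes sub: "darts d' \<subseteq> darts d"
    and restr: "\<And>x. x \<in> dart_colorings m d \<Longrightarrow> (\<lambda>z. if z \<in> darts d' then x z else 0) \<in> dart_colorings m d'"
    and extend: "\<And>y. y \<in> dart_colorings m d' \<Longrightarrow> \<exists>x\<in>dart_colorings m d. \<forall>z\<in>darts d'. x z = y z"
    and uniq: "\<And>x x' z. x \<in> dart_colorings m d \<Longrightarrow> x' \<in> dart_colorings m d \<Longrightarrow>
      (\<And>z. z \<in> darts d' \<Longrightarrow> x z = x' z) \<Longrightarrow> z \<in> darts d \<Longrightarrow> z \<notin> darts d' \<Longrightarrow> x z = x' z"
  shows "card (dart_colorings m d) = card (dart_colorings m d')"
proof -
  define F where "F x z = (if z \<in> darts d' then x z else 0)" for x :: "nat \<Rightarrow> int" and z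
  have "bij_betw F (dart_colorings m d) (dart_colorings m d')"
  proof (rule bij_betw_imageI)
    show "inj_on F (dart_colorings m d)"
    proof (rule inj_onI, rule ext)
      fix x x' z assume x: "x \<in> dart_colorings m d" "x' \<in> dart_colorings m d" and F: "F x = F x'"
      have eq: "x z = x' z" if "z \<in> darts d'" for z
        using fun_cong[OF F, of z] that by (simp add: F_def)
      show "x z = x' z"
        using eq uniq[OF x eq, of z] dart_coloringsD(1)[OF x(1), of z] dart_coloringsD(1)[OF x(2), of z]
        by (cases "z \<in> darts d"; cases "z \<in> darts d'") auto
    qed
    show "F ` dart_colorings m d = dart_colorings m d'"
    proof
      show "F ` dart_colorings m d \<subseteq> dart_colorings m d'" using restr by (auto simp: F_def[abs_def])
      show "dart_colorings m d' \<subseteq> F ` dart_colorings m d"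
      proof
        fix y assume y: "y \<in> dart_colorings m d'"
        obtain x where x: "x \<in> dart_colorings m d" "\<forall>z\<in>darts d'. x z = y z" using extend[OF y] by blast
        have "F x = y" using x(2) dart_coloringsD(1)[OF y] by (auto simp: F_def)
        with x(1) show "y \<in> F ` dart_colorings m d" by blast
      qed
    qed
  qed
  then show ?thesis by (rule bij_betw_same_card)
qed

context link_diagram_context
begin

text \<open>A change of the rotation system within a union \<open>X\<close> of vertices does not affect the other vertices.\<close>

lemma orbit_nxt_cong:
  assumes closed: "\<And>z. z \<in> X \<Longrightarrow> nxt d z \<in> X" and z: "z \<notin> X"
    and eq: "\<And>y. y \<notin> X \<Longrightarrow> f y = nxt d y"
  shows "orbit f z = orbit (nxt d) z"
proof (rule orbit_cong[OF permutation_self_in_orbit[OF permutation_nxt]])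
  fix y assume y: "y \<in> orbit (nxt d) z"
  have "y \<notin> X"
  proof
    assume yX: "y \<in> X"
    have "z \<in> orbit (nxt d) y"
      by (rule orbit_swap[OF permutation_self_in_orbit[OF permutation_nxt] y])
    then have "z \<in> X" by induction (use yX closed in auto)
    with z show False ..
  qed
  then show "f y = nxt d y" by (rule eq)
qed

context
  fixes x assumes x: "x \<in> darts d" "\<not> crossing_at d x"
begin

lemma forget_point_darts: "darts (forget_point d x) = darts d - {x, nxt d x}"
  and forget_point_over: "over (forget_point d x) = over d"
  and forget_point_opp: "z \<in> darts d - {x, nxt d x} \<Longrightarrow> opp (forget_point d x) z =
    (if z = opp d x then opp d (nxt d x) else if z = opp d (nxt d x) then opp d x else opp d z)"
  and forget_point_nxt: "z \<in> darts d - {x, nxt d x} \<Longrightarrow> nxt (forget_point d x) z = nxt d z"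
  by (auto simp: forget_point_def Let_def)

lemma forget_point_orbit:
  assumes "z \<notin> {x, nxt d x}"
  shows "orbit (nxt (forget_point d x)) z = orbit (nxt d) z"
  by (rule orbit_nxt_cong[OF _ assms]) (use nxt2[OF x(2)] in \<open>auto simp: forget_point_def Let_def\<close>)

lemma forget_point_crossing: "z \<in> darts d - {x, nxt d x} \<Longrightarrow> crossing_at (forget_point d x) z \<longleftrightarrow> crossing_at d z"
  using forget_point_orbit[of z] by (simp add: crossing_at_def forget_point_darts)

lemma nxt_notin_point: "z \<in> darts d - {x, nxt d x} \<Longrightarrow> nxt d z \<in> darts d - {x, nxt d x}"
  using nxt2[OF x(2)] by (metis DiffD1 DiffD2 DiffI insert_iff nxt_eq_iff nxt_in singletonD)

lemma forget_point_through: "z \<in> darts d - {x, nxt d x} \<Longrightarrow> through (forget_point d x) z = through d z"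
  using nxt_notin_point[of z] by (simp add: through_def forget_point_crossing forget_point_nxt)

lemma through_notin_point: "z \<in> darts d - {x, nxt d x} \<Longrightarrow> through d z \<in> darts d - {x, nxt d x}"
  unfolding through_def using nxt_notin_point[of z] nxt_notin_point[of "nxt d z"] by (metis (full_types))

text \<open>The two edges at a point have the same color, which is also the color of the edge that they merge into.\<close>

lemma card_dart_colorings_forget_point:
  assumes neq: "opp d x \<noteq> nxt d x"
  shows "card (dart_colorings m d) = card (dart_colorings m (forget_point d x))"
proof (rule card_dart_colorings_restrict)
  let ?d = "forget_point d x" and ?y = "nxt d x"
  have oy: "opp d ?y \<noteq> x" using neq by (metis opp_opp)
  have y: "?y \<in> darts d" "\<not> crossing_at d ?y" "nxt d ?y = x" using x nxt2 by auto
  have dd: "opp d x \<in> darts ?d" "opp d ?y \<in> darts ?d"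
    using x y neq oy opp_neq by (auto simp: forget_point_darts)
  show "darts ?d \<subseteq> darts d" by (auto simp: forget_point_darts)
  show "(\<lambda>z. if z \<in> darts ?d then c z else 0) \<in> dart_colorings m ?d" if c: "c \<in> dart_colorings m d" for c
  proof -
    have cx: "c (opp d x) = c x" "c (opp d ?y) = c x"
      using dart_coloringsD(4,5)[OF c, of x] dart_coloringsD(4)[OF c, of ?y] x y by (auto simp: through_point)
    show ?thesis
    proof (rule dart_coloringsI)
      fix z assume z: "z \<in> darts ?d"
      then have zd: "z \<in> darts d - {x, ?y}" by (simp add: forget_point_darts)
      have "opp d z \<in> darts ?d" if "z \<noteq> opp d x" "z \<noteq> opp d ?y"
        using that zd by (auto simp: forget_point_darts) (metis opp_opp)+
      then show "(if opp ?d z \<in> darts ?d then c (opp ?d z) else 0) = (if z \<in> darts ?d then c z else 0)"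
        using z dart_coloringsD(4)[OF c, of z] zd dd cx by (auto simp: forget_point_opp)
      show "(if through ?d z \<in> darts ?d then c (through ?d z) else 0) = (if z \<in> darts ?d then c z else 0)"
        if "\<not> crossing_at ?d z"
        using that dart_coloringsD(5)[OF c, of z] through_notin_point[OF zd] zd
        by (simp add: forget_point_crossing forget_point_through forget_point_darts)
      show "(if through ?d z \<in> darts ?d then c (through ?d z) else 0) = (if z \<in> darts ?d then c z else 0)"
        if "z \<in> over ?d"
        using that dart_coloringsD(6)[OF c, of z] through_notin_point[OF zd] zd
        by (simp add: forget_point_through forget_point_darts forget_point_over)
    next
      fix z assume "crossing_at ?d z" and o: "z \<notin> over ?d"
      then have zd: "z \<in> darts d - {x, ?y}" and zc: "crossing_at d z"
        using forget_point_crossing forget_point_darts by (auto simp: crossing_at_def)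
      show "[2 * (if nxt ?d z \<in> darts ?d then c (nxt ?d z) else 0) =
          (if z \<in> darts ?d then c z else 0) + (if through ?d z \<in> darts ?d then c (through ?d z) else 0)] (mod m)"
        using dart_coloringsD(7)[OF c zc] o through_notin_point[OF zd] nxt_notin_point[OF zd] zd
        by (simp add: forget_point_through forget_point_darts forget_point_over forget_point_nxt)
    qed (use dart_coloringsD(2,3)[OF c] in \<open>auto simp: forget_point_darts\<close>)
  qed
  show "\<exists>c\<in>dart_colorings m d. \<forall>z\<in>darts ?d. c z = e z" if e: "e \<in> dart_colorings m ?d" for e
  proof
    define c where "c z = (if z \<in> {x, ?y} then e (opp d x) else e z)" for z
    have eo: "e (opp d ?y) = e (opp d x)"
      using dart_coloringsD(4)[OF e dd(1)] dd(1) x by (simp add: forget_point_opp forget_point_darts)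
    show "\<forall>z\<in>darts ?d. c z = e z" by (simp add: c_def forget_point_darts)
    show "c \<in> dart_colorings m d"
    proof (rule dart_coloringsI)
      fix z assume z: "z \<in> darts d"
      consider "z \<in> {x, ?y}" | "z \<in> darts ?d" using z by (auto simp: forget_point_darts)
      then have "0 \<le> c z \<and> c z < m \<and> c (opp d z) = c z \<and> (\<not> crossing_at d z \<longrightarrow> c (through d z) = c z) \<and>
        (z \<in> over d \<longrightarrow> c (through d z) = c z)"
      proof cases
        case 1
        then show ?thesis using dart_coloringsD(2,3)[OF e dd(1)] dd x y eo over_crossing
          by (auto simp: c_def through_point forget_point_darts)
      next
        case 2
        then have zd: "z \<in> darts d - {x, ?y}" by (simp add: forget_point_darts)
        have "opp d z = w \<longleftrightarrow> z = opp d w" for w by auto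
        then have "c (opp d z) = c z"
          using dart_coloringsD(4)[OF e 2] zd eo x by (auto simp: c_def forget_point_opp split: if_splits)
        then show ?thesis using dart_coloringsD(2,3,5,6)[OF e 2] zd through_notin_point[OF zd]
          by (auto simp: c_def forget_point_crossing forget_point_through forget_point_over)
      qed
      then show "0 \<le> c z" "c z < m" "c (opp d z) = c z" "\<not> crossing_at d z \<Longrightarrow> c (through d z) = c z"
        "z \<in> over d \<Longrightarrow> c (through d z) = c z" by auto
    next
      fix z assume z: "crossing_at d z" "z \<notin> over d"
      then have zd: "z \<in> darts d - {x, ?y}" using x y crossing_in by auto
      show "[2 * c (nxt d z) = c z + c (through d z)] (mod m)"
        using dart_coloringsD(7)[OF e, of z] z zd through_notin_point[OF zd] nxt_notin_point[OF zd]
        by (simp add: c_def forget_point_crossing forget_point_through forget_point_over forget_point_nxt)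
    next
      fix z assume "z \<notin> darts d"
      then show "c z = 0" using dart_coloringsD(1)[OF e, of z] x y by (auto simp: c_def forget_point_darts)
    qed
  qed
  fix c c' z assume c: "c \<in> dart_colorings m d" "c' \<in> dart_colorings m d"
    and eq: "\<And>z. z \<in> darts ?d \<Longrightarrow> c z = c' z" and z: "z \<in> darts d" "z \<notin> darts ?d"
  have "z = x \<or> z = ?y" using z by (auto simp: forget_point_darts)
  then show "c z = c' z" using dart_coloringsD(4)[OF c(1), of z] dart_coloringsD(4)[OF c(2), of z] eq dd z(1) by auto
qed

end
end


section \<open>The first two Reidemeister moves\<close>

lemma residues_eqI: "[a = b] (mod m) \<Longrightarrow> 0 \<le> a \<Longrightarrow> a < m \<Longrightarrow> 0 \<le> b \<Longrightarrow> b < m \<Longrightarrow> a = (b::int)"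
  by (simp add: cong_def)

context link_diagram_context
begin

context
  fixes K :: "nat set"
  assumes K: "\<And>z. z \<in> K \<Longrightarrow> crossing_at d z" "\<And>z. z \<in> K \<Longrightarrow> opp d z \<in> K" "\<And>z. z \<in> K \<Longrightarrow> through d z \<notin> K"
    and closed: "\<And>z. z \<in> K \<Longrightarrow> nxt d z \<in> K \<or> through d (nxt d z) \<in> K"
begin

private abbreviation (input) "T \<equiv> through d ` K"

lemma T_iff: "z \<in> through d ` K \<longleftrightarrow> through d z \<in> K"
  by (metis imageE imageI through_through)

lemma KT_nxt: "z \<in> K \<union> T \<Longrightarrow> nxt d z \<in> K \<union> T"
  using closed[of z] closed[of "through d z"] by (auto simp: T_iff nxt_through)

text \<open>The darts to be deleted and their continuations through the crossings form a union of crossings, the ones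
  that disappear.\<close>

lemma KT_nxt_iff: "nxt d z \<in> K \<union> T \<longleftrightarrow> z \<in> K \<union> T"
proof
  assume a: "nxt d z \<in> K \<union> T"
  then have "crossing_at d (nxt d z)" using K(1) by (auto simp del: crossing_nxt)
  then have c: "crossing_at d z" by simp
  show "z \<in> K \<union> T"
    using KT_nxt[OF KT_nxt[OF KT_nxt[OF a]]] by (simp only: nxt4[OF c])
qed (rule KT_nxt)

lemma KT_through_iff: "through d z \<in> K \<union> T \<longleftrightarrow> z \<in> K \<union> T"
  by (auto simp: T_iff)

lemma pull_apart_darts: "darts (pull_apart d K) = darts d - K"
  and pull_apart_opp: "z \<notin> K \<Longrightarrow> opp (pull_apart d K) z = opp d z"
  and pull_apart_nxt_T: "z \<in> T \<Longrightarrow> nxt (pull_apart d K) z = through d (opp d (through d z))"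
  and pull_apart_nxt: "z \<notin> K \<union> T \<Longrightarrow> nxt (pull_apart d K) z = nxt d z"
  and pull_apart_over: "over (pull_apart d K) = over d - (K \<union> T)"
  using K(3) by (auto simp: pull_apart_def)

lemma pull_apart_crossing:
  assumes z: "z \<in> darts d - K"
  shows "crossing_at (pull_apart d K) z \<longleftrightarrow> z \<notin> T \<and> crossing_at d z"
proof (cases "z \<in> T")
  case True
  define w where "w = through d (opp d (through d z))"
  have w: "w \<in> T" "through d (opp d (through d w)) = z" using True K(2) by (auto simp: w_def)
  have "(nxt (pull_apart d K) ^^ 2) z = z"
    using True w by (simp add: eval_nat_numeral pull_apart_nxt_T w_def)
  then have "orbit (nxt (pull_apart d K)) z = {(nxt (pull_apart d K) ^^ m) z |m. m < 2}"
    by (rule orbit_altdef_bounded) simp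
  also have "\<dots> = (\<lambda>m. (nxt (pull_apart d K) ^^ m) z) ` {..<2}" by auto
  finally have "card (orbit (nxt (pull_apart d K)) z) \<le> 2"
    using card_image_le[of "{..<2::nat}" "\<lambda>m. (nxt (pull_apart d K) ^^ m) z"] by simp
  then show ?thesis using True by (auto simp: crossing_at_def)
next
  case False
  with z have "z \<notin> K \<union> T" by blast
  then have "orbit (nxt (pull_apart d K)) z = orbit (nxt d) z"
    by (intro orbit_nxt_cong[where X = "K \<union> T"] KT_nxt) (simp_all add: pull_apart_nxt)
  then show ?thesis using z False by (simp add: crossing_at_def pull_apart_darts)
qed

lemma pull_apart_through:
  assumes z: "z \<in> darts d - K" "z \<notin> T"
  shows "through (pull_apart d K) z = through d z"
proof -
  have "z \<notin> K \<union> T" "nxt d z \<notin> K \<union> T" using z KT_nxt_iff by blast+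
  then show ?thesis using z by (simp add: through_def pull_apart_crossing pull_apart_nxt)
qed

lemma pull_apart_through_T:
  assumes z: "z \<in> T"
  shows "through (pull_apart d K) z = through d (opp d (through d z))"
proof -
  have "z \<in> darts d - K" using z K crossing_in by auto
  then show ?thesis using z by (simp add: through_def[of "pull_apart d K"] pull_apart_crossing pull_apart_nxt_T)
qed

text \<open>Both of the first two Reidemeister moves delete the edges with darts \<open>K\<close> and join the loose ends. Their
  invariance is reduced to the crossings that disappear: the colors of joined ends agree (\<open>join\<close>), and
  the colors of \<open>K\<close> can be recovered from the ends (\<open>fill\<close>) in only one way (\<open>uniq\<close>).\<close>

lemma card_dart_colorings_pull_apart:
  assumes join: "\<And>c z. c \<in> dart_colorings m d \<Longrightarrow> z \<in> K \<Longrightarrow> c (through d z) = c (through d (opp d z))"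
    and fill: "\<And>e. e \<in> dart_colorings m (pull_apart d K) \<Longrightarrow>
      (\<And>z. z \<in> K \<Longrightarrow> 0 \<le> e (through d z) \<and> e (through d z) < m \<and> e (through d z) = e (through d (opp d z))) \<Longrightarrow>
      \<exists>c. (\<forall>z. z \<notin> K \<longrightarrow> c z = e z) \<and> (\<forall>z\<in>K. 0 \<le> c z \<and> c z < m \<and> c (opp d z) = c z) \<and>
        (\<forall>z\<in>K \<union> T. if z \<in> over d then c (through d z) = c z else [2 * c (nxt d z) = c z + c (through d z)] (mod m))"
    and uniq: "\<And>c c' z. c \<in> dart_colorings m d \<Longrightarrow> c' \<in> dart_colorings m d \<Longrightarrow>
      (\<And>z. z \<in> T \<Longrightarrow> c z = c' z) \<Longrightarrow> z \<in> K \<Longrightarrow> c z = c' z"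
  shows "card (dart_colorings m d) = card (dart_colorings m (pull_apart d K))"
proof (rule card_dart_colorings_restrict)
  let ?d = "pull_apart d K"
  have Td: "z \<in> darts d - K" if "z \<in> T" for z using that K crossing_in by auto
  show "darts ?d \<subseteq> darts d" by (auto simp: pull_apart_darts)
  show "(\<lambda>z. if z \<in> darts ?d then c z else 0) \<in> dart_colorings m ?d" if c: "c \<in> dart_colorings m d" for c
  proof (rule dart_coloringsI)
    fix z assume z: "z \<in> darts ?d"
    then have zd: "z \<in> darts d - K" by (simp add: pull_apart_darts)
    have "opp d z \<notin> K" using zd K(2)[of "opp d z"] by auto
    then show "(if opp ?d z \<in> darts ?d then c (opp ?d z) else 0) = (if z \<in> darts ?d then c z else 0)"
      using zd dart_coloringsD(4)[OF c, of z] by (simp add: pull_apart_opp pull_apart_darts)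
    show "(if through ?d z \<in> darts ?d then c (through ?d z) else 0) = (if z \<in> darts ?d then c z else 0)"
      if nc: "\<not> crossing_at ?d z"
    proof (cases "z \<in> T")
      case True
      then have "through d (opp d (through d z)) \<in> T" using K(2) by auto
      moreover have "c (through d (opp d (through d z))) = c z" using join[OF c, of "through d z"] True by (auto simp: T_iff)
      ultimately show ?thesis using zd Td by (simp add: pull_apart_through_T True pull_apart_darts)
    next
      case False
      with zd have "through d z \<notin> K" by (simp add: T_iff)
      then show ?thesis using zd False nc dart_coloringsD(5)[OF c, of z]
        by (simp add: pull_apart_through pull_apart_darts pull_apart_crossing)
    qed
    show "(if through ?d z \<in> darts ?d then c (through ?d z) else 0) = (if z \<in> darts ?d then c z else 0)"
      if o: "z \<in> over ?d"
      using o zd dart_coloringsD(6)[OF c, of z] T_iff[of z]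
      by (simp add: pull_apart_through pull_apart_darts pull_apart_over)
  next
    fix z assume "crossing_at ?d z" and o: "z \<notin> over ?d"
    then have z: "z \<in> darts d - K" "z \<notin> T" "crossing_at d z"
      using pull_apart_crossing pull_apart_darts by (auto simp: crossing_at_def[of ?d])
    then have "z \<notin> K \<union> T" by blast
    then have n: "nxt d z \<notin> K \<union> T" "through d z \<notin> K \<union> T"
      using KT_nxt_iff KT_through_iff by blast+
    show "[2 * (if nxt ?d z \<in> darts ?d then c (nxt ?d z) else 0) =
        (if z \<in> darts ?d then c z else 0) + (if through ?d z \<in> darts ?d then c (through ?d z) else 0)] (mod m)"
      using dart_coloringsD(7)[OF c z(3)] o n z
      by (simp add: pull_apart_through pull_apart_darts pull_apart_over pull_apart_nxt)
  qed (use dart_coloringsD(2,3)[OF c] in \<open>auto simp: pull_apart_darts\<close>)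
  show "\<exists>c\<in>dart_colorings m d. \<forall>z\<in>darts ?d. c z = e z" if e: "e \<in> dart_colorings m ?d" for e
  proof -
    have eT: "0 \<le> e (through d z) \<and> e (through d z) < m \<and> e (through d z) = e (through d (opp d z))" if z: "z \<in> K" for z
    proof -
      have t: "through d z \<in> T" using z by blast
      then have "through d z \<in> darts ?d" using Td[OF t] by (simp add: pull_apart_darts)
      moreover have "\<not> crossing_at ?d (through d z)" using t pull_apart_crossing[OF Td[OF t]] by blast
      ultimately show ?thesis using dart_coloringsD(2,3,5)[OF e, of "through d z"] t
        by (simp add: pull_apart_through_T)
    qed
    obtain c where cK: "\<forall>z. z \<notin> K \<longrightarrow> c z = e z" "\<forall>z\<in>K. 0 \<le> c z \<and> c z < m \<and> c (opp d z) = c z"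
      and cT: "\<forall>z\<in>K \<union> T. if z \<in> over d then c (through d z) = c z else [2 * c (nxt d z) = c z + c (through d z)] (mod m)"
      using fill[OF e eT] by blast
    have "c \<in> dart_colorings m d"
    proof (rule dart_coloringsI)
      fix z assume z: "z \<in> darts d"
      have "0 \<le> c z \<and> c z < m \<and> c (opp d z) = c z"
      proof (cases "z \<in> K")
        case False
        then have "opp d z \<notin> K" using K(2)[of "opp d z"] by auto
        then show ?thesis using False z cK(1) dart_coloringsD(2-4)[OF e, of z]
          by (simp add: pull_apart_darts pull_apart_opp)
      qed (use cK in blast)
      then show "0 \<le> c z" "c z < m" "c (opp d z) = c z" by auto
      show "c (through d z) = c z" if nc: "\<not> crossing_at d z"
      proof -
        have n: "z \<notin> K \<union> T" using nc K(1) by auto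
        then have "through d z \<notin> K \<union> T" using KT_through_iff by blast
        then show ?thesis using n z nc cK(1) dart_coloringsD(5)[OF e, of z]
          by (simp add: pull_apart_darts pull_apart_through pull_apart_crossing)
      qed
      show "c (through d z) = c z" if o: "z \<in> over d"
      proof (cases "z \<in> K \<union> T")
        case False
        then have "through d z \<notin> K \<union> T" using KT_through_iff by blast
        then show ?thesis using False z o cK(1) dart_coloringsD(6)[OF e, of z]
          by (simp add: pull_apart_darts pull_apart_through pull_apart_over)
      qed (use cT o in auto)
    next
      fix z assume z: "crossing_at d z" "z \<notin> over d"
      show "[2 * c (nxt d z) = c z + c (through d z)] (mod m)"
      proof (cases "z \<in> K \<union> T")
        case False
        then have "through d z \<notin> K \<union> T" "nxt d z \<notin> K \<union> T" using KT_through_iff KT_nxt_iff by blast+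
        then show ?thesis using False z crossing_in[OF z(1)] cK(1) dart_coloringsD(7)[OF e, of z]
          by (simp add: pull_apart_darts pull_apart_through pull_apart_over pull_apart_crossing pull_apart_nxt)
      qed (use cT z in auto)
    next
      fix z assume z: "z \<notin> darts d"
      then have "z \<notin> K" using K(1) crossing_in by blast
      then show "c z = 0" using cK(1) dart_coloringsD(1)[OF e, of z] z by (simp add: pull_apart_darts)
    qed
    moreover have "\<forall>z\<in>darts ?d. c z = e z" using cK(1) by (simp add: pull_apart_darts)
    ultimately show ?thesis by blast
  qed
  fix c c' z assume c: "c \<in> dart_colorings m d" "c' \<in> dart_colorings m d"
    and eq: "\<And>z. z \<in> darts ?d \<Longrightarrow> c z = c' z" and z: "z \<in> darts d" "z \<notin> darts ?d"
  have "c y = c' y" if "y \<in> T" for y using eq Td[OF that] by (simp add: pull_apart_darts)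
  then show "c z = c' z" by (rule uniq[OF c]) (use z in \<open>auto simp: pull_apart_darts\<close>)
qed

end

text \<open>The loop gives both strands at the crossing a common color \<open>c\<close>; then the relation \<open>2 c = c + z\<close> forces the
  fourth dart to have this color as well.\<close>

lemma card_dart_colorings_reidemeister1:
  assumes "reidemeister1 d d'"
  shows "card (dart_colorings m d) = card (dart_colorings m d')"
proof -
  obtain a where a: "crossing_at d a" "opp d a = nxt d a" and d': "d' = pull_apart d {a, opp d a}"
    using assms unfolding reidemeister1_def by blast
  define b where "b = nxt d a"
  have b: "opp d a = b" "opp d b = a" "crossing_at d b" using a opp_opp[of a] by (auto simp: b_def)
  have nb: "nxt d b = through d a" using a(1) by (simp add: b_def through_def)
  have ntb: "nxt d (through d b) = a" using nxt4[OF a(1)] b(3) by (simp add: b_def through_def)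
  have nta: "nxt d (through d a) = through d b" by (simp add: nxt_through b_def)
  have dist: "a \<noteq> b" "a \<noteq> through d a" "a \<noteq> through d b" "b \<noteq> through d a" "b \<noteq> through d b"
    using nxt_neq_crossing[OF a(1)] nxt_neq_crossing[OF b(3)] a(1) b(3) by (auto simp: b_def through_def)
  have inj: "a \<in> darts d" "b \<in> darts d" using a(1) b(3) crossing_in by auto
  have same: "c a = c b \<and> c (through d a) = c b \<and> c (through d b) = c b" if c: "c \<in> dart_colorings m d" for c
  proof -
    have ab: "c a = c b" using dart_coloringsD(4)[OF c inj(1)] b by simp
    note r = dart_coloringsD(2)[OF c] dart_coloringsD(3)[OF c]
    show ?thesis
    proof (cases "a \<in> over d")
      case True
      then have "b \<notin> over d" using nxt_over[OF a(1)] by (simp add: b_def)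
      have ta: "c (through d a) = c b" using dart_coloringsD(6)[OF c inj(1) True] ab by simp
      moreover have "[c (through d b) = c b] (mod m)"
        using dart_coloringsD(7)[OF c b(3) \<open>b \<notin> over d\<close>] ta nb by (simp add: cong_iff_dvd_diff dvd_minus_iff algebra_simps)
          (metis dvd_minus_iff minus_diff_eq)
      ultimately show ?thesis using ab r inj by (auto intro: residues_eqI)
    next
      case False
      then have o: "b \<in> over d" using nxt_over[OF a(1)] by (simp add: b_def)
      have tb: "c (through d b) = c b" using dart_coloringsD(6)[OF c inj(2) o] by simp
      moreover have "[c (through d a) = c b] (mod m)"
        using dart_coloringsD(7)[OF c a(1) False] ab by (simp add: cong_iff_dvd_diff b_def[symmetric])
          (metis dvd_minus_iff minus_diff_eq)
      ultimately show ?thesis using ab r inj by (auto intro: residues_eqI)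
    qed
  qed
  show ?thesis unfolding d' b(1)
  proof (rule card_dart_colorings_pull_apart)
    fix e assume eT: "\<And>z. z \<in> {a, b} \<Longrightarrow> 0 \<le> e (through d z) \<and> e (through d z) < m \<and> e (through d z) = e (through d (opp d z))"
    define c where "c z = (if z \<in> {a, b} then e (through d a) else e z)" for z
    have "c z = e (through d a)" if "z \<in> {a, b, through d a, through d b}" for z
      using that eT[of b] b by (auto simp: c_def)
    then show "\<exists>c. (\<forall>z. z \<notin> {a, b} \<longrightarrow> c z = e z) \<and> (\<forall>z\<in>{a, b}. 0 \<le> c z \<and> c z < m \<and> c (opp d z) = c z) \<and>
        (\<forall>z\<in>{a, b} \<union> through d ` {a, b}. if z \<in> over d then c (through d z) = c z else [2 * c (nxt d z) = c z + c (through d z)] (mod m))"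
      using b nb ntb nta b_def eT[of a] by (intro exI[of _ c]) (auto simp: c_def)
  next
    fix c c' z assume "c \<in> dart_colorings m d" "c' \<in> dart_colorings m d" "\<And>z. z \<in> through d ` {a, b} \<Longrightarrow> c z = c' z" "z \<in> {a, b}"
    then show "c z = c' z" using same[of c] same[of c'] by (metis image_insert insertE insertI1 singletonD)
  next
    fix c z assume "c \<in> dart_colorings m d" "z \<in> {a, b}"
    then show "c (through d z) = c (through d (opp d z))" using same[of c] b by auto
  qed (use a b dist nb in \<open>auto simp: b_def[symmetric]\<close>)
qed

end

text \<open>The color of an under-strand of color \<open>v\<close> after it has passed below color \<open>u\<close> is \<open>2 u - v\<close>.\<close>

lemma cong_reflect: "[2 * u = (2 * u - v) mod m + v] (mod m)" "[2 * u = v + (2 * u - v) mod m] (mod (m::int))"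
  by (simp_all add: cong_def mod_simps)

context link_diagram_context
begin

lemma orbit_through: "orbit (nxt d) (through d x) = orbit (nxt d) x"
  by (simp add: through_def orbit_nxt)

text \<open>Passing below the same color twice is the identity, and the color of the lower edge of the 2-gon is
  forced.\<close>

lemma card_dart_colorings_bigon:
  assumes ca: "crossing_at d a" and cb: "crossing_at d b" and ne: "orbit (nxt d) a \<noteq> orbit (nxt d) b"
    and fa: "nxt d (opp d a) = b" and fb: "nxt d (opp d b) = a"
    and oa: "a \<in> over d" "opp d a \<in> over d"
  shows "card (dart_colorings m d) = card (dart_colorings m (pull_apart d {a, opp d a, b, opp d b}))"
proof -
  define a' where "a' = opp d a"
  define b' where "b' = opp d b"
  have opp: "opp d a = a'" "opp d a' = a" "opp d b = b'" "opp d b' = b" by (simp_all add: a'_def b'_def)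
  have nxt: "nxt d a' = b" "nxt d b' = a" using fa fb by (simp_all add: a'_def b'_def)
  have c': "crossing_at d a'" "crossing_at d b'" using ca cb nxt crossing_nxt by metis+
  have nxt2: "nxt d a = through d b'" "nxt d b = through d a'" using nxt c' by (auto simp: through_def)
  have nxtt: "nxt d (through d a') = through d b" "nxt d (through d b') = through d a"
    "nxt d (through d a) = b'" "nxt d (through d b) = a'"
    using nxt nxt2 by (simp_all add: nxt_through)
  have inn: "a \<in> darts d" "b \<in> darts d" "a' \<in> darts d" "b' \<in> darts d" using ca cb c' crossing_in by auto
  have over: "a \<in> over d" "a' \<in> over d" "b \<notin> over d" "b' \<notin> over d"
    using oa nxt_over[OF c'(1)] nxt_over[OF c'(2)] nxt by (simp_all add: a'_def)
  have orb: "orbit (nxt d) a' = orbit (nxt d) b" "orbit (nxt d) b' = orbit (nxt d) a"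
    using orbit_nxt[of a'] orbit_nxt[of b'] nxt by simp_all
  have tself: "through d z \<noteq> z" if "crossing_at d z" for z
    using nxt_neq_crossing(2)[OF that] that by (simp add: through_def)
  have neq: "through d z \<noteq> w" if "orbit (nxt d) z \<noteq> orbit (nxt d) w \<or> (z \<in> over d) \<noteq> (w \<in> over d)" for z w
    using that orbit_through[of z] through_over[of z] by metis
  have neT: "through d a \<notin> {a, a', b, b'}" "through d b \<notin> {a, a', b, b'}" 
    "through d a' \<notin> {a, a', b, b'}" "through d b' \<notin> {a, a', b, b'}"
    by (simp_all add: neq orb ne ne[symmetric] over tself ca cb c')
  have neK: "a \<noteq> b" "a \<noteq> b'" "a' \<noteq> b" "a' \<noteq> b'" using over by auto
  have col: "c a = c (through d a) \<and> c (through d a') = c (through d a) \<and> c a' = c a \<and> c b' = c b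
     \<and> [2 * c (through d a) = c b + c (through d b)] (mod m) \<and> c (through d b) = c (through d b')"
    if c: "c \<in> dart_colorings m d" for c
  proof -
    have 1: "c a' = c a" "c b' = c b" using dart_coloringsD(4)[OF c] inn opp by metis+
    have 2: "c (through d a) = c a" "c (through d a') = c a'" using dart_coloringsD(6)[OF c] inn over by blast+
    have 3: "[2 * c (through d a) = c b + c (through d b)] (mod m)"
      using dart_coloringsD(7)[OF c cb over(3)] 1 2 nxt2 by simp
    have "[2 * c (through d a) = c b + c (through d b')] (mod m)"
      using dart_coloringsD(7)[OF c c'(2) over(4)] 1 2 nxt by simp
    with 3 have "[c b + c (through d b) = c b + c (through d b')] (mod m)"
      using cong_sym cong_trans by blast
    then have "c (through d b) = c (through d b')"
      using dart_coloringsD(2,3)[OF c] inn by (intro residues_eqI) (auto simp: cong_add_lcancel)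
    with 1 2 3 show ?thesis by simp
  qed
  show ?thesis unfolding a'_def[symmetric] b'_def[symmetric]
  proof (rule card_dart_colorings_pull_apart)
    fix e assume eT: "\<And>z. z \<in> {a, a', b, b'} \<Longrightarrow> 0 \<le> e (through d z) \<and> e (through d z) < m \<and> e (through d z) = e (through d (opp d z))"
    define r where "r = (2 * e (through d a) - e (through d b)) mod m"
    define c where "c z = (if z = a \<or> z = a' then e (through d a) else if z = b \<or> z = b' then r else e z)" for z
    have e: "e (through d a') = e (through d a)" "e (through d b') = e (through d b)"
      "0 \<le> e (through d a)" "e (through d a) < m" using eT[of a] eT[of b] opp by simp_all
    have r: "0 \<le> r" "r < m" using e by (simp_all add: r_def)
    have c: "c a = e (through d a)" "c a' = e (through d a)" "c b = r" "c b' = r"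
      "c (through d a) = e (through d a)" "c (through d a') = e (through d a)"
      "c (through d b) = e (through d b)" "c (through d b') = e (through d b)"
      using neT neK e by (auto simp: c_def)
    have "\<forall>z\<in>{a, a', b, b'} \<union> through d ` {a, a', b, b'}.
        if z \<in> over d then c (through d z) = c z else [2 * c (nxt d z) = c z + c (through d z)] (mod m)"
      using over by (simp add: c nxt nxt2 nxtt) (simp add: r_def cong_reflect)
    moreover have "\<forall>z\<in>{a, a', b, b'}. 0 \<le> c z \<and> c z < m \<and> c (opp d z) = c z"
      using r e by (simp add: c opp)
    moreover have "\<forall>z. z \<notin> {a, a', b, b'} \<longrightarrow> c z = e z" by (simp add: c_def)
    ultimately show "\<exists>c. (\<forall>z. z \<notin> {a, a', b, b'} \<longrightarrow> c z = e z) \<and>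
        (\<forall>z\<in>{a, a', b, b'}. 0 \<le> c z \<and> c z < m \<and> c (opp d z) = c z) \<and>
        (\<forall>z\<in>{a, a', b, b'} \<union> through d ` {a, a', b, b'}.
           if z \<in> over d then c (through d z) = c z else [2 * c (nxt d z) = c z + c (through d z)] (mod m))"
      by blast
  next
    fix c c' z assume c: "c \<in> dart_colorings m d" "c' \<in> dart_colorings m d"
      and eq: "\<And>z. z \<in> through d ` {a, a', b, b'} \<Longrightarrow> c z = c' z" and z: "z \<in> {a, a', b, b'}"
    have t: "c (through d a) = c' (through d a)" "c (through d b) = c' (through d b)" using eq by auto
    have "[c b + c (through d b) = c' b + c (through d b)] (mod m)"
      using col[OF c(1)] col[OF c(2)] t cong_sym cong_trans by metis
    then have "c b = c' b"
      using dart_coloringsD(2,3)[OF c(1)] dart_coloringsD(2,3)[OF c(2)] inn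
      by (intro residues_eqI) (auto simp: cong_add_rcancel)
    then show "c z = c' z" using col[OF c(1)] col[OF c(2)] t z by auto
  next
    fix c z assume "c \<in> dart_colorings m d" "z \<in> {a, a', b, b'}"
    then show "c (through d z) = c (through d (opp d z))" using col[of c] opp by auto
  next
    fix z assume "z \<in> {a, a', b, b'}"
    then show "crossing_at d z" "opp d z \<in> {a, a', b, b'}" "through d z \<notin> {a, a', b, b'}"
      "nxt d z \<in> {a, a', b, b'} \<or> through d (nxt d z) \<in> {a, a', b, b'}"
      using ca cb c' opp neT nxt nxt2 by auto
  qed
qed

text \<open>The 2-gon can be read from either of its sides, and the upper strand is on one of them.\<close>

lemma card_dart_colorings_reidemeister2:
  assumes "reidemeister2 d d'"
  shows "card (dart_colorings m d) = card (dart_colorings m d')"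
proof -
  obtain a b where ab: "crossing_at d a" "crossing_at d b" "orbit (nxt d) a \<noteq> orbit (nxt d) b"
       "nxt d (opp d a) = b" "nxt d (opp d b) = a" "a \<in> over d \<longleftrightarrow> opp d a \<in> over d"
    and d': "d' = pull_apart d {a, opp d a, b, opp d b}"
    using assms unfolding reidemeister2_def face_succ_def by blast
  show ?thesis
  proof (cases "a \<in> over d")
    case True
    then show ?thesis unfolding d' using ab by (intro card_dart_colorings_bigon) auto
  next
    case False
    have "crossing_at d (opp d a)" "crossing_at d (opp d b)" using ab crossing_nxt by metis+
    then have "b \<in> over d" "opp d b \<in> over d" using False ab nxt_over by metis+
    then have "card (dart_colorings m d) = card (dart_colorings m (pull_apart d {b, opp d b, a, opp d a}))"
      using ab by (intro card_dart_colorings_bigon) auto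
    moreover have "{b, opp d b, a, opp d a} = {a, opp d a, b, opp d b}" by blast
    ultimately show ?thesis unfolding d' by simp
  qed
qed

end


section \<open>The third Reidemeister move\<close>

text \<open>Here \<open>a\<close> is the upper strand, \<open>b\<close> the lower one. Reflecting at the color of \<open>c\<close> and then at the color of \<open>a\<close> is
  the same as reflecting at the color of \<open>a\<close> and then at the color that \<open>c\<close> has on the other side of \<open>a\<close>.\<close>

lemma triangle_top_bottom:
  fixes m :: int
  assumes A: "pa = ra" "[2 * pa = rc + qc] (mod m)" and B: "ra = qa" "[2 * qa = pb + rb] (mod m)"
    and C: "pc = rc" "[2 * pc = rb + qb] (mod m)"
  shows "[2 * qa = pc + qc] (mod m)" "[2 * pa = (2 * pa - qb) mod m + qb] (mod m)"
    "[2 * qc = pb + (2 * pa - qb) mod m] (mod m)"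
proof -
  show "[2 * qa = pc + qc] (mod m)" using A B C by simp
  show "[2 * pa = (2 * pa - qb) mod m + qb] (mod m)" by (rule cong_reflect)
  have "m dvd 2 * (2 * pa - (rc + qc)) - (2 * qa - (pb + rb)) + (2 * pc - (rb + qb))"
    using A(2) B(2) C(2) unfolding cong_iff_dvd_diff by (simp only: dvd_add dvd_diff dvd_mult)
  then have "m dvd - (2 * qc - (pb + (2 * pa - qb)))" using A B C by (simp add: algebra_simps)
  then have "[2 * qc = pb + (2 * pa - qb)] (mod m)" by (simp only: cong_iff_dvd_diff dvd_minus_iff)
  then show "[2 * qc = pb + (2 * pa - qb) mod m] (mod m)" by (simp add: cong_def mod_simps)
qed

text \<open>The coloring condition at a crossing of a strand with colors \<open>x\<close>, \<open>x'\<close> and a strand with colors \<open>y\<close>, \<open>y'\<close>, where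
  \<open>up\<close> says that the first strand is the upper one.\<close>

definition crossing_colors :: "int \<Rightarrow> bool \<Rightarrow> int \<Rightarrow> int \<Rightarrow> int \<Rightarrow> int \<Rightarrow> bool" where
  "crossing_colors m up x x' y y' \<longleftrightarrow>
     (if up then x = x' \<and> [2 * x = y + y'] (mod m) else y = y' \<and> [2 * y = x + x'] (mod m))"

text \<open>If the strand \<open>a\<close> is on top, the other two can be in either order; the two orders are mirror images.\<close>

lemma triangle_colors_top:
  assumes m: "m > 0" and range: "0 \<le> pa" "pa < m" "0 \<le> qc" "qc < m" "0 \<le> pb" "pb < m" "0 \<le> qb" "qb < m" "0 \<le> pc" "pc < m" "0 \<le> qa" "qa < m"
    and A: "crossing_colors m True pa ra rc qc" and B: "crossing_colors m False pb rb ra qa"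
    and C: "crossing_colors m up pc rc rb qb"
  shows "\<exists>ra' rb' rc'. 0 \<le> ra' \<and> ra' < m \<and> 0 \<le> rb' \<and> rb' < m \<and> 0 \<le> rc' \<and> rc' < m \<and>
    crossing_colors m True ra' qa pc rc' \<and> crossing_colors m False rb' qb pa ra' \<and> crossing_colors m up rc' qc pb rb'"
proof (cases up)
  case True
  have e: "pa = ra" "[2 * pa = rc + qc] (mod m)" "ra = qa" "[2 * qa = pb + rb] (mod m)"
    "pc = rc" "[2 * pc = rb + qb] (mod m)"
    using A B C True by (auto simp: crossing_colors_def)
  show ?thesis using triangle_top_bottom[OF e] True range m e
    by (intro exI[of _ qa] exI[of _ "(2 * pa - qb) mod m"] exI[of _ qc]) (auto simp: crossing_colors_def)
next
  case False
  have e: "qa = ra" "[2 * qa = rb + pb] (mod m)" "ra = pa" "[2 * pa = qc + rc] (mod m)"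
    "qb = rb" "[2 * qb = rc + pc] (mod m)"
    using A B C False by (auto simp: crossing_colors_def add.commute)
  show ?thesis using triangle_top_bottom[OF e] False range m e
    by (intro exI[of _ pa] exI[of _ pb] exI[of _ "(2 * qa - pc) mod m"]) (auto simp: crossing_colors_def add.commute)
qed

text \<open>The strand \<open>x\<close> of the triangle has the outer colors \<open>px\<close>, \<open>qx\<close> and the color \<open>rx\<close> between its two crossings. After
  the move it meets the two crossings in the opposite order, with some color \<open>rx'\<close> in between. As the strands
  are not cyclically ordered by height, one of them is on top of both others; up to rotation it is \<open>a\<close>.\<close>

lemma triangle_colors:
  assumes m: "m > 0" and range: "0 \<le> pa" "pa < m" "0 \<le> qa" "qa < m" "0 \<le> pb" "pb < m" "0 \<le> qb" "qb < m" "0 \<le> pc" "pc < m" "0 \<le> qc" "qc < m"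
    and A: "crossing_colors m ua pa ra rc qc" and B: "crossing_colors m ub pb rb ra qa"
    and C: "crossing_colors m uc pc rc rb qb" and acyclic: "\<not> ((ua \<longleftrightarrow> ub) \<and> (ub \<longleftrightarrow> uc))"
  shows "\<exists>ra' rb' rc'. 0 \<le> ra' \<and> ra' < m \<and> 0 \<le> rb' \<and> rb' < m \<and> 0 \<le> rc' \<and> rc' < m \<and>
    crossing_colors m ua ra' qa pc rc' \<and> crossing_colors m ub rb' qb pa ra' \<and> crossing_colors m uc rc' qc pb rb'"
proof -
  consider "ua" "\<not> ub" | "ub" "\<not> uc" | "uc" "\<not> ua" using acyclic by blast
  then show ?thesis
  proof cases
    case 1
    then show ?thesis using triangle_colors_top[of m pa qc pb qb pc qa ra rc rb uc] assms by simp
  next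
    case 2
    then show ?thesis using triangle_colors_top[of m pb qa pc qc pa qb rb ra rc ua] assms by simp blast
  next
    case 3
    then show ?thesis using triangle_colors_top[of m pc qb pa qa pb qc rc rb ra ub] assms by simp blast
  qed
qed

lemma triangle_colors_unique_top:
  assumes range: "0 \<le> rb" "rb < m" "0 \<le> rc" "rc < m" "0 \<le> sb" "sb < m" "0 \<le> sc" "sc < m"
    and A: "crossing_colors m True pa ra rc qc" and B: "crossing_colors m False pb rb ra qa"
    and A': "crossing_colors m True pa sa sc qc" and B': "crossing_colors m False pb sb sa qa"
  shows "ra = sa \<and> rb = sb \<and> rc = sc"
proof -
  have e: "pa = ra" "[2 * pa = rc + qc] (mod m)" "ra = qa" "[2 * qa = pb + rb] (mod m)"
    "pa = sa" "[2 * pa = sc + qc] (mod m)" "sa = qa" "[2 * qa = pb + sb] (mod m)"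
    using A B A' B' by (auto simp: crossing_colors_def)
  have "[rc + qc = sc + qc] (mod m)" by (rule cong_trans[OF cong_sym]) (rule e)+
  then have "[rc = sc] (mod m)" by (simp add: cong_add_rcancel)
  moreover have "[pb + rb = pb + sb] (mod m)" by (rule cong_trans[OF cong_sym]) (rule e)+
  then have "[rb = sb] (mod m)" by (simp add: cong_add_lcancel)
  ultimately have "rc = sc" "rb = sb" using range by (auto intro: residues_eqI)
  then show ?thesis using e by simp
qed

text \<open>The colors inside of the triangle are determined by the outer colors, again by going from the top strand
  to the others.\<close>

lemma triangle_colors_unique:
  assumes acyclic: "\<not> ((ua \<longleftrightarrow> ub) \<and> (ub \<longleftrightarrow> uc))"
    and range: "0 \<le> ra" "ra < m" "0 \<le> rb" "rb < m" "0 \<le> rc" "rc < m" "0 \<le> sa" "sa < m" "0 \<le> sb" "sb < m" "0 \<le> sc" "sc < m"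
    and A: "crossing_colors m ua pa ra rc qc" and B: "crossing_colors m ub pb rb ra qa"
    and C: "crossing_colors m uc pc rc rb qb"
    and A': "crossing_colors m ua pa sa sc qc" and B': "crossing_colors m ub pb sb sa qa"
    and C': "crossing_colors m uc pc sc sb qb"
  shows "ra = sa \<and> rb = sb \<and> rc = sc"
proof -
  consider "ua" "\<not> ub" | "ub" "\<not> uc" | "uc" "\<not> ua" using acyclic by blast
  then show ?thesis
  proof cases
    case 1
    then show ?thesis using triangle_colors_unique_top[of rb m rc sb sc pa ra qc pb qa sa] assms by simp
  next
    case 2
    then show ?thesis using triangle_colors_unique_top[of rc m ra sc sa pb rb qa pc qb sb] assms by simp
  next
    case 3
    then show ?thesis using triangle_colors_unique_top[of ra m rb sa sb pc rc qb pa qc sc] assms by simp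
  qed
qed

lemma transpose_comp_disjoint:
  "p \<noteq> r \<Longrightarrow> p \<noteq> t \<Longrightarrow> q \<noteq> r \<Longrightarrow> q \<noteq> t \<Longrightarrow>
    transpose p q \<circ> transpose r t = transpose r t \<circ> transpose p q"
  by (auto simp: fun_eq_iff transpose_def)

context link_diagram_context
begin

lemma crossing_colors_at:
  assumes x: "x \<in> dart_colorings m d" and w: "crossing_at d w" and z: "nxt d w = z"
  shows "crossing_colors m (z \<in> over d) (x (through d z)) (x z) (x w) (x (through d w))"
proof -
  have zc: "crossing_at d z" using w z by auto
  have n: "nxt d z = through d w" using z w by (auto simp: through_def)
  have o: "z \<in> over d \<longleftrightarrow> w \<notin> over d" using nxt_over[OF w] z by simp
  show ?thesis
  proof (cases "z \<in> over d")
    case True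
    then show ?thesis
      using dart_coloringsD(6)[OF x crossing_in[OF zc] True] dart_coloringsD(7)[OF x w] o z
      by (simp add: crossing_colors_def)
  next
    case False
    then have wo: "w \<in> over d" using o by simp
    show ?thesis
      using dart_coloringsD(6)[OF x crossing_in[OF w] wo] dart_coloringsD(7)[OF x zc False] False n
      by (simp add: crossing_colors_def add.commute)
  qed
qed

lemma crossing_colorsD:
  assumes w: "crossing_at d w" and z: "nxt d w = z"
    and colors: "crossing_colors m (z \<in> over d) (x (through d z)) (x z) (x w) (x (through d w))"
    and y: "y \<in> {w, z, through d w, through d z}"
  shows "if y \<in> over d then x (through d y) = x y else [2 * x (nxt d y) = x y + x (through d y)] (mod m)"
proof -
  have n: "nxt d z = through d w" "nxt d (through d w) = through d z" "nxt d (through d z) = w"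
    using z w nxt4[OF w] by (auto simp: through_def)
  have o: "z \<in> over d \<longleftrightarrow> w \<notin> over d" using nxt_over[OF w] z by simp
  show ?thesis
    using y colors o n z by (auto simp: crossing_colors_def add.commute)
qed

end

text \<open>The strand of the side \<open>a\<close> consists of the inner darts \<open>a\<close>, \<open>a'\<close> of this side and of the outer darts \<open>A1\<close>, \<open>A2\<close>
  that continue it beyond the crossings, in the order \<open>A1\<close>, \<open>a\<close>, \<open>a'\<close>, \<open>A2\<close>; likewise for \<open>b\<close> and \<open>c\<close>. The darts around
  the crossing between the sides \<open>c\<close> and \<open>a\<close> are, in this order, \<open>c'\<close>, \<open>a\<close>, \<open>C2\<close>, \<open>A1\<close>.\<close>

locale triangle_context = link_diagram_context +
  fixes a b c :: nat
  assumes crossings: "crossing_at d a" "crossing_at d b" "crossing_at d c"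
    and different: "orbit (nxt d) a \<noteq> orbit (nxt d) b" "orbit (nxt d) b \<noteq> orbit (nxt d) c"
      "orbit (nxt d) c \<noteq> orbit (nxt d) a"
    and triangle: "nxt d (opp d a) = b" "nxt d (opp d b) = c" "nxt d (opp d c) = a"
    and acyclic: "\<not> ((a \<in> over d \<longleftrightarrow> b \<in> over d) \<and> (b \<in> over d \<longleftrightarrow> c \<in> over d))"
begin

definition "a' = opp d a"
definition "b' = opp d b"
definition "c' = opp d c"
definition "A1 = through d a"
definition "B1 = through d b"
definition "C1 = through d c"
definition "A2 = through d a'"
definition "B2 = through d b'"
definition "C2 = through d c'"

lemma through_simps: "through d a = A1" "through d b = B1" "through d c = C1"
  "through d a' = A2" "through d b' = B2" "through d c' = C2"
  "through d A1 = a" "through d B1 = b" "through d C1 = c"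
  "through d A2 = a'" "through d B2 = b'" "through d C2 = c'"
  by (simp_all add: A1_def A2_def B1_def B2_def C1_def C2_def)

lemma opp_simps: "opp d a = a'" "opp d b = b'" "opp d c = c'" "opp d a' = a" "opp d b' = b" "opp d c' = c"
  by (simp_all add: a'_def b'_def c'_def)

lemma nxt_inner: "nxt d a' = b" "nxt d b' = c" "nxt d c' = a"
  using triangle by (simp_all add: a'_def b'_def c'_def)

lemma inner_crossings: "crossing_at d a'" "crossing_at d b'" "crossing_at d c'"
  using crossings nxt_inner crossing_nxt by metis+

lemma all_crossings: "crossing_at d A1" "crossing_at d B1" "crossing_at d C1"
    "crossing_at d A2" "crossing_at d B2" "crossing_at d C2"
  using crossings inner_crossings by (simp_all add: A1_def A2_def B1_def B2_def C1_def C2_def)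

lemma nxt_simps: "nxt d a = C2" "nxt d b = A2" "nxt d c = B2"
  "nxt d A2 = B1" "nxt d B2 = C1" "nxt d C2 = A1" "nxt d A1 = c'" "nxt d B1 = a'" "nxt d C1 = b'"
proof -
  show 1: "nxt d a = C2" "nxt d b = A2" "nxt d c = B2"
    using nxt_inner inner_crossings by (auto simp: A2_def B2_def C2_def through_def)
  show 2: "nxt d A2 = B1" "nxt d B2 = C1" "nxt d C2 = A1"
    using nxt_inner by (simp_all add: A2_def B2_def C2_def A1_def B1_def C1_def nxt_through)
  show "nxt d A1 = c'" "nxt d B1 = a'" "nxt d C1 = b'"
    using 1 2 nxt_inner nxt4[of a'] nxt4[of b'] nxt4[of c'] inner_crossings by simp_all
qed

lemma orbit_eqs:
  "orbit (nxt d) c' = orbit (nxt d) a" "orbit (nxt d) C2 = orbit (nxt d) a" "orbit (nxt d) A1 = orbit (nxt d) a"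
  "orbit (nxt d) a' = orbit (nxt d) b" "orbit (nxt d) A2 = orbit (nxt d) b" "orbit (nxt d) B1 = orbit (nxt d) b"
  "orbit (nxt d) b' = orbit (nxt d) c" "orbit (nxt d) B2 = orbit (nxt d) c" "orbit (nxt d) C1 = orbit (nxt d) c"
  using orbit_nxt[of c'] orbit_nxt[of a'] orbit_nxt[of b'] nxt_inner orbit_through
  by (simp_all add: A1_def A2_def B1_def B2_def C1_def C2_def)

lemma distinct_darts: "distinct [a, A1, c', C2, b, B1, a', A2, c, C1, b', B2]"
proof -
  have ne: "y \<noteq> z" if "orbit (nxt d) y \<noteq> orbit (nxt d) z" for y z using that by blast
  have four: "distinct [w, nxt d w, nxt d (nxt d w), nxt d (nxt d (nxt d w))]" if "crossing_at d w" for w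
    using nxt_neq_crossing[OF that] nxt_neq_crossing[of "nxt d w"] nxt_neq_crossing[of "nxt d (nxt d w)"] that by simp
  note 1 = four[OF inner_crossings(3), unfolded nxt_inner nxt_simps]
  note 2 = four[OF inner_crossings(1), unfolded nxt_inner nxt_simps]
  note 3 = four[OF inner_crossings(2), unfolded nxt_inner nxt_simps]
  show ?thesis
    using 1 2 3 by (auto simp: ne orbit_eqs different different[symmetric])
qed

text \<open>Together with the previous lemma this gives the inequalities in both directions, as needed by the simplifier.\<close>

lemma distinct_darts_rev: "distinct [B2, b', C1, c, A2, a', B1, b, C2, c', A1, a]"
  using distinct_darts unfolding distinct_rev[of "[a, A1, c', C2, b, B1, a', A2, c, C1, b', B2]", symmetric] by simp

lemmas neqs = distinct_darts[simplified] distinct_darts_rev[simplified]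

definition "s = slide d a \<circ> slide d b \<circ> slide d c"

lemma slide_eq: "slide d a = transpose a A2 \<circ> transpose a' A1" "slide d b = transpose b B2 \<circ> transpose b' B1"
  "slide d c = transpose c C2 \<circ> transpose c' C1"
  by (simp_all add: slide_def opp_simps through_simps)

definition "inner = {a, a', b, b', c, c'}"
definition "outer = {A1, A2, B1, B2, C1, C2}"

lemma s_simps: "s a = A2" "s b = B2" "s c = C2" "s a' = A1" "s b' = B1" "s c' = C1"
  "s A2 = a" "s B2 = b" "s C2 = c" "s A1 = a'" "s B1 = b'" "s C1 = c'"
  "z \<notin> inner \<Longrightarrow> z \<notin> outer \<Longrightarrow> s z = z"
  by (simp_all add: s_def slide_eq transpose_def inner_def outer_def neqs)

lemma s_s: "s (s z) = z"
  by (cases "z \<in> inner \<or> z \<in> outer") (auto simp: s_simps, auto simp: inner_def outer_def s_simps)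

lemma s_inner: "s z \<in> inner \<longleftrightarrow> z \<in> outer"
proof
  assume "z \<in> outer" then show "s z \<in> inner" by (auto simp: outer_def inner_def s_simps)
next
  assume "s z \<in> inner"
  then have "s (s z) \<in> outer" by (auto simp: outer_def inner_def s_simps)
  then show "z \<in> outer" by (simp add: s_s)
qed

lemma s_outer: "s z \<in> outer \<longleftrightarrow> z \<in> inner"
  using s_inner[of "s z"] by (simp add: s_s)

lemma opp_inner: "opp d z \<in> inner \<longleftrightarrow> z \<in> inner"
proof -
  have "opp d z \<in> inner" if "z \<in> inner" for z using that by (auto simp: inner_def opp_simps)
  from this[of z] this[of "opp d z"] show ?thesis by auto
qed

lemma triangle_darts: "inner \<union> outer \<subseteq> darts d"
  using crossings inner_crossings all_crossings crossing_in by (auto simp: inner_def outer_def)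

text \<open>Inner and outer darts are all the darts at the three crossings, so that the rest of the diagram is not affected.\<close>

lemma nxt_triangle: "nxt d z \<in> inner \<union> outer \<longleftrightarrow> z \<in> inner \<union> outer"
proof -
  have step: "nxt d z \<in> inner \<union> outer" if "z \<in> inner \<union> outer" for z
    using that by (auto simp: inner_def outer_def nxt_simps nxt_inner)
  have "z \<in> inner \<union> outer" if n: "nxt d z \<in> inner \<union> outer"
  proof -
    have "crossing_at d (nxt d z)"
      using n crossings inner_crossings all_crossings by (auto simp: inner_def outer_def simp del: crossing_nxt)
    then have "nxt d (nxt d (nxt d (nxt d z))) = z" by (simp add: nxt4)
    then show ?thesis using step[OF step[OF step[OF n]]] by simp
  qed
  with step show ?thesis by blast
qed

lemma through_triangle: "through d z \<in> inner \<union> outer \<longleftrightarrow> z \<in> inner \<union> outer"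
  by (simp only: through_def nxt_triangle split: if_split) simp

definition "d' = d\<lparr>opp := s \<circ> opp d \<circ> s\<rparr>"

lemma d'_simps: "darts d' = darts d" "nxt d' = nxt d" "over d' = over d" "opp d' z = s (opp d (s z))"
  "crossing_at d' = crossing_at d" "through d' = through d"
  by (auto simp: d'_def crossing_at_def through_def fun_eq_iff)

text \<open>The move attaches the surroundings of an outer dart to an inner dart, and the outer darts become the sides of
  the new triangle. So the inner darts take over the outer colors, and the outer darts receive the new inner
  colors.\<close>

lemma slid_coloring:
  assumes x: "x \<in> dart_colorings m d"
  shows "\<exists>x'\<in>dart_colorings m d'. \<forall>z. z \<notin> outer \<longrightarrow> x' z = x (s z)"
proof -
  have inn: "a \<in> darts d" "a' \<in> darts d" "b \<in> darts d" "b' \<in> darts d" "c \<in> darts d" "c' \<in> darts d"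
    "A1 \<in> darts d" "A2 \<in> darts d" "B1 \<in> darts d" "B2 \<in> darts d" "C1 \<in> darts d" "C2 \<in> darts d"
    using triangle_darts by (auto simp: inner_def outer_def)
  note range = dart_coloringsD(2)[OF x] dart_coloringsD(3)[OF x]
  have m: "m > 0" using range[OF inn(1)] by simp
  have op: "x a' = x a" "x b' = x b" "x c' = x c"
    using dart_coloringsD(4)[OF x] inn opp_simps by metis+
  obtain ra rb rc where r: "0 \<le> ra" "ra < m" "0 \<le> rb" "rb < m" "0 \<le> rc" "rc < m"
    and new: "crossing_colors m (a \<in> over d) ra (x A2) (x C1) rc" "crossing_colors m (b \<in> over d) rb (x B2) (x A1) ra"
      "crossing_colors m (c \<in> over d) rc (x C2) (x B1) rb"
    using triangle_colors[of m "x A1" "x A2" "x B1" "x B2" "x C1" "x C2" "a \<in> over d" "x a" "x c" "b \<in> over d" "x b" "c \<in> over d"]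
      m range inn acyclic crossing_colors_at[OF x _ nxt_inner(3)] crossing_colors_at[OF x _ nxt_inner(1)]
      crossing_colors_at[OF x _ nxt_inner(2)] inner_crossings op
    by (auto simp: through_simps)
  define x' where "x' z = (if z \<in> {A1, A2} then ra else if z \<in> {B1, B2} then rb else if z \<in> {C1, C2} then rc else x (s z))" for z
  have x': "x' z = x (s z)" if "z \<notin> outer" for z using that by (auto simp: x'_def outer_def)
  have vals: "x' a = x A2" "x' a' = x A1" "x' A1 = ra" "x' A2 = ra" "x' b = x B2" "x' b' = x B1" "x' B1 = rb" "x' B2 = rb"
    "x' c = x C2" "x' c' = x C1" "x' C1 = rc" "x' C2 = rc"
    by (simp_all add: x'_def s_simps neqs)
  have cross: "if z \<in> over d then x' (through d z) = x' z else [2 * x' (nxt d z) = x' z + x' (through d z)] (mod m)"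
    if "z \<in> inner \<union> outer" for z
  proof -
    have "z \<in> {c', a, C2, A1} \<or> z \<in> {a', b, A2, B1} \<or> z \<in> {b', c, B2, C1}"
      using that by (auto simp: inner_def outer_def)
    then show ?thesis
      using crossing_colorsD[OF inner_crossings(3) nxt_inner(3), of m x' z]
        crossing_colorsD[OF inner_crossings(1) nxt_inner(1), of m x' z]
        crossing_colorsD[OF inner_crossings(2) nxt_inner(2), of m x' z] new
      unfolding through_simps vals by blast
  qed
  have away: "x' z = x z" if "z \<notin> inner \<union> outer" for z using that x' s_simps(13) by auto
  have "x' \<in> dart_colorings m d'"
  proof (rule dart_coloringsI; unfold d'_simps)
    fix z assume z: "z \<notin> darts d"
    then have "z \<notin> inner \<union> outer" using triangle_darts by blast
    then show "x' z = 0" using away dart_coloringsD(1)[OF x z] by simp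
  next
    fix z assume z: "z \<in> darts d"
    have "s z \<in> darts d" using z triangle_darts s_simps(13)[of z] s_inner[of z] s_outer[of z] by (metis Un_iff subsetD)
    then show "0 \<le> x' z" "x' z < m" using range r by (auto simp: x'_def)
    show "x' (s (opp d (s z))) = x' z"
    proof (cases "z \<in> outer")
      case True
      then show ?thesis unfolding outer_def by (auto simp: s_simps opp_simps vals)
    next
      case False
      then have "s (opp d (s z)) \<notin> outer" using s_outer s_inner opp_inner by metis
      then show ?thesis using False x' \<open>s z \<in> darts d\<close> dart_coloringsD(4)[OF x] by (simp add: s_s)
    qed
    show "x' (through d z) = x' z" if nc: "\<not> crossing_at d z"
    proof -
      have "z \<notin> inner \<union> outer" using nc crossings inner_crossings all_crossings by (auto simp: inner_def outer_def)
      then show ?thesis using away through_triangle dart_coloringsD(5)[OF x z nc] by metis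
    qed
    show "x' (through d z) = x' z" if o: "z \<in> over d"
    proof (cases "z \<in> inner \<union> outer")
      case True
      then show ?thesis using cross[OF True] o by simp
    next
      case False
      then show ?thesis using away through_triangle dart_coloringsD(6)[OF x z o] by metis
    qed
  next
    fix z assume z: "crossing_at d z" "z \<notin> over d"
    show "[2 * x' (nxt d z) = x' z + x' (through d z)] (mod m)"
    proof (cases "z \<in> inner \<union> outer")
      case True
      then show ?thesis using cross[OF True] z by simp
    next
      case False
      then show ?thesis using away through_triangle nxt_triangle dart_coloringsD(7)[OF x z] by metis
    qed
  qed
  with x' show ?thesis by blast
qed

lemma coloring_eqI:
  assumes x: "x \<in> dart_colorings m d" and y: "y \<in> dart_colorings m d"
    and eq: "\<And>z. z \<notin> inner \<Longrightarrow> x z = y z"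
  shows "x = y"
proof
  fix z
  have inn: "a \<in> darts d" "a' \<in> darts d" "b \<in> darts d" "b' \<in> darts d" "c \<in> darts d" "c' \<in> darts d"
    using triangle_darts by (auto simp: inner_def outer_def)
  have e: "x A1 = y A1" "x A2 = y A2" "x B1 = y B1" "x B2 = y B2" "x C1 = y C1" "x C2 = y C2"
    by (rule eq, simp add: inner_def neqs)+
  have op: "x a' = x a" "x b' = x b" "x c' = x c" "y a' = y a" "y b' = y b" "y c' = y c"
    using dart_coloringsD(4)[OF x] dart_coloringsD(4)[OF y] inn opp_simps by metis+
  note cc = crossing_colors_at[OF _ inner_crossings(3) nxt_inner(3)] crossing_colors_at[OF _ inner_crossings(1) nxt_inner(1)]
      crossing_colors_at[OF _ inner_crossings(2) nxt_inner(2)]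
  have "x a = y a \<and> x b = y b \<and> x c = y c"
    using triangle_colors_unique[OF acyclic, of "x a" m "x b" "x c" "y a" "y b" "y c" "x A1" "x C2" "x B1" "x A2" "x C1" "x B2"]
      dart_coloringsD(2,3)[OF x] dart_coloringsD(2,3)[OF y] inn cc[OF x] cc[OF y]
    by (simp add: through_simps op e)
  then show "x z = y z" using eq[of z] op by (cases "z \<in> inner") (auto simp: inner_def)
qed

lemma card_dart_colorings_le: "card (dart_colorings m d) \<le> card (dart_colorings m d')"
proof -
  obtain F where F: "\<And>x. x \<in> dart_colorings m d \<Longrightarrow> F x \<in> dart_colorings m d'"
    "\<And>x z. x \<in> dart_colorings m d \<Longrightarrow> z \<notin> outer \<Longrightarrow> F x z = x (s z)"
    using slid_coloring[of _ m] by metis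
  have "inj_on F (dart_colorings m d)"
  proof (rule inj_onI)
    fix x y assume xy: "x \<in> dart_colorings m d" "y \<in> dart_colorings m d" and eq: "F x = F y"
    show "x = y"
    proof (rule coloring_eqI[OF xy])
      fix z assume "z \<notin> inner"
      then have "s z \<notin> outer" by (simp add: s_outer)
      then show "x z = y z" using F(2)[OF xy(1), of "s z"] F(2)[OF xy(2), of "s z"] eq by (simp add: s_s)
    qed
  qed
  then show ?thesis using F(1) finite_darts
    by (intro card_inj_on_le[of F] finite_dart_colorings) (auto simp: d'_simps)
qed

text \<open>After the move the outer darts bound a triangle, and sliding it undoes the move. So it is enough to bound
  the number of colorings in one direction.\<close>

lemma opposite_triangle:
  assumes "link_diagram d'"
  shows "triangle_context d' A1 B1 C1"
proof -
  have "opp d' A1 = A2" "opp d' B1 = B2" "opp d' C1 = C2" by (simp_all add: d'_simps s_simps opp_simps)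
  then show ?thesis
    using assms crossings all_crossings different acyclic
    by unfold_locales (simp_all add: d'_simps nxt_simps orbit_eqs, simp add: A1_def B1_def C1_def)
qed

lemma opposite_slide:
  assumes "link_diagram d'"
  shows "triangle_context.d' d' A1 B1 C1 = d"
proof -
  interpret op: triangle_context d' A1 B1 C1 by (rule opposite_triangle[OF assms])
  have o: "opp d' A1 = A2" "opp d' B1 = B2" "opp d' C1 = C2" by (simp_all add: d'_simps s_simps opp_simps)
  have sl: "slide d' A1 = slide d a" "slide d' B1 = slide d b" "slide d' C1 = slide d c"
    unfolding slide_eq unfolding slide_def o unfolding d'_simps through_simps
    by (simp_all add: transpose_comp_disjoint neqs transpose_commute[of A1] transpose_commute[of A2]
      transpose_commute[of B1] transpose_commute[of B2] transpose_commute[of C1] transpose_commute[of C2])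
  have "op.s = s" by (simp add: op.s_def s_def sl)
  then have "op.s \<circ> opp d' \<circ> op.s = opp d" by (auto simp: fun_eq_iff d'_simps s_s)
  then show ?thesis unfolding op.d'_def by (simp add: d'_def)
qed

lemma card_dart_colorings_slide:
  assumes "link_diagram d'"
  shows "card (dart_colorings m d) = card (dart_colorings m d')"
proof (rule antisym[OF card_dart_colorings_le])
  interpret op: triangle_context d' A1 B1 C1 by (rule opposite_triangle[OF assms])
  show "card (dart_colorings m d') \<le> card (dart_colorings m d)"
    using op.card_dart_colorings_le[of m] by (simp add: opposite_slide[OF assms])
qed

end

lemma card_dart_colorings_reidemeister3:
  assumes "link_diagram d" "link_diagram d'" "reidemeister3 d d'"
  shows "card (dart_colorings m d) = card (dart_colorings m d')"
proof -
  interpret link_diagram_context d by unfold_locales fact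
  obtain a b c where abc: "crossing_at d a" "crossing_at d b" "crossing_at d c"
       "orbit (nxt d) a \<noteq> orbit (nxt d) b" "orbit (nxt d) b \<noteq> orbit (nxt d) c"
       "orbit (nxt d) c \<noteq> orbit (nxt d) a"
       "nxt d (opp d a) = b" "nxt d (opp d b) = c" "nxt d (opp d c) = a"
       "\<not> ((a \<in> over d \<longleftrightarrow> b \<in> over d) \<and> (b \<in> over d \<longleftrightarrow> c \<in> over d))"
    and d': "d' = d\<lparr>opp := (slide d a \<circ> slide d b \<circ> slide d c) \<circ> opp d \<circ> (slide d a \<circ> slide d b \<circ> slide d c)\<rparr>"
    using assms(3) unfolding reidemeister3_def face_succ_def Let_def by blast
  interpret triangle_context d a b c by unfold_locales fact+
  show ?thesis using card_dart_colorings_slide assms(2) unfolding d'_def s_def d' by blast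
qed

lemma card_dart_colorings_elementary_move:
  assumes "elementary_move d d'"
  shows "card (dart_colorings m d) = card (dart_colorings m d')"
proof -
  have ld: "link_diagram d" "link_diagram d'" using assms by (auto simp: elementary_move_def)
  interpret link_diagram_context d by unfold_locales fact
  show ?thesis
    using assms card_dart_colorings_iso[OF ld] card_dart_colorings_reidemeister1 card_dart_colorings_reidemeister2
      card_dart_colorings_reidemeister3[OF ld] card_dart_colorings_forget_point
    unfolding elementary_move_def point_move_def by blast
qed

lemma card_dart_colorings_link:
  assumes "equivclp elementary_move d d'"
  shows "card (dart_colorings m d) = card (dart_colorings m d')"
  using assms
  by (induction rule: equivclp_induct) (metis card_dart_colorings_elementary_move)+


section \<open>Arithmetic of the colors along an under-strand\<close>

lemma card_multiples_annihilated:
  fixes m D :: nat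
  assumes m: "m > 0"
  shows "card {w \<in> {0..<int m}. int m dvd int D * w} = gcd m D"
proof -
  define g where "g = gcd m D"
  have g0: "g > 0" using m by (simp add: g_def)
  obtain m' D' where md: "m = g * m'" "D = g * D'" by (metis g_def dvdE gcd_dvd1 gcd_dvd2)
  have cop: "coprime m' D'"
  proof -
    have "g * gcd m' D' = g" unfolding g_def using md g_def by (metis gcd_mult_distrib_nat)
    then show ?thesis using g0 by (simp add: coprime_iff_gcd_eq_1)
  qed
  have "{w \<in> {0..<int m}. int m dvd int D * w} = (\<lambda>k. int m' * k) ` {0..<int g}"
  proof (rule subset_antisym; rule subsetI)
    fix w assume "w \<in> {w \<in> {0..<int m}. int m dvd int D * w}"
    then have w: "0 \<le> w" "w < int m" "int m dvd int D * w" by auto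
    from w(3) have "int g * int m' dvd int g * (int D' * w)" by (simp add: md mult.assoc)
    then have "int m' dvd int D' * w" using g0 by simp
    moreover have "coprime (int m') (int D')" using cop by simp
    ultimately have "int m' dvd w" using coprime_dvd_mult_right_iff by blast
    then obtain k where k: "w = int m' * k" ..
    have m'0: "m' > 0" using m md by (metis gr0I mult_0_right)
    have "0 \<le> k" using w(1) m'0 unfolding k by (simp add: zero_le_mult_iff)
    moreover have "int m' * k < int m' * int g" using w(2) unfolding k by (simp add: md mult.commute)
    then have "k < int g" using m'0 by simp
    ultimately show "w \<in> (\<lambda>k. int m' * k) ` {0..<int g}" using k by auto
  next
    fix w assume "w \<in> (\<lambda>k. int m' * k) ` {0..<int g}"
    then obtain k where k: "w = int m' * k" "k \<in> {0..<int g}" by (rule imageE)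
    then have k: "w = int m' * k" "0 \<le> k" "k < int g" by simp_all
    have m'0: "m' > 0" using m md by (metis gr0I mult_0_right)
    have "int m' * k < int m' * int g" using k(3) m'0 by simp
    then show "w \<in> {w \<in> {0..<int m}. int m dvd int D * w}"
      using k(2) unfolding k(1) md by (simp add: mult.commute mult.left_commute mult.assoc)
  qed
  moreover have "inj_on (\<lambda>k. int m' * k) {0..<int g}"
    using m md by (auto intro!: inj_onI)
  ultimately show ?thesis by (simp add: card_image g_def)
qed

text \<open>A pair \<open>(u, v)\<close> is given by \<open>u\<close> and by the difference \<open>w = v - u\<close>, on which there is only the condition that it is
  annihilated by the greatest common divisor.\<close>

lemma card_color_pairs:
  fixes m p q :: nat
  assumes m: "m > 0"
  shows "card {(u, v). u \<in> {0..<int m} \<and> v \<in> {0..<int m} \<and> int m dvd int p * (v - u) \<and> int m dvd int q * (v - u)}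
    = m * gcd m (gcd p q)"
proof -
  have gcd: "int m dvd int p * w \<and> int m dvd int q * w \<longleftrightarrow> int m dvd int (gcd p q) * w" for w
  proof
    assume dv: "int m dvd int p * w \<and> int m dvd int q * w"
    obtain a b where "a * int p + b * int q = gcd (int p) (int q)" using bezout_int by blast
    then have "int (gcd p q) = a * int p + b * int q" by simp
    then have "int (gcd p q) * w = a * (int p * w) + b * (int q * w)" by (simp only: distrib_right mult.assoc)
    then show "int m dvd int (gcd p q) * w" using dv by (simp only: dvd_add dvd_mult)
  next
    assume dv: "int m dvd int (gcd p q) * w"
    have "int (gcd p q) * w dvd int p * w" "int (gcd p q) * w dvd int q * w"
      by (rule mult_dvd_mono, simp_all)+
    then show "int m dvd int p * w \<and> int m dvd int q * w" using dv dvd_trans by blast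
  qed
  define P where "P = {(u, v). u \<in> {0..<int m} \<and> v \<in> {0..<int m} \<and> int m dvd int p * (v - u) \<and> int m dvd int q * (v - u)}"
  define Z where "Z = {w \<in> {0..<int m}. int m dvd int (gcd p q) * w}"
  have dvd_mod: "int m dvd k * (w mod int m) \<longleftrightarrow> int m dvd k * w" for k w
    by (simp add: dvd_eq_mod_eq_0 mod_mult_right_eq)
  have shift: "int m dvd int k * ((u + w) mod int m - u) \<longleftrightarrow> int m dvd int k * w" for k u w
  proof -
    have "int m dvd int k * ((u + w) mod int m - u) \<longleftrightarrow> int m dvd int k * (((u + w) mod int m - u) mod int m)"
      by (simp only: dvd_mod)
    also have "((u + w) mod int m - u) mod int m = w mod int m" by (simp add: mod_diff_left_eq)
    finally show ?thesis by (simp only: dvd_mod)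
  qed
  have P_iff: "(u, v) \<in> P \<longleftrightarrow> u \<in> {0..<int m} \<and> v \<in> {0..<int m} \<and> int m dvd int (gcd p q) * (v - u)" for u v
    by (simp only: P_def mem_Collect_eq prod.case gcd)
  have Z_iff: "w \<in> Z \<longleftrightarrow> w \<in> {0..<int m} \<and> int m dvd int (gcd p q) * w" for w
    by (simp only: Z_def mem_Collect_eq)
  have range: "x mod int m \<in> {0..<int m}" for x using m by simp
  have "bij_betw (\<lambda>(u, w). (u, (u + w) mod int m)) ({0..<int m} \<times> Z) P"
  proof (rule bij_betwI[where g = "\<lambda>(u, v). (u, (v - u) mod int m)"])
    show "(\<lambda>(u, w). (u, (u + w) mod int m)) \<in> {0..<int m} \<times> Z \<rightarrow> P"
      using range by (auto simp only: P_iff Z_iff shift mem_Sigma_iff Pi_iff split: prod.splits)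
    show "(\<lambda>(u, v). (u, (v - u) mod int m)) \<in> P \<rightarrow> {0..<int m} \<times> Z"
      using range by (auto simp only: P_iff Z_iff dvd_mod mem_Sigma_iff Pi_iff split: prod.splits)
    fix x assume "x \<in> {0..<int m} \<times> Z"
    then obtain u w where x: "x = (u, w)" and u: "u \<in> {0..<int m}" and "w \<in> Z" by blast
    then have "w \<in> {0..<int m}" by (simp only: Z_iff)
    with x u show "(\<lambda>(u, v). (u, (v - u) mod int m)) ((\<lambda>(u, w). (u, (u + w) mod int m)) x) = x"
      by (simp add: mod_diff_left_eq)
  next
    fix y assume "y \<in> P"
    then obtain u v where y: "y = (u, v)" and "(u, v) \<in> P" by (cases y) simp
    then have "u \<in> {0..<int m}" "v \<in> {0..<int m}" by (simp_all only: P_iff)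
    then show "(\<lambda>(u, w). (u, (u + w) mod int m)) ((\<lambda>(u, v). (u, (v - u) mod int m)) y) = y"
      unfolding y by (simp add: mod_add_right_eq)
  qed
  then have "card P = card ({0..<int m} \<times> Z)" by (rule bij_betw_same_card[symmetric])
  then show ?thesis
    using card_multiples_annihilated[OF m, of "gcd p q"] by (simp add: P_def Z_def card_cartesian_product)
qed

text \<open>The sequence 0, 2, -2, 4, -4, and so on: an under-strand that starts at a bridge of color \<open>u\<close> and passes first below
  a bridge of color \<open>u + w\<close> has the color \<open>u + strand_coeff i * w\<close> after \<open>i\<close> passes.\<close>

definition strand_coeff :: "nat \<Rightarrow> int" where
  "strand_coeff i = (if even i then - int i else int i + 1)"

lemma strand_coeff_0 [simp]: "strand_coeff 0 = 0"
  by (simp add: strand_coeff_def)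

lemma strand_coeff_Suc: "strand_coeff (Suc i) = (if even i then 2 else 0) - strand_coeff i"
  by (auto simp: strand_coeff_def)

lemma even_residues_covered:
  fixes D l :: nat
  assumes D: "0 < D" "D \<le> l" and r: "even r" "0 \<le> r" "r < int D"
  shows "\<exists>i<l. strand_coeff i = r"
proof (cases "r = 0")
  case True
  then show ?thesis using D by (intro exI[of _ 0]) simp
next
  case False
  with r have "odd (nat r - 1)" "int (nat r - 1) + 1 = r" "nat r - 1 < l" using D by (auto simp: even_nat_iff)
  then show ?thesis by (intro exI[of _ "nat r - 1"]) (simp add: strand_coeff_def)
qed

text \<open>For odd \<open>D\<close>, an odd residue \<open>r\<close> is represented by the even number \<open>r - D\<close>, which occurs among the first \<open>D\<close>
  coefficients.\<close>

lemma all_residues_covered: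
  fixes D l :: nat
  assumes D: "odd D" "D \<le> l" and r: "0 \<le> r" "r < int D"
  shows "\<exists>i<l. [strand_coeff i = r] (mod int D)"
proof (cases "even r")
  case True
  then show ?thesis using even_residues_covered[of D l r] D r odd_pos[OF D(1)] by (metis cong_refl)
next
  case False
  define i where "i = D - nat r"
  have nr: "nat r < D" "nat r > 0" "odd (nat r)" using False r by (auto simp: even_nat_iff order_less_le)
  then have "i < l" "even i" "int i = int D - r" using D r by (auto simp: i_def)
  then show ?thesis by (intro exI[of _ i]) (simp add: strand_coeff_def cong_iff_dvd_diff)
qed


section \<open>Two-bridge presentations\<close>

context link_diagram_context
begin

lemma length_reverse_path [simp]: "length (reverse_path d W) = length W"
  by (simp add: reverse_path_def)

lemma reverse_path_nth: "i < length W \<Longrightarrow> reverse_path d W ! i = opp d (W ! (length W - Suc i))"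
  by (simp add: reverse_path_def rev_nth)

lemma path_darts_reverse: "path_darts d (reverse_path d W) = path_darts d W"
  by (auto simp: path_darts_def reverse_path_def image_image)

lemma path_darts_nth: "path_darts d W = (\<lambda>i. W ! i) ` {..<length W} \<union> (\<lambda>i. opp d (W ! i)) ` {..<length W}"
  by (auto simp: path_darts_def in_set_conv_nth image_iff)

lemma path_darts_opp: "opp d z \<in> path_darts d W \<longleftrightarrow> z \<in> path_darts d W"
proof -
  have "opp d z \<in> path_darts d W" if "z \<in> path_darts d W" for z using that by (auto simp: path_darts_def)
  from this[of z] this[of "opp d z"] show ?thesis by auto
qed

context
  fixes W assumes W: "strand_path d W"
begin

lemma strand_nonempty: "W \<noteq> []" "0 < length W"
  using W by (auto simp: strand_path_def)

lemma strand_in: "i < length W \<Longrightarrow> W ! i \<in> darts d"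
  using W by (auto simp: strand_path_def)

lemma strand_step: "Suc i < length W \<Longrightarrow> crossing_at d (opp d (W ! i)) \<and> W ! Suc i = through d (opp d (W ! i))"
  using W successively_nth[of _ W i] unfolding strand_path_def by blast

lemma strand_crossing_Suc: "Suc i < length W \<Longrightarrow> crossing_at d (W ! Suc i)"
  using strand_step[of i] by simp

lemma strand_hd: "\<not> crossing_at d (W ! 0)"
  using W strand_nonempty by (simp add: strand_path_def hd_conv_nth)

lemma strand_last: "\<not> crossing_at d (opp d (W ! (length W - 1)))"
  using W strand_nonempty by (simp add: strand_path_def last_conv_nth)

lemma strand_path_darts_in: "path_darts d W \<subseteq> darts d"
  using strand_in by (auto simp: path_darts_nth)

lemma path_through: 
  assumes z: "z \<in> path_darts d W" and c: "crossing_at d z"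
  shows "through d z \<in> path_darts d W"
proof -
  from z consider i where "i < length W" "z = W ! i" | i where "i < length W" "z = opp d (W ! i)"
    by (auto simp: path_darts_nth)
  then show ?thesis
  proof cases
    case 1
    then obtain j where j: "i = Suc j" using c strand_hd by (cases i) auto
    then have "through d z = opp d (W ! j)" using strand_step[of j] 1 by simp
    then show ?thesis using 1 j by (auto simp: path_darts_nth)
  next
    case 2
    then have "i \<noteq> length W - 1" using c strand_last by auto
    then have "Suc i < length W" using 2 by simp
    then show ?thesis using strand_step[of i] 2 by (metis UnI1 image_eqI lessThan_iff path_darts_nth)
  qed
qed

lemma path_through_iff: "crossing_at d z \<Longrightarrow> through d z \<in> path_darts d W \<longleftrightarrow> z \<in> path_darts d W"
  using path_through[of z] path_through[of "through d z"] by auto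

lemma passes_nth: "Suc i < length W \<Longrightarrow> passes d W ! i = opp d (W ! i)"
  by (simp add: passes_def nth_butlast)

lemma length_passes: "length (passes d W) = length W - 1"
  by (simp add: passes_def)

lemma crossing_path_cases:
  assumes z: "z \<in> path_darts d W" and c: "crossing_at d z"
  obtains i where "Suc i < length W" "z = opp d (W ! i) \<or> z = through d (opp d (W ! i))"
proof -
  from z consider i where "i < length W" "z = W ! i" | i where "i < length W" "z = opp d (W ! i)"
    by (auto simp: path_darts_nth)
  then show ?thesis
  proof cases
    case 1
    then obtain j where j: "i = Suc j" using c strand_hd by (cases i) auto
    then show ?thesis using that[of j] strand_step[of j] 1 by simp
  next
    case 2
    then have "i \<noteq> length W - 1" using c strand_last by auto
    then show ?thesis using that[of i] 2 by simp
  qed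
qed

lemma point_path_cases:
  assumes z: "z \<in> path_darts d W" and c: "\<not> crossing_at d z"
  shows "z = W ! 0 \<or> z = opp d (W ! (length W - 1))"
proof -
  from z consider i where "i < length W" "z = W ! i" | i where "i < length W" "z = opp d (W ! i)"
    by (auto simp: path_darts_nth)
  then show ?thesis
  proof cases
    case 1
    then show ?thesis using c strand_crossing_Suc by (cases i) auto
  next
    case 2
    then have "\<not> Suc i < length W" using c strand_step by auto
    then have "i = length W - 1" using 2 by simp
    then show ?thesis using 2 by simp
  qed
qed

lemma path_ends_eq: "path_ends d W = {W ! 0, opp d (W ! (length W - 1))}"
  using strand_nonempty by (simp add: path_ends_def hd_conv_nth last_conv_nth)

lemma strand_path_reverse: "strand_path d (reverse_path d W)"
proof -
  have "crossing_at d (opp d (reverse_path d W ! i)) \<and>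
      reverse_path d W ! Suc i = through d (opp d (reverse_path d W ! i))" if i: "Suc i < length W" for i
  proof -
    define j where "j = length W - Suc (Suc i)"
    have j: "Suc j < length W" "length W - Suc i = Suc j" using i by (auto simp: j_def)
    have "reverse_path d W ! i = opp d (W ! Suc j)" "reverse_path d W ! Suc i = opp d (W ! j)"
      using i j by (simp_all add: reverse_path_nth j_def[symmetric])
    then show ?thesis using strand_step[OF j(1)] by simp
  qed
  then have step: "successively (\<lambda>x y. crossing_at d (opp d x) \<and> y = through d (opp d x)) (reverse_path d W)"
    by (simp add: successively_conv_nth)
  have "set (reverse_path d W) \<subseteq> path_darts d W" by (auto simp: reverse_path_def path_darts_def)
  then have "set (reverse_path d W) \<subseteq> darts d" using strand_path_darts_in by blast
  moreover have "hd (reverse_path d W) = opp d (last W)" "last (reverse_path d W) = opp d (hd W)"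
    using strand_nonempty by (simp_all add: reverse_path_def hd_rev last_rev hd_map last_map)
  moreover have "reverse_path d W \<noteq> []" using strand_nonempty by (simp add: reverse_path_def)
  ultimately show ?thesis using W step by (simp add: strand_path_def)
qed

text \<open>Distinctness makes the position of a dart on its strand well-defined, so that a coloring can be defined position by
  position.\<close>

lemma strand_index:
  assumes dist: "distinct (W @ reverse_path d W)"
  obtains f where "\<And>i. i < length W \<Longrightarrow> f (W ! i) = i" "\<And>i. i < length W \<Longrightarrow> f (opp d (W ! i)) = i"
proof
  define f where "f z = (SOME i. i < length W \<and> (z = W ! i \<or> z = opp d (W ! i)))" for z
  have d1: "W ! i = W ! j \<longleftrightarrow> i = j" if "i < length W" "j < length W" for i j
    using dist that by (simp add: nth_eq_iff_index_eq)
  have d2: "W ! i \<noteq> opp d (W ! j)" if "i < length W" "j < length W" for i j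
    using dist nth_mem[OF that(1)] nth_mem[OF that(2)] by (auto simp: reverse_path_def disjoint_iff)
  show "f (W ! i) = i" if "i < length W" for i
    unfolding f_def by (rule some_equality) (use that d1 d2 in auto)
  show "f (opp d (W ! i)) = i" if "i < length W" for i
    unfolding f_def by (rule some_equality) (use that d1 d2 in \<open>auto, metis\<close>)
qed

end
end

locale two_bridge_diagram = link_diagram_context +
  fixes A B U V :: "nat list"
  assumes presentation: "two_bridge_presentation d A B U V"
begin

abbreviation "PA \<equiv> path_darts d A"
abbreviation "PB \<equiv> path_darts d B"
abbreviation "PU \<equiv> path_darts d U"
abbreviation "PV \<equiv> path_darts d V"

lemma strands: "strand_path d A" "strand_path d B" "strand_path d U" "strand_path d V"
  using presentation by (auto simp: two_bridge_presentation_def)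

lemma set_path: "set (W @ reverse_path d W) = path_darts d W"
  by (auto simp: path_darts_def reverse_path_def)

lemma distinct_path: "W \<in> {A, B, U, V} \<Longrightarrow> distinct (W @ reverse_path d W)"
  using presentation by (auto simp: two_bridge_presentation_def)

lemma disjoint_paths: "PA \<inter> PB = {}" "PA \<inter> PU = {}" "PA \<inter> PV = {}" "PB \<inter> PU = {}" "PB \<inter> PV = {}" "PU \<inter> PV = {}"
proof -
  have "distinct ((A @ reverse_path d A) @ (B @ reverse_path d B) @ (U @ reverse_path d U) @ (V @ reverse_path d V))"
    using presentation by (simp add: two_bridge_presentation_def)
  then show "PA \<inter> PB = {}" "PA \<inter> PU = {}" "PA \<inter> PV = {}" "PB \<inter> PU = {}" "PB \<inter> PV = {}" "PU \<inter> PV = {}"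
    unfolding set_path[symmetric] distinct_append by auto
qed

lemma darts_paths: "darts d = PA \<union> PB \<union> PU \<union> PV"
  using presentation by (auto simp: two_bridge_presentation_def)

lemma ends_glued: "nxt d ` (path_ends d A \<union> path_ends d B) = path_ends d U \<union> path_ends d V"
  using presentation by (auto simp: two_bridge_presentation_def)

lemma bridge_over: "z \<in> PA \<union> PB \<Longrightarrow> crossing_at d z \<Longrightarrow> z \<in> over d"
proof -
  have "z \<in> over d" if W: "W \<in> {A, B}" "z \<in> path_darts d W" and c: "crossing_at d z" for W
  proof -
    have S: "strand_path d W" using W strands by blast
    obtain i where i: "Suc i < length W" "z = opp d (W ! i) \<or> z = through d (opp d (W ! i))"
      using crossing_path_cases[OF S W(2) c] .
    have "opp d (W ! i) \<in> set (passes d W)"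
      using i passes_nth[OF S i(1)] length_passes[OF S] by (metis Suc_lessE diff_Suc_1 nth_mem Suc_less_SucD)
    then have "opp d (W ! i) \<in> over d" using presentation W by (auto simp: two_bridge_presentation_def)
    then show ?thesis using i by auto
  qed
  then show "z \<in> PA \<union> PB \<Longrightarrow> crossing_at d z \<Longrightarrow> z \<in> over d" by blast
qed

lemma strand_under: "z \<in> PU \<union> PV \<Longrightarrow> z \<notin> over d"
proof -
  have "z \<notin> over d" if W: "W \<in> {U, V}" "z \<in> path_darts d W" and c: "crossing_at d z" for W
  proof -
    have S: "strand_path d W" using W strands by blast
    obtain i where i: "Suc i < length W" "z = opp d (W ! i) \<or> z = through d (opp d (W ! i))"
      using crossing_path_cases[OF S W(2) c] .
    have "opp d (W ! i) \<in> set (passes d W)"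
      using i passes_nth[OF S i(1)] length_passes[OF S] by (metis Suc_lessE diff_Suc_1 nth_mem Suc_less_SucD)
    then have "opp d (W ! i) \<notin> over d" using presentation W by (auto simp: two_bridge_presentation_def)
    then show ?thesis using i by auto
  qed
  then show "z \<in> PU \<union> PV \<Longrightarrow> z \<notin> over d" using over_crossing by blast
qed

text \<open>At a crossing a bridge lies above an under-strand, at a point an end of a bridge is attached to an
  end of an under-strand. In both cases a step around the vertex changes from the one kind of strand to the other.\<close>

lemma nxt_bridge_iff:
  assumes z: "z \<in> darts d"
  shows "nxt d z \<in> PA \<union> PB \<longleftrightarrow> z \<in> PU \<union> PV"
proof -
  have bridge: "w \<in> PA \<union> PB \<longleftrightarrow> w \<notin> PU \<union> PV" if "w \<in> darts d" for w
    using that darts_paths disjoint_paths by blast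
  show ?thesis
  proof (cases "crossing_at d z")
    case True
    then have "w \<in> PA \<union> PB \<longleftrightarrow> w \<in> over d" if "w \<in> {z, nxt d z}" for w
      using that bridge[of w] bridge_over[of w] strand_under[of w] z by auto
    then show ?thesis using nxt_over[OF True] bridge[OF z] by blast
  next
    case False
    have ends: "w \<in> path_ends d W \<longleftrightarrow> w \<in> path_darts d W" if "\<not> crossing_at d w" "W \<in> {A, B, U, V}" for w W
    proof -
      have S: "strand_path d W" using that strands by blast
      have "W ! 0 \<in> path_darts d W" "opp d (W ! (length W - 1)) \<in> path_darts d W"
        using strand_nonempty[OF S] by (auto simp: path_darts_nth)
      then show ?thesis using point_path_cases[OF S _ that(1)] path_ends_eq[OF S] by auto
    qed
    have glue: "nxt d w \<in> PU \<union> PV" if "w \<in> PA \<union> PB" "\<not> crossing_at d w" for w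
    proof -
      have "w \<in> path_ends d A \<union> path_ends d B" using that ends[OF that(2)] by auto
      then have "nxt d w \<in> path_ends d U \<union> path_ends d V" unfolding ends_glued[symmetric] by (rule imageI)
      then show ?thesis using that ends[of "nxt d w"] by auto
    qed
    have "nxt d z \<in> PA \<union> PB" if "z \<in> PU \<union> PV"
    proof -
      have "z \<in> nxt d ` (path_ends d A \<union> path_ends d B)" unfolding ends_glued using that ends[OF False] by auto
      then obtain w where w: "z = nxt d w" "w \<in> path_ends d A \<union> path_ends d B" by blast
      then have nc: "\<not> crossing_at d w" using False by simp
      then have "w \<in> PA \<union> PB" using w(2) ends[OF nc] by auto
      moreover have "nxt d z = w" using nc w by (simp add: nxt2)
      ultimately show ?thesis by simp
    qed
    moreover have "z \<in> PU \<union> PV" if "nxt d z \<in> PA \<union> PB"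
      using glue[OF that] False by (simp add: nxt2)
    ultimately show ?thesis by blast
  qed
qed

lemma nxt_under_iff: "z \<in> darts d \<Longrightarrow> nxt d z \<in> PU \<union> PV \<longleftrightarrow> z \<in> PA \<union> PB"
  using nxt_bridge_iff[of z] darts_paths disjoint_paths nxt_in[of z] by blast

lemma in_paths: "i < length W \<Longrightarrow> W ! i \<in> path_darts d W \<and> opp d (W ! i) \<in> path_darts d W"
  by (auto simp: path_darts_nth)

text \<open>For a dart of an under-strand this says which bridge is met at its vertex, be it above at a crossing or as
  its continuation at a point.\<close>

definition on_A :: "nat \<Rightarrow> bool" where
  "on_A z \<longleftrightarrow> nxt d z \<in> PA"

lemma on_A_through: "crossing_at d z \<Longrightarrow> on_A (through d z) = on_A z"
  unfolding on_A_def nxt_through using path_through_iff[OF strands(1)] by simp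

text \<open>Every edge of the under-strand leads from one bridge to the other.\<close>

definition alternates :: "nat list \<Rightarrow> bool" where
  "alternates W \<longleftrightarrow> (\<forall>i<length W. on_A (opp d (W ! i)) \<noteq> on_A (W ! i))"

lemma alternates_nth:
  assumes W: "strand_path d W" and alt: "alternates W" and i: "i < length W"
  shows "on_A (W ! i) = (on_A (W ! 0) \<noteq> odd i)" and "on_A (opp d (W ! i)) = (on_A (W ! 0) \<noteq> even i)"
proof -
  show *: "on_A (W ! i) = (on_A (W ! 0) \<noteq> odd i)" using i
  proof (induction i)
    case (Suc i)
    have "on_A (W ! Suc i) = on_A (opp d (W ! i))"
      using strand_step[OF W Suc.prems] on_A_through by simp
    then show ?case using Suc alt by (auto simp: alternates_def)
  qed simp
  show "on_A (opp d (W ! i)) = (on_A (W ! 0) \<noteq> even i)" using * alt i by (auto simp: alternates_def)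
qed

text \<open>An under-strand that consists of a single edge has no passes, so that the alternation says nothing about it: it may
  lead back to the bridge that it starts from.\<close>

definition alternating_presentation :: bool where
  "alternating_presentation \<longleftrightarrow> (\<forall>W\<in>{U, V}. 2 \<le> length W \<longrightarrow> alternates W) \<and>
     (\<forall>W\<in>{A, B}. distinct_adj (map (\<lambda>x. nxt d x \<in> path_darts d U) (passes d W)))"

text \<open>The alternation along the strand covers all edges but the last one, which is the first edge of the reverse
  path.\<close>

lemma alternates_if_distinct_adj:
  assumes W: "strand_path d W" and len: "2 \<le> length W"
    and d1: "distinct_adj (map (\<lambda>x. nxt d x \<in> PA) (hd W # passes d W))"
    and d2: "distinct_adj (map (\<lambda>x. nxt d x \<in> PA) (hd (reverse_path d W) # passes d (reverse_path d W)))"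
  shows "alternates W"
proof -
  have step: "on_A (opp d (X ! i)) \<noteq> on_A (X ! i)"
    if X: "strand_path d X" and i: "Suc i < length X"
      and dist: "distinct_adj (map (\<lambda>x. nxt d x \<in> PA) (hd X # passes d X))" for X i
  proof -
    let ?L = "map on_A (hd X # passes d X)"
    have "distinct_adj ?L" using dist by (simp add: on_A_def[abs_def])
    then have L: "?L ! i \<noteq> ?L ! Suc i" using i length_passes[OF X]
      unfolding distinct_adj_def by (auto dest!: successively_nth[of _ _ i] simp del: list.map)
    have "?L ! Suc i = on_A (opp d (X ! i))" using i passes_nth[OF X i] length_passes[OF X] by simp
    moreover have "?L ! i = on_A (X ! i)"
    proof (cases i)
      case 0
      then show ?thesis using strand_nonempty[OF X] by (simp add: hd_conv_nth)
    next
      case (Suc j)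
      then show ?thesis using i passes_nth[OF X, of j] length_passes[OF X] strand_step[OF X, of j]
        by (simp add: on_A_through)
    qed
    ultimately show ?thesis using L by simp
  qed
  show ?thesis unfolding alternates_def
  proof (intro allI impI)
    fix i assume i: "i < length W"
    show "on_A (opp d (W ! i)) \<noteq> on_A (W ! i)"
    proof (cases "Suc i < length W")
      case True
      then show ?thesis using step[OF W _ d1] by blast
    next
      case False
      then have "i = length W - 1" using i by simp
      then show ?thesis using step[OF strand_path_reverse[OF W] _ d2, of 0] reverse_path_nth[of 0 W] len strand_nonempty(1)[OF W] by auto
    qed
  qed
qed

end

lemma schubert_normal_form_obtain:
  assumes "schubert_normal_form d"
  obtains A B U V where "two_bridge_diagram d A B U V" "two_bridge_diagram.alternating_presentation d A B U V"
proof -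
  obtain A B U V where p: "two_bridge_presentation d A B U V"
    and 1: "\<forall>W\<in>{U, reverse_path d U, V, reverse_path d V}.
        distinct_adj (map (\<lambda>x. nxt d x \<in> path_darts d A) (hd W # passes d W))"
    and 2: "\<forall>W\<in>{A, B}. distinct_adj (map (\<lambda>x. nxt d x \<in> path_darts d U) (passes d W))"
    using assms unfolding schubert_normal_form_def by blast
  interpret two_bridge_diagram d A B U V
    using p by unfold_locales (auto simp: two_bridge_presentation_def)
  have alternating_presentation
    unfolding alternating_presentation_def
    using 1 2 alternates_if_distinct_adj[OF strands(3)] alternates_if_distinct_adj[OF strands(4)] by blast
  then show ?thesis using that two_bridge_diagram_axioms by blast
qed


section \<open>Counting the colorings of a Schubert normal form\<close>

locale schubert_diagram = two_bridge_diagram +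
  assumes alternating: alternating_presentation
begin

text \<open>The factor in the closing condition of an under-strand. An edge that leads back to its own bridge imposes no
  condition.\<close>

definition weight :: "nat list \<Rightarrow> nat" where
  "weight W = (if alternates W then length W else 0)"

lemma alternates_long: "W \<in> {U, V} \<Longrightarrow> 2 \<le> length W \<Longrightarrow> alternates W"
  using alternating by (auto simp: alternating_presentation_def)

lemma strand_UV: "W \<in> {U, V} \<Longrightarrow> strand_path d W"
  using strands by blast

lemma not_alternates:
  assumes W: "W \<in> {U, V}" and na: "\<not> alternates W"
  shows "length W = 1" and "on_A (opp d (W ! 0)) = on_A (W ! 0)"
proof -
  show l: "length W = 1"
    using alternates_long[OF W] na strand_nonempty(2)[OF strand_UV[OF W]] by linarith
  then show "on_A (opp d (W ! 0)) = on_A (W ! 0)" using na by (simp add: alternates_def)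
qed

lemma under_darts: "W \<in> {U, V} \<Longrightarrow> i < length W \<Longrightarrow> W ! i \<in> PU \<union> PV \<and> opp d (W ! i) \<in> PU \<union> PV"
  using in_paths[of i W] by blast

lemma bridge_color:
  assumes x: "x \<in> dart_colorings m d" and W: "W \<in> {A, B}" and z: "z \<in> path_darts d W"
  shows "x z = x (W ! 0)"
proof -
  have S: "strand_path d W" using W strands by blast
  have "x (W ! i) = x (W ! 0)" if "i < length W" for i
    using that
  proof (induction i)
    case (Suc i)
    have "opp d (W ! i) \<in> PA \<union> PB" using in_paths[of i W] Suc.prems W by auto
    then have "opp d (W ! i) \<in> over d" using bridge_over strand_step[OF S Suc.prems] by blast
    then have "x (W ! Suc i) = x (opp d (W ! i))"
      using dart_coloringsD(6)[OF x, of "opp d (W ! i)"] strand_step[OF S Suc.prems] strand_in[OF S, of i] Suc.prems by simp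
    also have "\<dots> = x (W ! i)" using dart_coloringsD(4)[OF x strand_in[OF S, of i]] Suc.prems by simp
    finally show ?case using Suc by simp
  qed simp
  then show ?thesis
    using z dart_coloringsD(4)[OF x strand_in[OF S]] by (auto simp: path_darts_nth)
qed

text \<open>The color of the bridge that is met at the vertex of \<open>z\<close>, if \<open>u\<close> and \<open>v\<close> are the colors of the bridges \<open>A\<close> and \<open>B\<close>.\<close>

definition bridge_val :: "int \<Rightarrow> int \<Rightarrow> nat \<Rightarrow> int" where
  "bridge_val u v z = (if on_A z then u else v)"

lemma bridge_val_nxt:
  assumes x: "x \<in> dart_colorings m d" and z: "z \<in> PU \<union> PV"
  shows "x (nxt d z) = bridge_val (x (A ! 0)) (x (B ! 0)) z"
proof -
  have "z \<in> darts d" using z darts_paths by blast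
  then have "nxt d z \<in> PA \<union> PB" using nxt_bridge_iff z by blast
  then show ?thesis
    using bridge_color[OF x, of A "nxt d z"] bridge_color[OF x, of B "nxt d z"]
    by (auto simp: bridge_val_def on_A_def)
qed

lemma bridge_val_alternates:
  assumes W: "W \<in> {U, V}" and alt: "alternates W" and i: "i < length W"
  shows "bridge_val u v (opp d (W ! i)) = (if even i then bridge_val v u (W ! 0) else bridge_val u v (W ! 0))"
  using alternates_nth(2)[OF strand_UV[OF W] alt i] by (auto simp: bridge_val_def)

text \<open>Exchanging \<open>u\<close> and \<open>v\<close> gives the color of the bridge from which the under-strand does not start.\<close>

definition strand_color :: "int \<Rightarrow> int \<Rightarrow> nat list \<Rightarrow> nat \<Rightarrow> int" where
  "strand_color u v W i =
     bridge_val u v (W ! 0) + strand_coeff i * (bridge_val v u (W ! 0) - bridge_val u v (W ! 0))"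

lemma strand_color_Suc:
  assumes W: "W \<in> {U, V}" and i: "Suc i < length W"
  shows "strand_color u v W (Suc i) = 2 * bridge_val u v (opp d (W ! i)) - strand_color u v W i"
proof -
  have "alternates W" using alternates_long[OF W] i by simp
  then show ?thesis
    using bridge_val_alternates[OF W _ , of i u v] i
    by (auto simp: strand_color_def strand_coeff_Suc algebra_simps)
qed

text \<open>The closing condition: the color with which an under-strand arrives is the color of its last bridge.\<close>

lemma strand_color_last:
  assumes W: "W \<in> {U, V}"
  shows "[strand_color u v W (length W - 1) = bridge_val u v (opp d (W ! (length W - 1)))] (mod m) \<longleftrightarrow>
    m dvd int (weight W) * (v - u)"
proof (cases "alternates W")
  case True
  define l where "l = length W - 1"
  have l: "l < length W" "length W = Suc l" using strand_nonempty(2)[OF strand_UV[OF W]] by (auto simp: l_def)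
  define k where "k = bridge_val v u (W ! 0) - bridge_val u v (W ! 0)"
  have "k = v - u \<or> k = - (v - u)" by (auto simp: k_def bridge_val_def)
  then have k: "m dvd int (weight W) * (v - u) \<longleftrightarrow> m dvd int (Suc l) * k"
    using True l(2) by (auto simp: weight_def) (metis dvd_minus_iff minus_mult_right minus_diff_eq)+
  show ?thesis
  proof (cases "even l")
    case True
    then have "strand_color u v W l - bridge_val u v (opp d (W ! l)) = - (int (Suc l) * k)"
      using bridge_val_alternates[OF W \<open>alternates W\<close> l(1), of u v]
      by (simp add: strand_color_def strand_coeff_def k_def algebra_simps)
    then show ?thesis unfolding l_def[symmetric] cong_iff_dvd_diff k by (metis dvd_minus_iff)
  next
    case False
    then have "strand_color u v W l - bridge_val u v (opp d (W ! l)) = int (Suc l) * k"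
      using bridge_val_alternates[OF W \<open>alternates W\<close> l(1), of u v]
      by (simp add: strand_color_def strand_coeff_def k_def algebra_simps)
    then show ?thesis unfolding l_def[symmetric] cong_iff_dvd_diff k by metis
  qed
next
  case False
  then show ?thesis using not_alternates[OF W False]
    by (simp add: weight_def strand_color_def bridge_val_def)
qed

lemma strand_color_coloring:
  assumes x: "x \<in> dart_colorings m d" and W: "W \<in> {U, V}" and i: "i < length W"
  shows "[x (W ! i) = strand_color (x (A ! 0)) (x (B ! 0)) W i] (mod m)"
  using i
proof (induction i)
  case 0
  then have z: "W ! 0 \<in> PU \<union> PV" "W ! 0 \<in> darts d" using under_darts[OF W] strand_in[OF strand_UV[OF W]] by auto
  have "x (W ! 0) = x (nxt d (W ! 0))"
    using dart_coloringsD(5)[OF x z(2)] strand_hd[OF strand_UV[OF W]] by (simp add: through_point)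
  then show ?case using bridge_val_nxt[OF x z(1)] by (simp add: strand_color_def)
next
  case (Suc i)
  let ?z = "opp d (W ! i)"
  have z: "?z \<in> PU \<union> PV" "crossing_at d ?z" "W ! Suc i = through d ?z" "W ! i \<in> darts d"
    using under_darts[OF W] strand_step[OF strand_UV[OF W] Suc.prems] strand_in[OF strand_UV[OF W]] Suc.prems by auto
  have "[2 * x (nxt d ?z) = x ?z + x (W ! Suc i)] (mod m)"
    using dart_coloringsD(7)[OF x z(2)] strand_under[OF z(1)] z(3) by simp
  then have "[2 * x (nxt d ?z) - x ?z = x (W ! Suc i)] (mod m)"
    by (simp add: cong_iff_dvd_diff algebra_simps)
  then have 1: "[x (W ! Suc i) = 2 * bridge_val (x (A ! 0)) (x (B ! 0)) ?z - x (W ! i)] (mod m)"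
    using bridge_val_nxt[OF x z(1)] dart_coloringsD(4)[OF x z(4)] by (simp add: cong_sym)
  also have "[2 * bridge_val (x (A ! 0)) (x (B ! 0)) ?z - x (W ! i) =
      2 * bridge_val (x (A ! 0)) (x (B ! 0)) ?z - strand_color (x (A ! 0)) (x (B ! 0)) W i] (mod m)"
    using Suc by (intro cong_diff cong_refl) auto
  finally show ?case using strand_color_Suc[OF W Suc.prems] by simp
qed

lemma weight_annihilates:
  assumes x: "x \<in> dart_colorings m d" and W: "W \<in> {U, V}"
  shows "m dvd int (weight W) * (x (B ! 0) - x (A ! 0))"
proof -
  define l where "l = length W - 1"
  have l: "l < length W" using strand_nonempty(2)[OF strand_UV[OF W]] by (auto simp: l_def)
  let ?z = "opp d (W ! l)"
  have z: "?z \<in> PU \<union> PV" "W ! l \<in> darts d" "\<not> crossing_at d ?z"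
    using under_darts[OF W l] strand_in[OF strand_UV[OF W] l] strand_last[OF strand_UV[OF W]] by (auto simp: l_def)
  have "x (W ! l) = x ?z" using dart_coloringsD(4)[OF x z(2)] by simp
  also have "\<dots> = x (nxt d ?z)" using dart_coloringsD(5)[OF x, of ?z] z by (simp add: through_point)
  also have "\<dots> = bridge_val (x (A ! 0)) (x (B ! 0)) ?z" by (rule bridge_val_nxt[OF x z(1)])
  finally show ?thesis
    using strand_color_coloring[OF x W l] strand_color_last[OF W] unfolding l_def by (metis cong_sym)
qed

text \<open>The closing conditions are the only obstruction to prescribing the colors of the bridges.\<close>

lemma obtain_coloring:
  assumes u: "0 \<le> u" "u < m" and v: "0 \<le> v" "v < m"
    and wt: "\<And>W. W \<in> {U, V} \<Longrightarrow> m dvd int (weight W) * (v - u)"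
  obtains x where "x \<in> dart_colorings m d" "\<And>z. z \<in> PA \<Longrightarrow> x z = u" "\<And>z. z \<in> PB \<Longrightarrow> x z = v"
    "\<And>W i. W \<in> {U, V} \<Longrightarrow> i < length W \<Longrightarrow> x (W ! i) = strand_color u v W i mod m"
proof -
  obtain fU where fU: "\<And>i. i < length U \<Longrightarrow> fU (U ! i) = i" "\<And>i. i < length U \<Longrightarrow> fU (opp d (U ! i)) = i"
    using strand_index[OF strands(3) distinct_path] by blast
  obtain fV where fV: "\<And>i. i < length V \<Longrightarrow> fV (V ! i) = i" "\<And>i. i < length V \<Longrightarrow> fV (opp d (V ! i)) = i"
    using strand_index[OF strands(4) distinct_path] by blast
  define x where "x z = (if z \<in> PA then u else if z \<in> PB then v else if z \<in> PU then strand_color u v U (fU z) mod m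
    else if z \<in> PV then strand_color u v V (fV z) mod m else 0)" for z
  have m: "m > 0" using u by simp
  have xA: "x z = u" if "z \<in> PA" for z using that by (simp add: x_def)
  have xB: "x z = v" if "z \<in> PB" for z using that disjoint_paths by (auto simp: x_def)
  have xW: "x (W ! i) = strand_color u v W i mod m" "x (opp d (W ! i)) = strand_color u v W i mod m"
    if "W \<in> {U, V}" "i < length W" for W i
  proof -
    have "W ! i \<notin> PA \<union> PB" "opp d (W ! i) \<notin> PA \<union> PB" "W ! i \<in> path_darts d W" "opp d (W ! i) \<in> path_darts d W"
      using in_paths[OF that(2)] that(1) disjoint_paths by blast+
    moreover have "z \<notin> PU" if "z \<in> PV" for z using that disjoint_paths by blast
    ultimately show "x (W ! i) = strand_color u v W i mod m" "x (opp d (W ! i)) = strand_color u v W i mod m"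
      using that fU fV by (auto simp: x_def)
  qed
  have xnxt: "x (nxt d z) = bridge_val u v z" if z: "z \<in> PU \<union> PV" for z
  proof -
    have "nxt d z \<in> PA \<union> PB" using z nxt_bridge_iff darts_paths by blast
    then show ?thesis using xA xB by (auto simp: bridge_val_def on_A_def)
  qed
  have xpoint: "x z = bridge_val u v z" if W: "W \<in> {U, V}" "z \<in> path_darts d W" and nc: "\<not> crossing_at d z" for W z
  proof -
    have S: "strand_path d W" by (rule strand_UV[OF W(1)])
    have l: "0 < length W" "length W - 1 < length W" using strand_nonempty(2)[OF S] by auto
    have b: "bridge_val u v y mod m = bridge_val u v y" for y using u v by (simp add: bridge_val_def)
    consider "z = W ! 0" | "z = opp d (W ! (length W - 1))" using point_path_cases[OF S W(2) nc] by blast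
    then show ?thesis
    proof cases
      case 1
      then show ?thesis using xW(1)[OF W(1) l(1)] b by (simp add: strand_color_def)
    next
      case 2
      have "x z = strand_color u v W (length W - 1) mod m" using xW(2)[OF W(1) l(2)] 2 by simp
      also have "\<dots> = bridge_val u v z mod m"
        using strand_color_last[OF W(1), of u v m] wt[OF W(1)] 2 by (simp add: cong_def)
      finally show ?thesis by (simp add: b)
    qed
  qed
  have paths: "\<exists>W\<in>{U, V}. z \<in> path_darts d W" if "z \<in> PU \<union> PV" for z using that by blast
  have "x \<in> dart_colorings m d"
  proof (rule dart_coloringsI)
    fix z assume "z \<notin> darts d"
    then show "x z = 0" using darts_paths by (auto simp: x_def)
  next
    fix z assume z: "z \<in> darts d"
    show "0 \<le> x z" "x z < m" using u v m by (auto simp: x_def)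
    show "x (opp d z) = x z"
    proof (cases "z \<in> PA \<union> PB")
      case True
      then show ?thesis using xA xB path_darts_opp by auto
    next
      case False
      then obtain W where W: "W \<in> {U, V}" "z \<in> path_darts d W" using paths z darts_paths by blast
      then obtain i where "i < length W" "z = W ! i \<or> z = opp d (W ! i)" by (auto simp: path_darts_nth)
      then show ?thesis using xW[OF W(1)] by auto
    qed
    show "x (through d z) = x z" if nc: "\<not> crossing_at d z"
    proof (cases "z \<in> PA \<union> PB")
      case True
      then have w: "nxt d z \<in> PU \<union> PV" "nxt d (nxt d z) = z" using nxt_under_iff[OF z] nc nxt2 by auto
      then obtain W where W: "W \<in> {U, V}" "nxt d z \<in> path_darts d W" using paths by blast
      then have "x (nxt d z) = x z" using xpoint[OF W] xnxt[OF w(1)] w(2) nc by simp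
      then show ?thesis using nc by (simp add: through_point)
    next
      case False
      then have w: "z \<in> PU \<union> PV" using z darts_paths by blast
      then obtain W where W: "W \<in> {U, V}" "z \<in> path_darts d W" using paths by blast
      then show ?thesis using xpoint[OF W nc] xnxt[OF w] nc by (simp add: through_point)
    qed
    show "x (through d z) = x z" if o: "z \<in> over d"
    proof -
      have "z \<in> PA \<union> PB" using o strand_under z darts_paths by blast
      then show ?thesis using xA xB path_through[OF strands(1) _ over_crossing[OF o]] path_through[OF strands(2) _ over_crossing[OF o]] by auto
    qed
  next
    fix z assume z: "crossing_at d z" "z \<notin> over d"
    then have w: "z \<in> PU \<union> PV" using bridge_over crossing_in darts_paths by blast
    then obtain W where W: "W \<in> {U, V}" "z \<in> path_darts d W" using paths by blast
    have S: "strand_path d W" by (rule strand_UV[OF W(1)])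
    obtain i where i: "Suc i < length W" "z = opp d (W ! i) \<or> z = through d (opp d (W ! i))"
      using crossing_path_cases[OF S W(2) z(1)] .
    let ?y = "opp d (W ! i)"
    have y: "crossing_at d ?y" "W ! Suc i = through d ?y" using strand_step[OF S i(1)] by auto
    have "x (nxt d z) = bridge_val u v ?y"
      using xnxt[OF w] i(2) on_A_through[OF y(1)] by (auto simp: bridge_val_def)
    moreover have "x z + x (through d z) = strand_color u v W i mod m + strand_color u v W (Suc i) mod m"
      using i xW(2)[OF W(1), of i] xW(1)[OF W(1), of "Suc i"] y(2) by auto
    moreover have "[2 * bridge_val u v ?y = strand_color u v W i mod m + strand_color u v W (Suc i) mod m] (mod m)"
      unfolding strand_color_Suc[OF W(1) i(1)] by (simp add: cong_def mod_add_eq)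
    ultimately show "[2 * x (nxt d z) = x z + x (through d z)] (mod m)" by simp
  qed
  then show ?thesis using that xA xB xW(1) by blast
qed

lemma card_dart_colorings_schubert:
  assumes m: "m > 0"
  shows "card (dart_colorings (int m) d) = m * gcd m (gcd (weight U) (weight V))"
proof -
  let ?P = "{(u, v). u \<in> {0..<int m} \<and> v \<in> {0..<int m} \<and> int m dvd int (weight U) * (v - u) \<and> int m dvd int (weight V) * (v - u)}"
  have ab: "A ! 0 \<in> darts d" "B ! 0 \<in> darts d" "A ! 0 \<in> PA" "B ! 0 \<in> PB"
    using strand_in[OF strands(1)] strand_in[OF strands(2)] strand_nonempty(2)[OF strands(1)] strand_nonempty(2)[OF strands(2)] in_paths
    by auto
  have "bij_betw (\<lambda>x. (x (A ! 0), x (B ! 0))) (dart_colorings (int m) d) ?P"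
  proof (rule bij_betw_imageI)
    show "inj_on (\<lambda>x. (x (A ! 0), x (B ! 0))) (dart_colorings (int m) d)"
    proof (rule inj_onI, rule ext)
      fix x y z assume x: "x \<in> dart_colorings (int m) d" and y: "y \<in> dart_colorings (int m) d"
        and "(x (A ! 0), x (B ! 0)) = (y (A ! 0), y (B ! 0))"
      then have eq: "x (A ! 0) = y (A ! 0)" "x (B ! 0) = y (B ! 0)" by auto
      have eqW: "x (W ! i) = y (W ! i)" if "W \<in> {U, V}" "i < length W" for W i
      proof -
        have "[x (W ! i) = y (W ! i)] (mod int m)"
          using strand_color_coloring[OF x that] strand_color_coloring[OF y that] eq cong_sym cong_trans by metis
        moreover have "W ! i \<in> darts d" using strand_in[OF strand_UV] that by blast
        ultimately show ?thesis using dart_coloringsD(2,3)[OF x] dart_coloringsD(2,3)[OF y] by (intro residues_eqI) auto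
      qed
      consider "z \<in> PA" | "z \<in> PB" | W where "W \<in> {U, V}" "z \<in> path_darts d W" | "z \<notin> darts d"
        using darts_paths by blast
      then show "x z = y z"
      proof cases
        case 1
        then show ?thesis using bridge_color[OF x, of A] bridge_color[OF y, of A] eq by simp
      next
        case 2
        then show ?thesis using bridge_color[OF x, of B] bridge_color[OF y, of B] eq by simp
      next
        case (3 W)
        then obtain i where i: "i < length W" "z = W ! i \<or> z = opp d (W ! i)" by (auto simp: path_darts_nth)
        have "W ! i \<in> darts d" using strand_in[OF strand_UV] 3 i by blast
        then show ?thesis using eqW[OF 3(1) i(1)] i(2) dart_coloringsD(4)[OF x] dart_coloringsD(4)[OF y] by auto
      next
        case 4
        then show ?thesis using dart_coloringsD(1)[OF x] dart_coloringsD(1)[OF y] by simp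
      qed
    qed
    show "(\<lambda>x. (x (A ! 0), x (B ! 0))) ` dart_colorings (int m) d = ?P"
    proof
      show "(\<lambda>x. (x (A ! 0), x (B ! 0))) ` dart_colorings (int m) d \<subseteq> ?P"
        using dart_coloringsD(2,3) ab weight_annihilates by auto
      show "?P \<subseteq> (\<lambda>x. (x (A ! 0), x (B ! 0))) ` dart_colorings (int m) d"
      proof
        fix p assume p: "p \<in> ?P"
        obtain u v where uv: "p = (u, v)" by force
        with p have r: "0 \<le> u" "u < int m" "0 \<le> v" "v < int m"
          and w: "\<And>W. W \<in> {U, V} \<Longrightarrow> int m dvd int (weight W) * (v - u)" by auto
        obtain x where "x \<in> dart_colorings (int m) d" "x (A ! 0) = u" "x (B ! 0) = v"
          using obtain_coloring[OF r w] ab by metis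
        then show "p \<in> (\<lambda>x. (x (A ! 0), x (B ! 0))) ` dart_colorings (int m) d" unfolding uv by force
      qed
    qed
  qed
  then have "card (dart_colorings (int m) d) = card ?P" by (rule bij_betw_same_card)
  then show ?thesis using card_color_pairs[OF m] by simp
qed

end


section \<open>A coloring with all colors\<close>

context two_bridge_diagram
begin

abbreviation "first W \<equiv> W ! 0"
abbreviation "final W \<equiv> opp d (W ! (length W - 1))"

lemma ends_in: "W \<in> {A, B, U, V} \<Longrightarrow> first W \<in> path_darts d W \<and> final W \<in> path_darts d W"
  using strand_nonempty(2)[of W] strands by (auto simp: path_darts_nth)

lemma first_neq_final: assumes W: "W \<in> {A, B, U, V}" shows "first W \<noteq> final W"
proof -
  have S: "strand_path d W" using W strands by blast
  obtain l where l: "length W = Suc l" using strand_nonempty(2)[OF S] by (cases "length W") auto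
  have "W ! 0 \<in> set W" "opp d (W ! l) \<in> set (reverse_path d W)" using l by (auto simp: reverse_path_def)
  moreover have "set W \<inter> set (reverse_path d W) = {}" using distinct_path[OF W] by simp
  ultimately have "W ! 0 \<noteq> opp d (W ! l)" by (metis disjoint_iff)
  then show ?thesis using l by simp
qed

text \<open>Two of the four ends of under-strands are attached to the two ends of the bridge \<open>A\<close>.\<close>

lemma on_A_ends: "card {z \<in> {first U, final U, first V, final V}. on_A z} = 2"
proof -
  have eq: "{z \<in> {first U, final U, first V, final V}. on_A z} = nxt d ` path_ends d A"
  proof (intro subset_antisym subsetI)
    fix z assume z: "z \<in> {z \<in> {first U, final U, first V, final V}. on_A z}"
    then have nc: "\<not> crossing_at d z" using strand_hd strand_last strands by auto
    have "nxt d z \<in> PA" using z by (simp add: on_A_def)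
    then have "nxt d z \<in> path_ends d A"
      using point_path_cases[OF strands(1), of "nxt d z"] nc path_ends_eq[OF strands(1)] by simp
    moreover have "nxt d (nxt d z) = z" using nc by (rule nxt2)
    ultimately show "z \<in> nxt d ` path_ends d A" by (metis imageI)
  next
    fix z assume "z \<in> nxt d ` path_ends d A"
    then obtain w where w: "w \<in> path_ends d A" "z = nxt d w" by blast
    have nc: "\<not> crossing_at d w" using w strand_hd strand_last strands path_ends_eq[OF strands(1)] by auto
    have "z \<in> path_ends d U \<union> path_ends d V" using w ends_glued by blast
    then have "z \<in> {first U, final U, first V, final V}"
      using path_ends_eq[OF strands(3)] path_ends_eq[OF strands(4)] by auto
    moreover have "nxt d z \<in> PA" using nc w ends_in[of A] path_ends_eq[OF strands(1)] by (auto simp: nxt2)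
    ultimately show "z \<in> {z \<in> {first U, final U, first V, final V}. on_A z}" by (simp add: on_A_def)
  qed
  have "card (path_ends d A) = 2" using first_neq_final[of A] path_ends_eq[OF strands(1)] by simp
  moreover have "inj_on (nxt d) (path_ends d A)" by (auto intro: inj_onI)
  ultimately show ?thesis unfolding eq by (simp add: card_image)
qed

text \<open>Either both under-strands join different bridges, or each of them returns to its own bridge.\<close>

lemma on_A_ends_cases:
  "(on_A (first U) \<noteq> on_A (final U) \<and> on_A (first V) \<noteq> on_A (final V)) \<or>
   (on_A (first U) = on_A (final U) \<and> on_A (first V) = on_A (final V) \<and> on_A (first U) \<noteq> on_A (first V))"
proof -
  have count: "(p \<noteq> q \<and> r \<noteq> s) \<or> (p = q \<and> r = s \<and> p \<noteq> r)"
    if "card {z \<in> {a, b, c, e}. P z} = 2" "a \<noteq> b" "c \<noteq> e" "a \<noteq> c" "a \<noteq> e" "b \<noteq> c" "b \<noteq> e"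
      "p = P a" "q = P b" "r = P c" "s = P e" for P :: "nat \<Rightarrow> bool" and a b c e p q r s
  proof -
    have ins: "{z \<in> insert y X. P z} = (if P y then insert y {z \<in> X. P z} else {z \<in> X. P z})" for y X by auto
    have none: "{z \<in> {}. P z} = {}" by simp
    show ?thesis using that(1-7) unfolding ins none that(8-11)
      by (cases "P a"; cases "P b"; cases "P c"; cases "P e") simp_all
  qed
  have "first U \<noteq> final U" "first V \<noteq> final V" "first U \<noteq> first V" "first U \<noteq> final V" "final U \<noteq> first V" "final U \<noteq> final V"
    using first_neq_final[of U] first_neq_final[of V] ends_in[of U] ends_in[of V] disjoint_paths by auto
  then show ?thesis by (intro count[OF on_A_ends]) auto
qed

lemma alternates_parity:
  assumes W: "W \<in> {U, V}" and alt: "alternates W"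
  shows "odd (length W) \<longleftrightarrow> on_A (first W) \<noteq> on_A (final W)"
proof -
  have S: "strand_path d W" using W strands by blast
  obtain l where l: "length W = Suc l" using strand_nonempty(2)[OF S] by (cases "length W") auto
  show ?thesis using alternates_nth(2)[OF S alt, of l] l by auto
qed

end

context schubert_diagram
begin

definition modulus :: nat where "modulus = gcd (weight U) (weight V)"

lemma joining_alternates:
  assumes W: "W \<in> {U, V}" and "on_A (first W) \<noteq> on_A (final W)"
  shows "alternates W"
  using assms not_alternates[OF W] by (metis diff_self_eq_0)

text \<open>If \<open>W\<close> has no passes, then both bridges are crossed by \<open>W'\<close> only. As the bridges meet the two under-strands
  alternately, each bridge has at most one crossing. A longer \<open>W'\<close> would pass below one bridge twice, with one pass
  below the other bridge in between.\<close>

lemma weight_0_imp_short: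
  assumes W: "W \<in> {U, V}" "W' \<in> {U, V}" "W \<noteq> W'" and w: "weight W = 0" "weight W' = length W'"
  shows "length W' \<le> 2"
proof (rule ccontr)
  assume long: "\<not> length W' \<le> 2"
  have S: "strand_path d W" "strand_path d W'" using W strands by auto
  have na: "\<not> alternates W" using w(1) strand_nonempty(2)[OF S(1)] by (auto simp: weight_def)
  have l1: "length W = 1" by (rule not_alternates(1)[OF W(1) na])
  have even: "even (length W')"
  proof -
    have "on_A (first W) = on_A (final W)" using not_alternates[OF W(1) na] by simp
    then have "on_A (first W') = on_A (final W')" using on_A_ends_cases W by auto
    then show ?thesis using alternates_parity[OF W(2)] alternates_long[OF W(2)] long by auto
  qed
  then have len: "3 < length W'" using long by (cases "length W' = 3") auto
  have alt: "alternates W'" using alternates_long[OF W(2)] long by simp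
  let ?y = "opp d (W' ! 0)" and ?z = "opp d (W' ! 2)"
  have yz: "crossing_at d ?y" "crossing_at d ?z" "W' ! 1 = through d ?y"
    using strand_step[OF S(2), of 0] strand_step[OF S(2), of 2] len by (auto simp: numeral_eq_Suc)
  have same: "on_A ?y = on_A ?z"
    using alternates_nth(2)[OF S(2) alt, of 0] alternates_nth(2)[OF S(2) alt, of 2] len by (cases W') auto
  have dist: "?z \<noteq> ?y" "?z \<noteq> through d ?y"
  proof -
    obtain f where f0: "\<And>i. i < length W' \<Longrightarrow> f (W' ! i) = i" "\<And>i. i < length W' \<Longrightarrow> f (opp d (W' ! i)) = (i::nat)"
      using strand_index[OF S(2) distinct_path] W by blast
    have f: "f ?z = 2" "f ?y = 0" "f (W' ! 1) = 1" using f0(2)[of 2] f0(2)[of 0] f0(1)[of 1] len by linarith+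
    show "?z \<noteq> ?y" using f by (metis zero_neq_numeral)
    show "?z \<noteq> through d ?y" using f yz(3) by (metis one_eq_numeral_iff semiring_norm(85))
  qed
  have under: "?y \<in> PU \<union> PV" "?z \<in> PU \<union> PV" by (rule conjunct2[OF under_darts[OF W(2)]], use len in linarith)+
  obtain Y where Y: "Y \<in> {A, B}" "nxt d ?y \<in> path_darts d Y" "nxt d ?z \<in> path_darts d Y"
  proof -
    have "nxt d ?y \<in> PA \<union> PB" "nxt d ?z \<in> PA \<union> PB"
      using under nxt_bridge_iff darts_paths by blast+
    then show ?thesis using that same unfolding on_A_def by blast
  qed
  have SY: "strand_path d Y" using Y strands by blast
  have "2 < length Y"
  proof (rule ccontr)
    assume short: "\<not> 2 < length Y"
    have "w \<in> {opp d (Y ! 0), through d (opp d (Y ! 0))}" if w: "w \<in> path_darts d Y" "crossing_at d w" for w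
    proof -
      obtain i where i: "Suc i < length Y" "w = opp d (Y ! i) \<or> w = through d (opp d (Y ! i))"
        using crossing_path_cases[OF SY w] .
      then have "i = 0" using short by simp
      then show ?thesis using i(2) by simp
    qed
    from this[OF Y(2)] this[OF Y(3)] yz(1,2)
    have "nxt d ?y \<in> {opp d (Y ! 0), through d (opp d (Y ! 0))}" "nxt d ?z \<in> {opp d (Y ! 0), through d (opp d (Y ! 0))}"
      by simp_all
    then have "nxt d ?z = nxt d ?y \<or> nxt d ?z = through d (nxt d ?y)" by (metis insertE singletonD through_through)
    then have "?z = ?y \<or> ?z = through d ?y" unfolding nxt_through[symmetric] nxt_eq_iff .
    then show False using dist by blast
  qed
  moreover have "distinct_adj (map (\<lambda>x. nxt d x \<in> PU) (passes d Y))"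
    using alternating Y(1) by (auto simp: alternating_presentation_def)
  ultimately have "(nxt d (passes d Y ! 0) \<in> PU) \<noteq> (nxt d (passes d Y ! 1) \<in> PU)"
    using length_passes[OF SY] unfolding distinct_adj_def by (auto dest!: successively_nth[of _ _ 0])
  moreover have "nxt d (passes d Y ! i) \<in> path_darts d W'" if i: "Suc i < length Y" for i
  proof -
    let ?x = "opp d (Y ! i)"
    have x: "crossing_at d ?x" "?x \<in> PA \<union> PB" using strand_step[OF SY i] in_paths[of i Y] i Y(1) by auto
    then have "nxt d ?x \<in> PU \<union> PV" using nxt_under_iff crossing_in by blast
    moreover have "nxt d ?x \<notin> path_darts d W"
    proof
      assume "nxt d ?x \<in> path_darts d W"
      then obtain j where "Suc j < length W" using crossing_path_cases[OF S(1), of "nxt d ?x"] x(1) by (metis crossing_nxt)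
      then show False using l1 by simp
    qed
    ultimately show ?thesis unfolding passes_nth[OF SY i] using W by auto
  qed
  then have "nxt d (passes d Y ! 0) \<in> path_darts d W'" "nxt d (passes d Y ! 1) \<in> path_darts d W'"
    using \<open>2 < length Y\<close> by auto
  ultimately show False using W disjoint_paths by blast
qed

text \<open>Starting from the bridge of color 1, the colors are \<open>1 - strand_coeff i\<close>.\<close>

lemma strand_residue:
  assumes W: "W \<in> {U, V}" and i: "i < length W" and x: "x (W ! i) = strand_color 0 1 W i mod int D"
    and r: "0 \<le> r" "r < int D" and c: "[strand_coeff i = (if on_A (first W) then r else 1 - r)] (mod int D)"
  shows "x (W ! i) = r"
proof -
  have "[strand_color 0 1 W i = r] (mod int D)"
  proof (cases "on_A (first W)")
    case True
    then show ?thesis using c by (simp add: strand_color_def bridge_val_def)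
  next
    case False
    then have "[1 - strand_coeff i = 1 - (1 - r)] (mod int D)" using c by (intro cong_diff cong_refl) auto
    then show ?thesis using False by (simp add: strand_color_def bridge_val_def)
  qed
  then show ?thesis using x r by (simp add: cong_def)
qed

text \<open>The bridges get the colors 0 and 1. If the modulus is 2, these are all colors already; this settles the case of an
  under-strand without passes. Otherwise both under-strands are at least as long as the modulus.\<close>

lemma surjective_coloring:
  assumes D: "2 \<le> modulus"
  obtains x where "x \<in> dart_colorings (int modulus) d" "\<And>r. 0 \<le> r \<Longrightarrow> r < int modulus \<Longrightarrow> \<exists>z\<in>darts d. x z = r"
proof -
  obtain x where x: "x \<in> dart_colorings (int modulus) d" "\<And>z. z \<in> PA \<Longrightarrow> x z = 0" "\<And>z. z \<in> PB \<Longrightarrow> x z = 1"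
    and xW: "\<And>W i. W \<in> {U, V} \<Longrightarrow> i < length W \<Longrightarrow> x (W ! i) = strand_color 0 1 W i mod int modulus"
    by (rule obtain_coloring[of 0 "int modulus" 1]) (use D in \<open>auto simp: modulus_def\<close>)
  have AB: "first A \<in> PA" "first B \<in> PB" "first A \<in> darts d" "first B \<in> darts d"
    using ends_in[of A] ends_in[of B] darts_paths by auto
  have long: "modulus \<le> length W" if "W \<in> {U, V}" "weight W \<noteq> 0" for W
    using that dvd_imp_le[of modulus "weight W"] by (auto simp: modulus_def weight_def split: if_splits)
  have "\<exists>z\<in>darts d. x z = r" if r: "0 \<le> r" "r < int modulus" for r
  proof (cases "on_A (first U) \<noteq> on_A (final U)")
    case True
    have alt: "alternates U" by (rule joining_alternates[OF _ True]) simp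
    have wU: "weight U = length U" "weight U \<noteq> 0" using alt strand_nonempty(2)[OF strands(3)] by (auto simp: weight_def)
    have "odd (length U)" using alternates_parity[OF _ alt] True by simp
    then have odd: "odd modulus" using wU by (metis modulus_def gcd_dvd1 dvd_trans)
    define r' where "r' = (if on_A (first U) then r else 1 - r) mod int modulus"
    have "0 \<le> r'" "r' < int modulus" using D by (auto simp: r'_def)
    then obtain i where i: "i < length U" "[strand_coeff i = r'] (mod int modulus)"
      using all_residues_covered[OF odd long[OF _ wU(2)]] by auto
    have "x (U ! i) = r"
      by (rule strand_residue[where x = x and D = modulus, OF _ i(1) xW[OF _ i(1)] r]) (use i in \<open>auto simp: r'_def cong_def\<close>)
    then show ?thesis using strand_in[OF strands(3) i(1)] by blast
  next
    case False
    then have same: "on_A (first U) = on_A (final U)" "on_A (first V) = on_A (final V)" "on_A (first U) \<noteq> on_A (first V)"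
      using on_A_ends_cases by auto
    have evenW: "even (weight W)" if "W \<in> {U, V}" for W
      using alternates_parity[OF that] same that by (auto simp: weight_def)
    then have even: "even modulus" by (auto simp: modulus_def)
    show ?thesis
    proof (cases "modulus = 2")
      case True
      then have "r = 0 \<or> r = 1" using r by auto
      then show ?thesis using x AB by blast
    next
      case False
      have pos: "weight W \<noteq> 0" if W: "W \<in> {U, V}" for W
      proof
        assume 0: "weight W = 0"
        obtain W' where W': "W' \<in> {U, V}" "W \<noteq> W'" "modulus = weight W'"
          using W 0 disjoint_paths ends_in[of U] unfolding modulus_def by (metis disjoint_iff gcd_0_nat gcd_0_left_nat insertCI insertE singletonD)
        then have "weight W' = length W'" using D by (auto simp: weight_def split: if_splits)
        then show False using weight_0_imp_short[OF W W'(1,2) 0] W' D False by simp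
      qed
      define W where "W = (if even r \<longleftrightarrow> on_A (first U) then U else V)"
      have W: "W \<in> {U, V}" "even (if on_A (first W) then r else 1 - r)"
        using same(3) by (auto simp: W_def)
      define r' where "r' = (if on_A (first W) then r else 1 - r) mod int modulus"
      have "even r'" unfolding r'_def using W(2) even by (meson dvd_mod even_of_nat)
      moreover have "0 \<le> r'" "r' < int modulus" using D by (auto simp: r'_def)
      moreover have "0 < modulus" using D by simp
      ultimately obtain i where i: "i < length W" "strand_coeff i = r'"
        using even_residues_covered[OF _ long[OF W(1) pos[OF W(1)]]] by blast
      have "x (W ! i) = r"
        by (rule strand_residue[where x = x and D = modulus, OF W(1) i(1) xW[OF W(1) i(1)] r]) (use i in \<open>auto simp: r'_def cong_def\<close>)
      then show ?thesis using strand_in[OF strand_UV[OF W(1)] i(1)] by blast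
    qed
  qed
  with x(1) that show ?thesis by blast
qed

end


section \<open>Faces and the half-turn symmetry\<close>

lemma sum_card_orbits:
  assumes "f permutes X" "finite X"
  shows "(\<Sum>S\<in>orbit f ` X. card S) = card X"
proof -
  have perm: "permutation f" using assms by (auto simp: permutation_permutes)
  have sub: "orbit f x \<subseteq> X" if "x \<in> X" for x by (rule permutes_orbit_subset[OF assms(1) that])
  have self: "x \<in> orbit f x" for x by (rule permutation_self_in_orbit[OF perm])
  have eq: "orbit f y = orbit f x" if "y \<in> orbit f x" for x y
    using that by (rule orbit_cyclic_eq3[OF cyclic_on_orbit'[OF perm]])
  have "card (\<Union> (orbit f ` X)) = sum card (orbit f ` X)"
  proof (rule card_Union_disjoint)
    show "pairwise disjnt (orbit f ` X)"
    proof (rule pairwiseI, clarify)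
      fix x y assume "orbit f x \<noteq> orbit f y"
      then show "disjnt (orbit f x) (orbit f y)" using eq unfolding disjnt_def by blast
    qed
  qed (use sub assms(2) finite_subset in blast)
  moreover have "\<Union> (orbit f ` X) = X" using sub self by blast
  ultimately show ?thesis by simp
qed

text \<open>The sizes of the orbits add up to the number of elements; if this is at most \<open>k\<close> times the number of orbits, none
  can be larger than \<open>k\<close>.\<close>

lemma orbits_of_minimal_size:
  assumes f: "f permutes X" "finite X" and ge: "\<And>x. x \<in> X \<Longrightarrow> k \<le> card (orbit f x)"
    and few: "card X \<le> k * card (orbit f ` X)" and x: "x \<in> X"
  shows "card (orbit f x) = k"
proof (rule ccontr)
  assume "card (orbit f x) \<noteq> k"
  then have "k < card (orbit f x)" using ge[OF x] by simp
  then have "(\<Sum>S\<in>orbit f ` X. k) < (\<Sum>S\<in>orbit f ` X. card S)"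
    using f x ge by (intro sum_strict_mono_ex1) auto
  then show False using few sum_card_orbits[OF f] by (simp add: mult.commute)
qed

lemma orbit_involution: "f (f x) = x \<Longrightarrow> orbit f x = {x, f x}"
proof -
  assume "f (f x) = x"
  then have "orbit f x = {(f ^^ m) x |m. m < 2}" by (intro orbit_altdef_bounded) (simp_all add: eval_nat_numeral)
  also have "\<dots> = (\<lambda>m. (f ^^ m) x) ` {..<2}" by blast
  also have "{..<2} = {0, 1::nat}" by auto
  finally show "orbit f x = {x, f x}" by simp
qed

lemma card_orbits_involution:
  assumes "f permutes X" "finite X" and "\<And>x. x \<in> X \<Longrightarrow> f (f x) = x" "\<And>x. x \<in> X \<Longrightarrow> f x \<noteq> x"
  shows "2 * card (orbit f ` X) = card X"
proof -
  have "card (orbit f x) = 2" if "x \<in> X" for x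
    using orbit_involution[where f = f and x = x, OF assms(3)[OF that]] assms(4)[OF that] by simp
  then have "(\<Sum>S\<in>orbit f ` X. card S) = (\<Sum>S\<in>orbit f ` X. 2)" by (intro sum.cong) auto
  then show ?thesis using sum_card_orbits[OF assms(1,2)] by simp
qed

context link_diagram_context
begin

lemma card_edges: "2 * card (edges d) = card (darts d)"
  unfolding edges_def by (rule card_orbits_involution[OF opp_permutes finite_darts]) (simp_all add: opp_neq)

lemma finite_vertices: "finite (vertices d)"
  using finite_darts by (simp add: vertices_def)

text \<open>A crossing has four darts and a point has two, which are counted once more.\<close>

lemma card_vertices_points:
  "4 * card (vertices d) = card (darts d) + card {z \<in> darts d. \<not> crossing_at d z}"
proof -
  define P where "P = {v \<in> vertices d. card v = 2}"
  define Q where "Q = {v \<in> vertices d. card v = 4}"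
  have PQ: "vertices d = P \<union> Q" "P \<inter> Q = {}" and fin: "finite P" "finite Q"
    using link_diagram finite_vertices by (auto simp: P_def Q_def link_diagram_def)
  have dist: "disjnt v w" if "v \<in> vertices d" "w \<in> vertices d" "v \<noteq> w" for v w
    using that orbit_cyclic_eq3[OF cyclic_on_orbit'[OF permutation_nxt]] unfolding vertices_def disjnt_def by blast
  have "\<Union> P = {z \<in> darts d. \<not> crossing_at d z}"
  proof (intro subset_antisym subsetI)
    fix z assume "z \<in> \<Union> P"
    then obtain x where x: "x \<in> darts d" "z \<in> orbit (nxt d) x" "card (orbit (nxt d) x) = 2" by (auto simp: P_def vertices_def)
    then have "orbit (nxt d) z = orbit (nxt d) x" using orbit_cyclic_eq3[OF cyclic_on_orbit'[OF permutation_nxt]] by blast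
    moreover have "z \<in> darts d" using x permutes_orbit_subset[OF nxt_permutes] by blast
    ultimately show "z \<in> {z \<in> darts d. \<not> crossing_at d z}" using x by (simp add: crossing_at_def)
  next
    fix z assume z: "z \<in> {z \<in> darts d. \<not> crossing_at d z}"
    then have "orbit (nxt d) z \<in> P" using card_point by (auto simp: P_def vertices_def)
    then show "z \<in> \<Union> P" using permutation_self_in_orbit[OF permutation_nxt] by blast
  qed
  moreover have "card (\<Union> P) = sum card P"
  proof (rule card_Union_disjoint)
    show "pairwise disjnt P" using dist by (simp add: pairwise_def P_def)
    show "finite v" if "v \<in> P" for v using that card.infinite[of v] by (auto simp: P_def)
  qed
  moreover have "sum card P = 2 * card P" by (simp add: P_def)
  moreover have "(\<Sum>v\<in>vertices d. card v) = 2 * card P + 4 * card Q"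
    unfolding PQ(1) by (subst sum.union_disjoint) (use PQ fin in \<open>auto simp: P_def Q_def\<close>)
  moreover have "(\<Sum>v\<in>vertices d. card v) = card (darts d)"
    using sum_card_orbits[OF nxt_permutes finite_darts] by (simp add: vertices_def)
  moreover have "card (vertices d) = card P + card Q" unfolding PQ(1) by (rule card_Un_disjoint) (use PQ fin in auto)
  ultimately show ?thesis by simp
qed

text \<open>Euler's formula, where the graph has at least one component.\<close>

lemma card_faces_ge:
  "card (darts d) + 8 \<le> 4 * card (faces d) + card {z \<in> darts d. \<not> crossing_at d z}"
proof -
  have "0 < card (graph_components d)"
    using finite_darts darts_nonempty by (simp add: graph_components_def card_gt_0_iff)
  then show ?thesis using euler card_edges card_vertices_points by linarith
qed

lemma face_succ_permutes: "face_succ d permutes darts d"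
proof -
  have "face_succ d = nxt d \<circ> opp d" by (auto simp: face_succ_def)
  then show ?thesis using permutes_compose[OF opp_permutes nxt_permutes] by simp
qed

end

context two_bridge_diagram
begin

lemma card_points_le: "card {z \<in> darts d. \<not> crossing_at d z} \<le> 8"
proof -
  have "{z \<in> darts d. \<not> crossing_at d z} \<subseteq> set [first A, final A, first B, final B, first U, final U, first V, final V]"
    using point_path_cases[OF strands(1)] point_path_cases[OF strands(2)] point_path_cases[OF strands(3)]
      point_path_cases[OF strands(4)] darts_paths by auto
  then have "card {z \<in> darts d. \<not> crossing_at d z} \<le> card (set [first A, final A, first B, final B, first U, final U, first V, final V])"
    by (intro card_mono) auto
  also have "\<dots> \<le> length [first A, final A, first B, final B, first U, final U, first V, final V]" by (rule card_length)
  finally show ?thesis by simp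
qed

context
  assumes alt: "alternates U" "alternates V"
begin

lemma on_A_opp: assumes z: "z \<in> PU \<union> PV" shows "on_A (opp d z) \<noteq> on_A z"
proof -
  from z obtain W where W: "W \<in> {U, V}" "z \<in> path_darts d W" by blast
  then obtain i where "i < length W" "z = W ! i \<or> z = opp d (W ! i)" by (auto simp: path_darts_nth)
  then show ?thesis using alt W(1) by (auto simp: alternates_def)
qed

text \<open>Four kinds of darts: on the bridge \<open>A\<close>, on an under-strand at \<open>A\<close>, on the bridge \<open>B\<close>, on an under-strand at \<open>B\<close>. The
  boundary of a face runs through them in this cyclic order, so that the number of its darts is a multiple of 4.\<close>

definition side :: "nat \<Rightarrow> nat" where
  "side z = (if z \<in> PA then 0 else if z \<in> PB then 2 else if on_A z then 1 else 3)"

lemma side_face_succ: assumes z: "z \<in> darts d" shows "side (face_succ d z) = (side z + 1) mod 4"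
proof -
  have in_bridge: "nxt d (nxt d (opp d z)) \<in> path_darts d W" if W: "W \<in> {A, B}" "z \<in> path_darts d W" for W
  proof (cases "crossing_at d (opp d z)")
    case True
    then show ?thesis using path_through[of W "opp d z"] W strands by (auto simp: nxt_nxt_crossing path_darts_opp)
  next
    case False
    then show ?thesis using W by (simp add: nxt2 path_darts_opp)
  qed
  show ?thesis
  proof (cases "z \<in> PA \<union> PB")
    case True
    then have "nxt d (opp d z) \<in> PU \<union> PV" using nxt_under_iff[of "opp d z"] z by (auto simp: path_darts_opp)
    then have "nxt d (opp d z) \<notin> PA \<union> PB" using disjoint_paths by blast
    then show ?thesis
      using True in_bridge[of A] in_bridge[of B] disjoint_paths unfolding side_def face_succ_def on_A_def by auto
  next
    case False
    then have u: "z \<in> PU \<union> PV" using z darts_paths by blast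
    then have "opp d z \<in> PU \<union> PV" by (auto simp: path_darts_opp)
    then have "nxt d (opp d z) \<in> PA \<union> PB" using nxt_bridge_iff z by simp
    then show ?thesis using on_A_opp[OF u] False disjoint_paths unfolding side_def face_succ_def on_A_def by auto
  qed
qed

lemma face_card_ge: assumes z: "z \<in> darts d" shows "4 \<le> card (orbit (face_succ d) z)"
proof -
  let ?f = "face_succ d"
  have fin: "?f w \<in> darts d" if "w \<in> darts d" for w using that by (simp add: face_succ_def)
  have s: "side z < 4" by (simp add: side_def)
  have sides: "side (?f z) = (side z + 1) mod 4" "side (?f (?f z)) = (side z + 2) mod 4"
    "side (?f (?f (?f z))) = (side z + 3) mod 4" "side z = side z mod 4"
    using side_face_succ z fin s by (simp_all add: mod_simps add.commute)
  have ne: "(side z + i) mod 4 \<noteq> (side z + j) mod 4" if "i < j" "j < 4" for i j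
    using s that by presburger
  have "distinct (map side [z, ?f z, ?f (?f z), ?f (?f (?f z))])"
    using ne[of 0 1] ne[of 0 2] ne[of 0 3] ne[of 1 2] ne[of 1 3] ne[of 2 3] sides(4) unfolding list.map sides(1-3) by simp
  then have "distinct [z, ?f z, ?f (?f z), ?f (?f (?f z))]" by (simp only: distinct_map)
  then have "card (set [z, ?f z, ?f (?f z), ?f (?f (?f z))]) = 4" by (simp only: distinct_card) simp
  moreover have "permutation ?f" using face_succ_permutes finite_darts by (auto simp: permutation_permutes)
  then have self: "z \<in> orbit ?f z" by (rule permutation_self_in_orbit)
  then have "finite (orbit ?f z)" by (rule finite_orbit)
  moreover have "set [z, ?f z, ?f (?f z), ?f (?f (?f z))] \<subseteq> orbit ?f z" using self by (auto intro: orbit.intros)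
  ultimately show ?thesis using card_mono[of "orbit ?f z" "set [z, ?f z, ?f (?f z), ?f (?f (?f z))]"] by simp
qed

text \<open>This is the point where planarity is used. With eight darts at points, Euler's formula gives at least a quarter as many
  faces as there are darts, while every face has at least four darts. So every face has exactly four.\<close>

lemma face_succ_4: "face_succ d (face_succ d (face_succ d (face_succ d z))) = z"
proof (cases "z \<in> darts d")
  case True
  have "card (darts d) \<le> 4 * card (orbit (face_succ d) ` darts d)"
    using card_faces_ge card_points_le unfolding faces_def by linarith
  then have "card (orbit (face_succ d) z) = 4"
    using face_card_ge True by (intro orbits_of_minimal_size[OF face_succ_permutes finite_darts]) auto
  moreover have "permutation (face_succ d)" using face_succ_permutes finite_darts by (auto simp: permutation_permutes)
  ultimately show ?thesis using orbit_card(1)[of "face_succ d" z 4] by (simp add: eval_nat_numeral)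
next
  case False
  then have "face_succ d z = z" using face_succ_permutes by (simp add: permutes_not_in)
  then show ?thesis by simp
qed

text \<open>On the darts of the under-strands, \<open>rot\<close> is the step to the next such dart around the bridge at which
  it lies, along one side of this bridge, and around its end to the other side. The map \<open>reflect\<close> passes below the
  bridge.\<close>

definition rot :: "nat \<Rightarrow> nat" where "rot z = nxt d (opp d (nxt d z))"
definition reflect :: "nat \<Rightarrow> nat" where "reflect z = (if crossing_at d z then through d z else z)"

lemma reflect_nxt: "nxt d (nxt d z) = reflect z"
  by (simp add: reflect_def through_def nxt2)

text \<open>The two edges on the boundary of a quadrilateral are adjacent at both bridges, but in opposite directions. Together
  with the next lemma, \<open>rot\<close> is conjugated to its inverse both by \<open>opp\<close> and by \<open>reflect\<close>.\<close>

lemma rot_opp_rot: "rot (opp d (rot z)) = opp d z"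
  using face_succ_4[of "opp d z"] by (simp add: rot_def face_succ_def)

lemma rot_reflect_rot: "rot (reflect (rot z)) = reflect z"
proof -
  have "nxt d (reflect (nxt d w)) = w" for w
    unfolding reflect_nxt[symmetric] using nxt4[of w] nxt2[of w] by (cases "crossing_at d w") auto
  then show ?thesis by (simp add: rot_def reflect_nxt)
qed

lemma funpow_rot_opp: "(rot ^^ n) (opp d ((rot ^^ n) z)) = opp d z"
  by (induction n arbitrary: z) (simp_all add: funpow_swap1[symmetric] rot_opp_rot, simp add: funpow_swap1 rot_opp_rot)

lemma funpow_rot_reflect: "(rot ^^ n) (reflect ((rot ^^ n) z)) = reflect z"
  by (induction n arbitrary: z) (simp_all add: funpow_swap1[symmetric] rot_reflect_rot, simp add: funpow_swap1 rot_reflect_rot)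

text \<open>Starting at an end of a bridge, the rotation follows one side of this bridge.\<close>

lemma rot_along:
  assumes W: "strand_path d W" and i: "i < length W"
  shows "nxt d ((rot ^^ i) (nxt d (first W))) = W ! i"
  using i
proof (induction i)
  case 0
  show ?case using strand_hd[OF W] by (simp add: nxt2)
next
  case (Suc i)
  then have "(rot ^^ Suc i) (nxt d (first W)) = nxt d (opp d (W ! i))" by (simp add: rot_def[of "(rot ^^ i) (nxt d (first W))"])
  then show ?case using strand_step[OF W Suc.prems] by (simp add: nxt_nxt_crossing)
qed

lemma rot_end:
  assumes W: "strand_path d W"
  shows "(rot ^^ length W) (nxt d (first W)) = nxt d (final W)"
proof -
  obtain l where l: "length W = Suc l" using strand_nonempty(2)[OF W] by (cases "length W") auto
  then show ?thesis using rot_along[OF W, of l] by (simp add: rot_def)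
qed

text \<open>After \<open>length A\<close> steps, the rotation around \<open>A\<close> has come from one end of \<open>A\<close> to the other one.\<close>

definition half_turn :: "nat \<Rightarrow> nat" where "half_turn = rot ^^ length A"

lemma half_turn_ends: "half_turn (nxt d (first A)) = nxt d (final A)" "half_turn (nxt d (final A)) = nxt d (first A)"
proof -
  show "half_turn (nxt d (first A)) = nxt d (final A)" unfolding half_turn_def by (rule rot_end[OF strands(1)])
  have "first (reverse_path d A) = final A" "final (reverse_path d A) = first A"
    using strand_nonempty(2)[OF strands(1)] by (simp_all add: reverse_path_nth)
  then show "half_turn (nxt d (final A)) = nxt d (first A)"
    using rot_end[OF strand_path_reverse[OF strands(1)]] unfolding half_turn_def by simp
qed

lemma half_turn_opp': "half_turn (opp d (half_turn z)) = opp d z"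
  and half_turn_reflect': "half_turn (reflect (half_turn z)) = reflect z"
  unfolding half_turn_def by (rule funpow_rot_opp funpow_rot_reflect)+

text \<open>Around the bridge \<open>A\<close> this is a full turn. An edge that leads to \<open>B\<close> carries it over, in the opposite direction.\<close>

lemma half_turn_half_turn:
  assumes z: "z \<in> PU \<union> PV"
  shows "half_turn (half_turn z) = z"
proof -
  have comm: "half_turn ((rot ^^ i) w) = (rot ^^ i) (half_turn w)" for i w
    unfolding half_turn_def by (metis add.commute comp_apply funpow_add)
  have onA: "half_turn (half_turn z) = z" if z: "on_A z" for z
  proof -
    have path: "half_turn (half_turn z) = z"
      if W: "W \<in> {A, reverse_path d A}" and i: "i < length W" "nxt d z = W ! i" for W i
    proof -
      have S: "strand_path d W" using W strands strand_path_reverse by blast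
      have "first (reverse_path d A) = final A" using strand_nonempty(2)[OF strands(1)] by (simp add: reverse_path_nth)
      then have h: "half_turn (half_turn (nxt d (first W))) = nxt d (first W)"
        using W half_turn_ends by auto
      have "z = (rot ^^ i) (nxt d (first W))" using rot_along[OF S i(1)] i(2) nxt_eq_iff by metis
      then show ?thesis using h comm by simp
    qed
    obtain i where i: "i < length A" "nxt d z = A ! i \<or> nxt d z = opp d (A ! i)"
      using z by (auto simp: on_A_def path_darts_nth)
    moreover have "opp d (A ! i) = reverse_path d A ! (length A - Suc i)"
      using i(1) by (simp add: reverse_path_nth)
    ultimately show ?thesis using path[of A i] path[of "reverse_path d A" "length A - Suc i"] by auto
  qed
  show ?thesis
  proof (cases "on_A z")
    case False
    then have "half_turn (half_turn (opp d z)) = opp d z" using onA on_A_opp[OF z] by blast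
    moreover have "half_turn (half_turn (opp d (half_turn (half_turn (opp d z))))) = opp d (opp d z)"
      by (simp only: half_turn_opp')
    ultimately show ?thesis by simp
  qed (rule onA)
qed

lemma half_turn_opp: "z \<in> PU \<union> PV \<Longrightarrow> half_turn (opp d z) = opp d (half_turn z)"
  using half_turn_opp'[of "half_turn z"] half_turn_half_turn by simp

lemma half_turn_reflect: "z \<in> PU \<union> PV \<Longrightarrow> half_turn (reflect z) = reflect (half_turn z)"
  using half_turn_reflect'[of "half_turn z"] half_turn_half_turn by simp

lemma crossing_half_turn:
  assumes z: "z \<in> PU \<union> PV"
  shows "crossing_at d (half_turn z) \<longleftrightarrow> crossing_at d z"
proof -
  have r: "reflect w = w \<longleftrightarrow> \<not> crossing_at d w" for w
    using nxt_neq_crossing(2)[of w] by (auto simp: reflect_def through_def)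
  have "reflect z = z \<longleftrightarrow> reflect (half_turn z) = half_turn z"
    using half_turn_reflect[OF z] half_turn_reflect'[of z] half_turn_half_turn[OF z] by metis
  then show ?thesis using r by blast
qed

text \<open>The half turn commutes with \<open>opp\<close> and \<open>reflect\<close>, which generate the course of an under-strand. So it maps the darts of \<open>X\<close>
  to those of \<open>Y\<close> one by one, and \<open>Y\<close> ends not later than \<open>X\<close>.\<close>

lemma length_le_half_turn:
  assumes X: "strand_path d X" "path_darts d X \<subseteq> PU \<union> PV" and Y: "strand_path d Y"
    and first: "first Y = half_turn (first X)"
  shows "length Y \<le> length X"
proof (rule ccontr)
  assume long: "\<not> length Y \<le> length X"
  have under: "X ! i \<in> PU \<union> PV" "opp d (X ! i) \<in> PU \<union> PV" if "i < length X" for i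
    using in_paths[OF that] X(2) by blast+
  have "Y ! i = half_turn (X ! i)" if "i < length X" for i
    using that
  proof (induction i)
    case (Suc i)
    let ?z = "opp d (X ! i)"
    have u: "X ! i \<in> PU \<union> PV" "?z \<in> PU \<union> PV" using under Suc.prems by auto
    have "X ! Suc i = reflect ?z" using strand_step[OF X(1) Suc.prems] by (simp add: reflect_def)
    moreover have "Y ! Suc i = reflect (opp d (Y ! i))" using strand_step[OF Y, of i] Suc.prems long by (simp add: reflect_def)
    ultimately show ?case using Suc half_turn_opp[OF u(1)] half_turn_reflect[OF u(2)] by simp
  qed (simp add: first)
  moreover obtain l where l: "length X = Suc l" using strand_nonempty(2)[OF X(1)] by (cases "length X") auto
  ultimately have "opp d (Y ! l) = half_turn (opp d (X ! l))" using half_turn_opp under by simp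
  moreover have "\<not> crossing_at d (opp d (X ! l))" using strand_last[OF X(1)] l by simp
  moreover have "crossing_at d (opp d (Y ! l))" using strand_step[OF Y, of l] l long by simp
  ultimately show False using crossing_half_turn under l by simp
qed

text \<open>Both under-strands, directed suitably, start at the ends of \<open>A\<close>, which the half turn exchanges.\<close>

lemma joined_strands_same_length:
  assumes join: "on_A (first U) \<noteq> on_A (final U)" "on_A (first V) \<noteq> on_A (final V)"
  shows "length U = length V"
proof -
  have start: "\<exists>X. strand_path d X \<and> path_darts d X = path_darts d W \<and> length X = length W \<and> first X \<in> {nxt d (first A), nxt d (final A)}"
    if W: "W \<in> {U, V}" "on_A (first W) \<noteq> on_A (final W)" for W
  proof -
    have S: "strand_path d W" using W strands by blast
    have rev: "first (reverse_path d W) = final W" using strand_nonempty(2)[OF S] by (simp add: reverse_path_nth)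
    have e: "z \<in> {nxt d (first A), nxt d (final A)}" if "on_A z" "\<not> crossing_at d z" for z
    proof -
      have "nxt d z = first A \<or> nxt d z = final A"
        using point_path_cases[OF strands(1), of "nxt d z"] that by (simp add: on_A_def)
      then show ?thesis using nxt2[OF that(2)] by auto
    qed
    show ?thesis
    proof (cases "on_A (first W)")
      case True
      then show ?thesis using S e[OF True strand_hd[OF S]] by blast
    next
      case False
      then have "on_A (final W)" using W by blast
      then show ?thesis
        using strand_path_reverse[OF S] path_darts_reverse[of W] rev e[OF _ strand_last[OF S]]
        by (intro exI[of _ "reverse_path d W"]) simp
    qed
  qed
  obtain X where X: "strand_path d X" "path_darts d X = PU" "length X = length U" "first X \<in> {nxt d (first A), nxt d (final A)}"
    using start[of U] join by blast
  obtain Y where Y: "strand_path d Y" "path_darts d Y = PV" "length Y = length V" "first Y \<in> {nxt d (first A), nxt d (final A)}"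
    using start[of V] join by blast
  have "first X \<in> PU" using in_paths[OF strand_nonempty(2)[OF X(1)]] unfolding X(2) by (rule conjunct1)
  moreover have "first Y \<in> PV" using in_paths[OF strand_nonempty(2)[OF Y(1)]] unfolding Y(2) by (rule conjunct1)
  ultimately have "first X \<noteq> first Y" using disjoint_paths(6) by (metis disjoint_iff)
  then have "first Y = half_turn (first X)" "first X = half_turn (first Y)"
    using X(4) Y(4) half_turn_ends by (elim insertE emptyE; simp)+
  then have "length Y \<le> length X" "length X \<le> length Y"
    using length_le_half_turn[OF X(1) _ Y(1)] length_le_half_turn[OF Y(1) _ X(1)] X(2) Y(2) by auto
  then show ?thesis using X Y by simp
qed

end
end

context schubert_diagram
begin

text \<open>If the under-strands return to their bridges, then the modulus is even, hence 0; this happens only if neither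
  of them has passes.\<close>

lemma modulus_le_1_imp_no_passes:
  assumes "modulus \<le> 1"
  shows "length U = 1 \<and> length V = 1"
proof (cases "on_A (first U) \<noteq> on_A (final U)")
  case True
  then have V: "on_A (first V) \<noteq> on_A (final V)" using on_A_ends_cases by blast
  have alt: "alternates U" "alternates V" using joining_alternates True V by auto
  have "length U = length V" by (rule joined_strands_same_length[OF alt True V])
  then have "length U \<le> 1" using assms alt by (simp add: modulus_def weight_def)
  then show ?thesis using \<open>length U = length V\<close> strand_nonempty(2)[OF strands(3)] by linarith
next
  case False
  then have same: "on_A (first U) = on_A (final U)" "on_A (first V) = on_A (final V)"
    using on_A_ends_cases by auto
  have evenW: "even (weight W)" if "W \<in> {U, V}" for W
    using alternates_parity[OF that] same that by (auto simp: weight_def)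
  then have "even modulus" by (auto simp: modulus_def)
  then have "modulus = 0" using assms by (cases "modulus = 1") auto
  then have "\<not> alternates U" "\<not> alternates V"
    using strand_nonempty(2)[OF strands(3)] strand_nonempty(2)[OF strands(4)] by (auto simp: modulus_def weight_def split: if_splits)
  then show ?thesis using not_alternates(1) by simp
qed

end


section \<open>Diagrams without crossings\<close>

lemma involution_permutes:
  assumes "\<And>x. f (f x) = x" "\<And>x. x \<notin> X \<Longrightarrow> f x = x"
  shows "f permutes X"
  unfolding permutes_def using assms by metis

context
  fixes f :: "'a \<Rightarrow> 'a" and X :: "'a set" and y :: 'a
  assumes f: "f permutes X" "finite X" and y: "y \<in> X" "f y \<noteq> y"
begin

text \<open>The permutation \<open>transpose y (f y) \<circ> f\<close> arises from \<open>f\<close> by removing \<open>y\<close> from its cycle. The faces of a diagram change in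
  this way when a point is forgotten.\<close>

lemma skip_apply: "(transpose y (f y) \<circ> f) z = (if z = y then y else if f z = y then f y else f z)"
  using permutes_inj[OF f(1)] by (auto simp: transpose_def dest: injD)

lemma skip_permutes: "(transpose y (f y) \<circ> f) permutes (X - {y})"
proof -
  have "f y \<in> X" using y permutes_in_image[OF f(1)] by blast
  then have "(transpose y (f y) \<circ> f) permutes X"
    using permutes_compose[OF f(1) permutes_swap_id[of y X "f y"]] y by (simp add: transpose_def)
  then show ?thesis by (rule permutes_superset) (auto simp: skip_apply)
qed

lemma orbit_skip:
  assumes z: "z \<noteq> y"
  shows "orbit (transpose y (f y) \<circ> f) z = orbit f z - {y}"
proof -
  let ?g = "transpose y (f y) \<circ> f"
  have nexti: "?g w \<in> orbit f w \<and> ?g w \<noteq> y" if "w \<noteq> y" for w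
  proof (cases "f w = y")
    case True
    have "f (f w) \<in> orbit f w" by (rule orbit.step[OF orbit.base])
    then show ?thesis using that True y(2) unfolding skip_apply by simp
  next
    case False
    then show ?thesis using that orbit.base[of f w] unfolding skip_apply by simp
  qed
  have "w \<in> orbit f z \<and> w \<noteq> y" if "w \<in> orbit ?g z" for w
    using that
  proof induction
    case base
    show ?case by (rule nexti[OF z])
  next
    case (step w)
    then show ?case using nexti[of w] orbit_trans[of "?g w" f w z] by blast
  qed
  moreover have "(w \<noteq> y \<longrightarrow> w \<in> orbit ?g z) \<and> (w = y \<longrightarrow> f y \<in> orbit ?g z)" if "w \<in> orbit f z" for w
    using that
  proof induction
    case base
    show ?case using orbit.base[of ?g z] z unfolding skip_apply by (auto split: if_splits)
  next
    case (step w)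
    show ?case
    proof (cases "w = y")
      case False
      then have "?g w \<in> orbit ?g z" using step by (intro orbit.step) auto
      then show ?thesis using False unfolding skip_apply by (auto split: if_splits)
    qed (use step y in auto)
  qed
  ultimately show ?thesis by blast
qed

lemma card_orbits_skip: "card (orbit (transpose y (f y) \<circ> f) ` (X - {y})) = card (orbit f ` X)"
proof -
  let ?g = "transpose y (f y) \<circ> f"
  have perm: "permutation f" using f by (auto simp: permutation_permutes)
  have self: "x \<in> orbit f x" for x by (rule permutation_self_in_orbit[OF perm])
  have eq: "orbit f w = orbit f x" if "w \<in> orbit f x" for w x
    using that by (rule orbit_cyclic_eq3[OF cyclic_on_orbit'[OF perm]])
  have fy: "f y \<in> X" using y permutes_in_image[OF f(1)] by blast
  have rep: "\<exists>x\<in>X - {y}. S = orbit f x" if S: "S \<in> orbit f ` X" for S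
  proof -
    obtain x where x: "x \<in> X" "S = orbit f x" using S by blast
    have "orbit f y = orbit f (f y)" by (rule permutation_orbit_step[OF perm, symmetric])
    then show ?thesis using x fy y by (cases "x = y") auto
  qed
  have "orbit ?g ` (X - {y}) = (\<lambda>S. S - {y}) ` (orbit f ` X)"
  proof (intro subset_antisym subsetI)
    fix S assume "S \<in> (\<lambda>S. S - {y}) ` (orbit f ` X)"
    then obtain T where T: "T \<in> orbit f ` X" "S = T - {y}" by (rule imageE)
    obtain x where x: "x \<in> X - {y}" "T = orbit f x" using rep[OF T(1)] by (rule bexE)
    have "S = orbit ?g x" unfolding T(2) x(2) by (rule orbit_skip[symmetric]) (use x(1) in simp)
    then show "S \<in> orbit ?g ` (X - {y})" using x(1) by (rule image_eqI)
  next
    fix S assume "S \<in> orbit ?g ` (X - {y})"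
    then obtain x where "x \<in> X - {y}" "S = orbit ?g x" by (rule imageE)
    then have "x \<in> X" "S = orbit f x - {y}" using orbit_skip by simp_all
    then show "S \<in> (\<lambda>S. S - {y}) ` (orbit f ` X)" by blast
  qed
  moreover have "inj_on (\<lambda>S. S - {y}) (orbit f ` X)"
  proof (rule inj_onI)
    fix S T assume S: "S \<in> orbit f ` X" and T: "T \<in> orbit f ` X" and ST: "S - {y} = T - {y}"
    obtain x where x: "x \<noteq> y" "S = orbit f x" using rep[OF S] by blast
    then have "x \<in> T" using ST self[of x] by blast
    then show "S = T" using eq T x(2) by blast
  qed
  ultimately show ?thesis by (simp add: card_image)
qed

end

context link_diagram_context
begin

definition step_rel :: "(nat \<times> nat) set" where
  "step_rel = {(y, z). y \<in> darts d \<and> (z = opp d y \<or> z = nxt d y)}"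

lemma graph_components_eq: "graph_components d = (\<lambda>z. step_rel\<^sup>* `` {z}) ` darts d"
  by (simp add: graph_components_def step_rel_def)

lemma step_rel_opp: "z \<in> darts d \<Longrightarrow> (z, opp d z) \<in> step_rel"
  and step_rel_nxt: "z \<in> darts d \<Longrightarrow> (z, nxt d z) \<in> step_rel"
  by (auto simp: step_rel_def)

lemma step_rel_back: "(y, z) \<in> step_rel \<Longrightarrow> (z, y) \<in> step_rel\<^sup>*"
proof -
  assume yz: "(y, z) \<in> step_rel"
  then have y: "y \<in> darts d" by (simp add: step_rel_def)
  note n = r_into_rtrancl[OF step_rel_nxt]
  have reverse: "(nxt d y, y) \<in> step_rel\<^sup>*"
  proof (cases "crossing_at d y")
    case True
    have "(nxt d y, nxt d (nxt d (nxt d (nxt d y)))) \<in> step_rel\<^sup>*"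
      using y by (intro rtrancl_trans[OF n rtrancl_trans[OF n n]]) auto
    then show ?thesis by (simp add: nxt4[OF True])
  next
    case False
    then show ?thesis using n[of "nxt d y"] y by (simp add: nxt2)
  qed
  from yz have "z = opp d y \<or> z = nxt d y" by (auto simp: step_rel_def)
  then show "(z, y) \<in> step_rel\<^sup>*" using reverse step_rel_opp[of z] y by auto
qed

lemma component_sym: "(y, z) \<in> step_rel\<^sup>* \<Longrightarrow> (z, y) \<in> step_rel\<^sup>*"
  by (induction rule: rtrancl_induct) (auto intro: rtrancl_trans step_rel_back)

lemma component_eq: "(y, z) \<in> step_rel\<^sup>* \<Longrightarrow> step_rel\<^sup>* `` {z} = step_rel\<^sup>* `` {y}"
  using component_sym by (auto intro: rtrancl_trans)

context
  fixes x assumes x: "x \<in> darts d" "\<not> crossing_at d x" and neq: "opp d x \<noteq> nxt d x"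
begin

private abbreviation (input) "d' \<equiv> forget_point d x"
private abbreviation (input) "y \<equiv> nxt d x"

lemma y_facts: "y \<in> darts d" "nxt d y = x" "y \<noteq> x" "opp d y \<noteq> x" "opp d x \<noteq> x" "opp d y \<noteq> y" "opp d x \<noteq> opp d y"
  using x nxt2[OF x(2)] nxt_neq[OF x(1)] opp_neq neq by (auto, metis opp_opp)

lemma forget_opp_all: "opp d' z = (if z = x \<or> z = y then z else if z = opp d x then opp d y
    else if z = opp d y then opp d x else opp d z)"
  by (auto simp: forget_point_def Let_def)

lemma forget_nxt_all: "nxt d' z = (if z = x \<or> z = y then z else nxt d z)"
  by (auto simp: forget_point_def Let_def)

lemma opp_swap: "opp d z = w \<longleftrightarrow> z = opp d w"
  by (metis opp_opp)

lemmas ineqs = y_facts(3-6) y_facts(3-6)[symmetric] neq neq[symmetric]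

lemma forget_opp_opp: "opp d' (opp d' z) = z"
proof -
  have "opp d z \<noteq> x" if "z \<noteq> opp d x" for z using that by (metis opp_opp)
  moreover have "opp d z \<noteq> y" if "z \<noteq> opp d y" for z using that by (metis opp_opp)
  ultimately show ?thesis
    by (cases "z = x"; cases "z = y"; cases "z = opp d x"; cases "z = opp d y") (simp_all add: forget_opp_all ineqs)
qed

lemma forget_opp_permutes: "opp d' permutes darts d'"
proof (rule involution_permutes[OF forget_opp_opp])
  fix z assume z: "z \<notin> darts d'"
  show "opp d' z = z"
  proof (cases "z \<in> {x, y}")
    case False
    then have "z \<notin> darts d" using z by (simp add: forget_point_darts[OF x])
    then have "opp d z = z" "z \<noteq> opp d x" "z \<noteq> opp d y" using opp_permutes x y_facts(1) by (auto simp: permutes_not_in)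
    then show ?thesis by (simp add: forget_opp_all)
  qed (auto simp: forget_opp_all)
qed

lemma forget_opp_neq: "z \<in> darts d' \<Longrightarrow> opp d' z \<noteq> z"
  using opp_neq y_facts by (auto simp: forget_opp_all forget_point_darts[OF x])

lemma forget_nxt_permutes: "nxt d' permutes darts d'"
proof -
  have "cyclic_on (nxt d) {x, y}"
    using cyclic_on_orbit[OF nxt_permutes finite_darts, of x] orbit_point[OF x] by simp
  then have "perm_restrict (nxt d) (darts d - {x, y}) permutes (darts d - {x, y})"
    by (rule perm_restrict_diff_cyclic[OF nxt_permutes])
  moreover have "perm_restrict (nxt d) (darts d - {x, y}) = nxt d'"
    using nxt_permutes by (auto simp: perm_restrict_def forget_nxt_all fun_eq_iff permutes_not_in)
  ultimately show ?thesis by (simp add: forget_point_darts[OF x])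
qed

lemma forget_vertices: "vertices d = insert {x, y} (vertices d')" "{x, y} \<notin> vertices d'"
proof -
  have v: "vertices d' = orbit (nxt d) ` (darts d - {x, y})"
    using forget_point_orbit[OF x] by (auto simp: vertices_def forget_point_darts[OF x] image_iff)
  have "orbit (nxt d) x = {x, y}" "orbit (nxt d) y = {x, y}"
    using orbit_point[OF x] orbit_nxt[of x] by auto
  moreover have "darts d = {x, y} \<union> (darts d - {x, y})" using x y_facts by auto
  then have "vertices d = orbit (nxt d) ` ({x, y} \<union> (darts d - {x, y}))" unfolding vertices_def by (rule arg_cong)
  ultimately show "vertices d = insert {x, y} (vertices d')" unfolding v image_Un by simp
  show "{x, y} \<notin> vertices d'"
  proof
    assume "{x, y} \<in> vertices d'"
    then obtain z where "z \<in> darts d - {x, y}" "orbit (nxt d) z = {x, y}" unfolding v by blast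
    then show False using permutation_self_in_orbit[OF permutation_nxt, of z] by blast
  qed
qed

lemma forget_edges: "card (edges d) = Suc (card (edges d'))"
proof -
  have fin: "finite (darts d')" using finite_darts by (simp add: forget_point_darts[OF x])
  have "2 * card (edges d') = card (darts d')"
    unfolding edges_def by (rule card_orbits_involution[OF forget_opp_permutes fin forget_opp_opp forget_opp_neq])
  moreover have "card (darts d) = card (darts d') + 2"
  proof -
    have "card (darts d') = card (darts d) - card {x, y}" using x y_facts
      unfolding forget_point_darts[OF x] by (intro card_Diff_subset) auto
    moreover have "card {x, y} = 2" using y_facts by simp
    moreover have "card {x, y} \<le> card (darts d)" using x y_facts finite_darts by (intro card_mono) auto
    ultimately show ?thesis by simp
  qed
  ultimately show ?thesis using card_edges by linarith
qed

text \<open>The two darts at the point are removed from the boundaries of the two faces next to it (or from two places of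
  one boundary). Neither of them is alone on its face, as the strand does not close up at the point.\<close>

lemma forget_faces: "card (faces d') = card (faces d)"
proof -
  let ?f = "face_succ d"
  let ?g = "transpose y (?f y) \<circ> ?f"
  let ?h = "transpose x (?g x) \<circ> ?g"
  have fy: "?f y \<noteq> y" "?f y \<noteq> x" "?f x \<noteq> x" "?f x \<noteq> y"
    using y_facts neq by (auto simp: face_succ_def) (metis nxt_eq_iff)+
  note skip1 = skip_apply[OF face_succ_permutes finite_darts y_facts(1) fy(1)]
  have g: "?g permutes (darts d - {y})"
    by (rule skip_permutes[OF face_succ_permutes finite_darts y_facts(1) fy(1)])
  have fin: "finite (darts d - {y})" using finite_darts by simp
  have gx: "?g x = ?f x" unfolding skip1 using fy y_facts by simp
  have xin: "x \<in> darts d - {y}" "?g x \<noteq> x" using x y_facts fy unfolding gx by auto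
  note skip2 = skip_apply[OF g fin xin]
  have "face_succ d' = ?h"
  proof
    fix z
    have nx: "nxt d w = x \<longleftrightarrow> w = y" "nxt d w = y \<longleftrightarrow> w = x" for w
      using nxt_eq_iff[of w y] nxt_eq_iff[of w x] y_facts(2) by simp_all
    have ox: "opp d w = x \<longleftrightarrow> w = opp d x" "opp d w = y \<longleftrightarrow> w = opp d y" for w by (metis opp_opp)+
    show "face_succ d' z = ?h z"
      unfolding skip2 unfolding skip1 unfolding face_succ_def forget_opp_all forget_nxt_all
      by (cases "z = x"; cases "z = y"; cases "z = opp d x"; cases "z = opp d y") (simp_all add: nx ox ineqs y_facts(2))
  qed
  then have "faces d' = orbit ?h ` (darts d - {y} - {x})"
    unfolding faces_def forget_point_darts[OF x] by (metis Diff_insert)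
  then have "card (faces d') = card (orbit ?h ` (darts d - {y} - {x}))" by (rule arg_cong)
  also have "\<dots> = card (orbit ?g ` (darts d - {y}))" by (rule card_orbits_skip[OF g fin xin])
  also have "\<dots> = card (faces d)"
    unfolding faces_def by (rule card_orbits_skip[OF face_succ_permutes finite_darts y_facts(1) fy(1)])
  finally show ?thesis .
qed

lemma forget_components: "card (graph_components d') = card (graph_components d)"
proof -
  define r where "r = {(w, z). w \<in> darts d' \<and> (z = opp d' w \<or> z = nxt d' w)}"
  let ?p = "opp d x" and ?q = "opp d y"
  have dd: "darts d' = darts d - {x, y}" by (rule forget_point_darts[OF x])
  have pq: "?p \<in> darts d'" "?q \<in> darts d'" using x y_facts neq by (auto simp: dd)
  have rpq: "(?p, ?q) \<in> r" "(?q, ?p) \<in> r" using pq y_facts neq by (auto simp: r_def forget_opp_all)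
  have xp: "(?p, x) \<in> step_rel" "(x, y) \<in> step_rel" "(y, ?q) \<in> step_rel" "(?q, y) \<in> step_rel" "(y, x) \<in> step_rel" "(x, ?p) \<in> step_rel"
    using x y_facts step_rel_opp[of ?p] step_rel_opp[of ?q] step_rel_opp step_rel_nxt by (auto simp: step_rel_def)
  have comp: "r\<^sup>* `` {z} = step_rel\<^sup>* `` {z} - {x, y}" if z: "z \<in> darts d'" for z
  proof -
    have "(z, w) \<in> step_rel\<^sup>* \<and> w \<in> darts d'" if "(z, w) \<in> r\<^sup>*" for w
      using that
    proof (induction rule: rtrancl_induct)
      case base
      show ?case using z by simp
    next
      case (step w w')
      then have w: "w \<in> darts d - {x, y}" and wz: "(z, w) \<in> step_rel\<^sup>*" by (auto simp: dd)
      from step(2) consider "w' = opp d' w" | "w' = nxt d' w" by (auto simp: r_def)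
      then show ?case
      proof cases
        case 2
        then show ?thesis using wz w nxt_notin_point[OF x w] step_rel_nxt[of w] by (auto simp: forget_nxt_all dd)
      next
        case 1
        consider "w = ?p" "w' = ?q" | "w = ?q" "w' = ?p" | "w \<noteq> ?p" "w \<noteq> ?q" "w' = opp d w"
          using 1 w y_facts by (auto simp: forget_opp_all split: if_splits)
        then show ?thesis
        proof cases
          case 1
          then show ?thesis using wz xp(1-3) pq by (meson rtrancl.rtrancl_into_rtrancl)
        next
          case 2
          then show ?thesis using wz xp(4-6) pq by (meson rtrancl.rtrancl_into_rtrancl)
        next
          case 3
          then have "w' \<in> darts d'" using w by (auto simp: dd opp_swap)
          then show ?thesis using 3 wz w step_rel_opp[of w] by auto
        qed
      qed
    qed
    moreover have "(w \<notin> {x, y} \<longrightarrow> (z, w) \<in> r\<^sup>*) \<and> (w \<in> {x, y} \<longrightarrow> (z, ?p) \<in> r\<^sup>* \<and> (z, ?q) \<in> r\<^sup>*)"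
      if "(z, w) \<in> step_rel\<^sup>*" for w
      using that
    proof (induction rule: rtrancl_induct)
      case base
      show ?case using z by (auto simp: dd)
    next
      case (step w w')
      have w: "w \<in> darts d" and w': "w' = opp d w \<or> w' = nxt d w" using step(2) by (auto simp: step_rel_def)
      have both: "(z, ?p) \<in> r\<^sup>* \<and> (z, ?q) \<in> r\<^sup>*" if "(z, ?p) \<in> r\<^sup>* \<or> (z, ?q) \<in> r\<^sup>*"
        using that rpq by (meson rtrancl.rtrancl_into_rtrancl)
      show ?case
      proof (cases "w \<in> {x, y}")
        case True
        then have pqz: "(z, ?p) \<in> r\<^sup>*" "(z, ?q) \<in> r\<^sup>*" using step.IH by auto
        have "w' \<in> {?p, ?q, x, y}" using True w' y_facts by auto
        then show ?thesis using pqz by auto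
      next
        case False
        then have zw: "(z, w) \<in> r\<^sup>*" "w \<in> darts d - {x, y}" using step.IH w by auto
        consider "w = ?p" "w' = x" | "w = ?q" "w' = y" | "w \<noteq> ?p" "w \<noteq> ?q" "w' = opp d w" | "w' = nxt d w"
          using w' by (cases "w = ?p"; cases "w = ?q") auto
        then show ?thesis
        proof cases
          case 1
          then show ?thesis using both zw by auto
        next
          case 2
          then show ?thesis using both zw by auto
        next
          case 3
          then have "(w, w') \<in> r" using zw by (auto simp: r_def dd forget_opp_all)
          moreover have "w' \<notin> {x, y}" using 3 by (auto simp: opp_swap)
          ultimately show ?thesis using zw by (auto intro: rtrancl_into_rtrancl)
        next
          case 4
          then have "(w, w') \<in> r" using zw by (auto simp: r_def dd forget_nxt_all)
          moreover have "w' \<notin> {x, y}" using 4 nxt_notin_point[OF x zw(2)] by auto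
          ultimately show ?thesis using zw by (auto intro: rtrancl_into_rtrancl)
        qed
      qed
    qed
    ultimately show ?thesis by (auto simp: dd)
  qed
  have rep: "\<exists>z\<in>darts d'. S = step_rel\<^sup>* `` {z}" if "S \<in> graph_components d" for S
  proof -
    obtain z where z: "z \<in> darts d" "S = step_rel\<^sup>* `` {z}" using \<open>S \<in> graph_components d\<close> by (auto simp: graph_components_eq)
    show ?thesis
    proof (cases "z \<in> {x, y}")
      case True
      have "(x, ?p) \<in> step_rel\<^sup>*" using xp(6) by (rule r_into_rtrancl)
      moreover have "(y, ?p) \<in> step_rel\<^sup>*" using xp(5,6) by (meson r_into_rtrancl rtrancl_trans)
      ultimately have "(z, ?p) \<in> step_rel\<^sup>*" using True by blast
      then show ?thesis using component_eq z(2) pq(1) by blast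
    qed (use z in \<open>auto simp: dd\<close>)
  qed
  have "graph_components d' = (\<lambda>z. r\<^sup>* `` {z}) ` darts d'" by (simp add: graph_components_def r_def)
  also have "\<dots> = (\<lambda>S. S - {x, y}) ` graph_components d"
  proof (intro subset_antisym subsetI)
    fix S assume "S \<in> (\<lambda>z. r\<^sup>* `` {z}) ` darts d'"
    then show "S \<in> (\<lambda>S. S - {x, y}) ` graph_components d" using comp by (auto simp: graph_components_eq dd)
  next
    fix S assume "S \<in> (\<lambda>S. S - {x, y}) ` graph_components d"
    then obtain z where "z \<in> darts d'" "S = step_rel\<^sup>* `` {z} - {x, y}" using rep by blast
    then show "S \<in> (\<lambda>z. r\<^sup>* `` {z}) ` darts d'" using comp by blast
  qed
  finally have eq: "graph_components d' = (\<lambda>S. S - {x, y}) ` graph_components d" .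
  have "inj_on (\<lambda>S. S - {x, y}) (graph_components d)"
  proof (rule inj_onI)
    fix S T assume S: "S \<in> graph_components d" and T: "T \<in> graph_components d" and ST: "S - {x, y} = T - {x, y}"
    obtain z where z: "z \<in> darts d'" "S = step_rel\<^sup>* `` {z}" using rep[OF S] by blast
    then have "z \<in> S - {x, y}" by (auto simp: dd)
    then have "z \<in> T" using ST by blast
    then show "S = T" using T z(2) component_eq by (auto simp: graph_components_eq)
  qed
  then show ?thesis unfolding eq by (rule card_image)
qed

text \<open>Forgetting a point removes one vertex and one edge, and neither faces nor components: Euler's formula persists.\<close>

lemma link_diagram_forget_point: "link_diagram d'"
proof -
  have fin: "finite (vertices d')" using finite_darts by (simp add: vertices_def forget_point_darts[OF x])
  have V: "card (vertices d) = Suc (card (vertices d'))"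
    using forget_vertices fin by simp
  have cross: "crossing_at d' z \<longleftrightarrow> crossing_at d z" for z
  proof (cases "z \<in> darts d - {x, y}")
    case False
    then have "z \<notin> darts d'" "\<not> crossing_at d z" using x crossing_in[of z] by (auto simp: forget_point_darts[OF x])
    then show ?thesis by (simp add: crossing_at_def[of d'])
  qed (rule forget_point_crossing[OF x])
  have "nxt d' z = nxt d z" if "crossing_at d z" for z
    using that x by (auto simp: forget_nxt_all)
  then have over: "\<forall>z. crossing_at d' z \<longrightarrow> (z \<in> over d' \<longleftrightarrow> nxt d' z \<notin> over d')"
    using nxt_over by (simp add: cross forget_point_over[OF x])
  have "opp d x \<in> darts d'" using x y_facts neq by (auto simp: forget_point_darts[OF x])
  then have ne: "darts d' \<noteq> {}" by blast
  have size: "\<forall>v\<in>vertices d'. card v = 2 \<or> card v = 4"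
    using link_diagram forget_vertices(1) by (simp add: link_diagram_def)
  have eul: "card (vertices d') + card (faces d') = card (edges d') + 2 * card (graph_components d')"
    using euler V forget_edges forget_faces forget_components by linarith
  have "over d' \<subseteq> {z. crossing_at d' z}"
    using over_crossing by (auto simp: cross forget_point_over[OF x])
  moreover have "finite (darts d')" using finite_darts by (simp add: forget_point_darts[OF x])
  ultimately show ?thesis
    unfolding link_diagram_def
    using ne forget_opp_permutes forget_opp_neq forget_opp_opp forget_nxt_permutes size over eul by simp
qed

end
end

text \<open>A disjoint union of circles with one point each: vertices, edges and components coincide, and each component has two
  faces, with one dart each.\<close>

lemma circles_link_diagram:
  assumes fin: "finite (darts c)" "darts c \<noteq> {}" and perm: "opp c permutes darts c" and nxt: "nxt c = opp c"
    and inv: "\<And>x. x \<in> darts c \<Longrightarrow> opp c (opp c x) = x" "\<And>x. x \<in> darts c \<Longrightarrow> opp c x \<noteq> x" and over: "over c = {}"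
  shows "link_diagram c" and "2 * card (graph_components c) = card (darts c)"
proof -
  have orbit: "orbit (opp c) x = {x, opp c x}" if "x \<in> darts c" for x
    using orbit_involution[where f = "opp c" and x = x, OF inv(1)[OF that]] .
  have card2: "card (orbit (opp c) x) = 2" if "x \<in> darts c" for x
    using orbit[OF that] inv(2)[OF that] by simp
  have half: "2 * card (orbit (opp c) ` darts c) = card (darts c)"
    by (rule card_orbits_involution[OF perm fin(1) inv])
  have nc: "\<not> crossing_at c x" for x using card2 by (auto simp: crossing_at_def nxt)
  have "face_succ c x = x" if "x \<in> darts c" for x using inv(1)[OF that] by (simp add: face_succ_def nxt)
  then have "orbit (face_succ c) x = {x}" if "x \<in> darts c" for x using that orbit_eq_singleton_iff by metis
  then have "faces c = (\<lambda>x. {x}) ` darts c" unfolding faces_def by (rule image_cong[OF refl])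
  then have F: "card (faces c) = card (darts c)" by (simp add: card_image)
  have comp: "{(y, z). y \<in> darts c \<and> (z = opp c y \<or> z = nxt c y)}\<^sup>* `` {x} = orbit (opp c) x" if x: "x \<in> darts c" for x
  proof -
    define r where "r = {(y, z). y \<in> darts c \<and> (z = opp c y \<or> z = nxt c y)}"
    have "(x, w) \<in> r\<^sup>* \<Longrightarrow> w \<in> {x, opp c x}" for w
      by (induction rule: rtrancl_induct) (use inv x in \<open>auto simp: r_def nxt\<close>)
    moreover have "(x, opp c x) \<in> r\<^sup>*" using x by (auto simp: r_def)
    ultimately show ?thesis unfolding r_def[symmetric] orbit[OF x] by auto
  qed
  have "graph_components c = orbit (opp c) ` darts c"
    unfolding graph_components_def by (rule image_cong[OF refl comp])
  then have C: "2 * card (graph_components c) = card (darts c)" using half by simp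
  have V: "card (vertices c) = card (edges c)" by (simp add: vertices_def edges_def nxt)
  have vert: "\<forall>v\<in>vertices c. card v = 2 \<or> card v = 4" using card2 by (auto simp: vertices_def nxt)
  show "2 * card (graph_components c) = card (darts c)" by (rule C)
  have p: "nxt c permutes darts c" using perm nxt by simp
  have "card (vertices c) + card (faces c) = card (edges c) + 2 * card (graph_components c)" using F C V by simp
  then show "link_diagram c" unfolding link_diagram_def using fin perm p inv over nc vert by simp
qed

lemma transpose_circles:
  "link_diagram \<lparr>darts = {0, 1}, opp = transpose 0 1, nxt = transpose 0 1, over = {}\<rparr>"
  "link_diagram \<lparr>darts = {0, 1, 2, 3}, opp = transpose 0 1 \<circ> transpose 2 3,
      nxt = transpose 0 1 \<circ> transpose 2 3, over = {}\<rparr>"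
proof -
  have "transpose 0 1 permutes {0, 1::nat}" by (rule permutes_swap_id) auto
  then show "link_diagram \<lparr>darts = {0, 1}, opp = transpose 0 1, nxt = transpose 0 1, over = {}\<rparr>"
    by (intro circles_link_diagram(1)) (auto simp: transpose_def)
  have "(transpose 0 1 \<circ> transpose 2 3) permutes {0, 1, 2, 3::nat}"
    by (intro permutes_compose permutes_swap_id) auto
  then show "link_diagram \<lparr>darts = {0, 1, 2, 3}, opp = transpose 0 1 \<circ> transpose 2 3,
      nxt = transpose 0 1 \<circ> transpose 2 3, over = {}\<rparr>"
    by (intro circles_link_diagram(1)) (auto simp: transpose_def)
qed

text \<open>Forget points as long as some circle has more than one of them.\<close>

lemma crossingless_reduce:
  assumes "link_diagram d" "\<And>x. \<not> crossing_at d x"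
  shows "\<exists>c. equivclp elementary_move d c \<and> link_diagram c \<and> (\<forall>x. \<not> crossing_at c x) \<and>
    card (graph_components c) = card (graph_components d) \<and> (\<forall>x\<in>darts c. opp c x = nxt c x)"
  using assms
proof (induction "card (darts d)" arbitrary: d rule: less_induct)
  case less
  interpret link_diagram_context d by unfold_locales fact
  show ?case
  proof (cases "\<forall>x\<in>darts d. opp d x = nxt d x")
    case True
    then show ?thesis using less.prems by (intro exI[of _ d]) (auto simp: equivclp_refl)
  next
    case False
    then obtain x where x: "x \<in> darts d" "\<not> crossing_at d x" "opp d x \<noteq> nxt d x" using less.prems(2) by blast
    let ?d = "forget_point d x"
    have ld: "link_diagram ?d" by (rule link_diagram_forget_point[OF x])
    have nc: "\<not> crossing_at ?d z" for z
      using forget_point_crossing[OF x(1,2), of z] less.prems(2) forget_point_darts[OF x(1,2)] by (auto simp: crossing_at_def)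
    have "card (darts ?d) < card (darts d)"
      unfolding forget_point_darts[OF x(1,2)] using x finite_darts by (intro psubset_card_mono) auto
    from less.hyps[OF this ld nc] obtain c where c: "equivclp elementary_move ?d c" "link_diagram c"
      "\<forall>x. \<not> crossing_at c x" "card (graph_components c) = card (graph_components ?d)" "\<forall>x\<in>darts c. opp c x = nxt c x"
      by blast
    have "elementary_move d ?d" using ld less.prems(1) x unfolding elementary_move_def point_move_def by blast
    then have "equivclp elementary_move d c" using c(1) by (meson equivclp_trans r_into_equivclp)
    then show ?thesis using c forget_components[OF x] by (intro exI[of _ c]) simp
  qed
qed

lemma crossingless_trivial:
  assumes ld: "link_diagram d" and nc: "\<And>x. \<not> crossing_at d x" and comps: "card (graph_components d) \<le> 2"
  shows "link_of d = trivial_knot \<or> link_of d = trivial_two_component_link"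
proof -
  obtain c where c: "equivclp elementary_move d c" "link_diagram c" "\<forall>x. \<not> crossing_at c x"
    "card (graph_components c) = card (graph_components d)" "\<forall>x\<in>darts c. opp c x = nxt c x"
    using crossingless_reduce[OF ld nc] by blast
  interpret c: link_diagram_context c by unfold_locales (rule c(2))
  have nxt: "nxt c = opp c"
    using c(5) c.nxt_permutes c.opp_permutes by (auto simp: fun_eq_iff permutes_not_in) (metis permutes_not_in)
  have over: "over c = {}" using c(3) c.over_crossing by auto
  have card: "2 * card (graph_components c) = card (darts c)"
    by (rule circles_link_diagram(2)[OF c.finite_darts c.darts_nonempty c.opp_permutes nxt _ c.opp_neq over]) simp
  have link: "link_of d = link_of e" if "diagram_iso c e" "link_diagram e" for e
  proof -
    have "elementary_move c e" using that c(2) by (simp add: elementary_move_def)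
    then have "equivclp elementary_move d e" using c(1) by (meson equivclp_trans r_into_equivclp)
    then show ?thesis unfolding link_of_def by (auto intro: equivclp_trans equivclp_sym)
  qed
  obtain x where x: "x \<in> darts c" using c.darts_nonempty by blast
  have x': "opp c x \<in> darts c" "opp c x \<noteq> x" using x c.opp_neq by auto
  have "0 < card (darts c)" using c.finite_darts x by (auto simp: card_gt_0_iff)
  then have "card (darts c) = 2 \<or> card (darts c) = 4" using card comps c(4) by arith
  then show ?thesis
  proof
    assume 2: "card (darts c) = 2"
    have D: "darts c = {x, opp c x}"
      by (rule card_subset_eq[OF c.finite_darts, symmetric]) (use 2 x x' in auto)
    define g where "g z = (if z = x then 0 else 1 :: nat)" for z
    have "diagram_iso c \<lparr>darts = {0, 1}, opp = transpose 0 1, nxt = transpose 0 1, over = {}\<rparr>"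
      unfolding diagram_iso_def
    proof (intro exI[of _ g] conjI ballI)
      show "bij_betw g (darts c) (darts \<lparr>darts = {0, 1}, opp = transpose 0 1, nxt = transpose 0 1, over = {}\<rparr>)"
        using x' unfolding D by (auto simp: bij_betw_def g_def)
    qed (use x' nxt over in \<open>auto simp: D g_def\<close>)
    then show ?thesis using link transpose_circles(1) by (simp add: trivial_knot_def)
  next
    assume 4: "card (darts c) = 4"
    have "card {x, opp c x} = 2" using x' by simp
    then have "{x, opp c x} \<noteq> darts c" using 4 by auto
    then obtain y where y: "y \<in> darts c" "y \<noteq> x" "y \<noteq> opp c x" using x x' by blast
    have y': "opp c y \<in> darts c" "opp c y \<noteq> y" "opp c y \<noteq> x" "opp c y \<noteq> opp c x"
      using y(1) c.opp_neq[OF y(1)] y(2,3) c.opp_opp[of y] by auto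
    have D: "darts c = {x, opp c x, y, opp c y}"
      by (rule card_subset_eq[OF c.finite_darts, symmetric]) (use 4 x x' y y' in auto)
    define g where "g z = (if z = x then 0 else if z = opp c x then 1 else if z = y then 2 else 3 :: nat)" for z
    let ?T = "\<lparr>darts = {0, 1, 2, 3}, opp = transpose 0 1 \<circ> transpose 2 3, nxt = transpose 0 1 \<circ> transpose 2 3, over = {}\<rparr>"
    have "diagram_iso c ?T"
      unfolding diagram_iso_def
    proof (intro exI[of _ g] conjI ballI)
      show "bij_betw g (darts c) (darts ?T)"
        using x' y y' unfolding D by (auto simp: bij_betw_def g_def)
      fix z assume "z \<in> darts c"
      then have z: "z = x \<or> z = opp c x \<or> z = y \<or> z = opp c y" by (simp add: D)
      then show "g (opp c z) = opp ?T (g z)" using x' y y' by (elim disjE) (simp_all add: g_def)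
      then show "g (nxt c z) = nxt ?T (g z)" by (simp add: nxt)
      show "z \<in> over c \<longleftrightarrow> g z \<in> over ?T" by (simp add: over)
    qed
    then show ?thesis using link transpose_circles(2) by (simp add: trivial_two_component_link_def)
  qed
qed

context schubert_diagram
begin

text \<open>Every component contains one of the two under-strands, as every edge of a bridge ends at an under-strand.\<close>

lemma crossingless_if_no_passes:
  assumes "length U = 1" "length V = 1"
  shows "\<not> crossing_at d z" and "card (graph_components d) \<le> 2"
proof -
  have no: "\<not> crossing_at d z" if "z \<in> PU \<union> PV" for z
  proof
    assume c: "crossing_at d z"
    from that obtain W where W: "W \<in> {U, V}" "z \<in> path_darts d W" by blast
    obtain i where "Suc i < length W" using crossing_path_cases[OF strand_UV[OF W(1)] W(2) c] by blast
    then show False using W(1) assms by auto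
  qed
  have nxt: "nxt d z \<in> PU \<union> PV" if "z \<in> PA \<union> PB" for z
    using that nxt_under_iff[of z] darts_paths by blast
  show "\<not> crossing_at d z"
    using no[of z] no[of "nxt d z"] nxt[of z] crossing_in[of z] darts_paths by auto
  have "graph_components d \<subseteq> {step_rel\<^sup>* `` {first U}, step_rel\<^sup>* `` {first V}}"
  proof
    fix S assume "S \<in> graph_components d"
    then obtain z where z: "z \<in> darts d" "S = step_rel\<^sup>* `` {z}" by (auto simp: graph_components_eq)
    obtain w where w: "w \<in> PU \<union> PV" "(w, z) \<in> step_rel\<^sup>*"
    proof (cases "z \<in> PU \<union> PV")
      case False
      then have "nxt d z \<in> PU \<union> PV" using nxt z(1) darts_paths by blast
      then show ?thesis using that step_rel_back[OF step_rel_nxt[OF z(1)]] by blast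
    qed (use that in blast)
    from w(1) obtain W where W: "W \<in> {U, V}" "w \<in> path_darts d W" by blast
    then have "w = first W \<or> w = opp d (first W)" using assms by (auto simp: path_darts_nth)
    moreover have "first W \<in> darts d" using strand_in[OF strand_UV[OF W(1)]] assms W(1) by auto
    ultimately have "(first W, w) \<in> step_rel\<^sup>*" using step_rel_opp by auto
    then have "(first W, z) \<in> step_rel\<^sup>*" using w(2) by (rule rtrancl_trans)
    then have "S = step_rel\<^sup>* `` {first W}" using component_eq z(2) by blast
    then show "S \<in> {step_rel\<^sup>* `` {first U}, step_rel\<^sup>* `` {first V}}" using W(1) by auto
  qed
  then have "card (graph_components d) \<le> card {step_rel\<^sup>* `` {first U}, step_rel\<^sup>* `` {first V}}"
    by (intro card_mono) auto
  also have "\<dots> \<le> 2" by (simp add: card_insert_le_m1)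
  finally show "card (graph_components d) \<le> 2" .
qed

end


section \<open>The theorem\<close>

theorem theorem1p2:
  fixes R :: "diagram set" and D :: nat and S :: diagram
  assumes "rational_link R"
    and "R \<noteq> trivial_knot"
    and "R \<noteq> trivial_two_component_link"
    and "D = link_determinant R"
    and "S \<in> R"
    and "schubert_normal_form S"
  shows "\<exists>f. coloring D S f \<and> nontrivial_coloring S f \<and> f ` arcs S = {0..<D}"
proof -
  obtain A B U V where "two_bridge_diagram S A B U V" and alt: "two_bridge_diagram.alternating_presentation S A B U V"
    using schubert_normal_form_obtain[OF assms(6)] .
  then interpret two_bridge_diagram S A B U V by blast
  interpret schubert_diagram S A B U V by unfold_locales (rule alt)
  obtain d0 where d0: "link_diagram d0" "R = link_of d0" using assms(1) unfolding rational_link_def is_link_def by blast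
  have R: "R = link_of S"
  proof -
    have "equivclp elementary_move d0 S" using assms(5) d0(2) by (simp add: link_of_def)
    then show ?thesis unfolding d0(2) link_of_def by (auto intro: equivclp_trans equivclp_sym)
  qed
  have two: "2 \<le> modulus"
  proof (rule ccontr)
    assume "\<not> 2 \<le> modulus"
    then have "length U = 1 \<and> length V = 1" by (intro modulus_le_1_imp_no_passes) simp
    then show False
      using crossingless_trivial[OF link_diagram] crossingless_if_no_passes assms(2,3) unfolding R by blast
  qed
  have "diagram_determinant e = modulus" if e: "e \<in> R" for e
  proof -
    have eq: "equivclp elementary_move S e" using e by (simp add: R link_of_def)
    have "link_diagram e"
      using eq by (induction rule: equivclp_induct) (auto simp: elementary_move_def link_diagram)
    then interpret e: link_diagram_context e by unfold_locales
    show ?thesis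
    proof (rule e.diagram_determinant_eq)
      show "modulus > 0" using two by simp
      show "card (dart_colorings (int m) e) = m * gcd m modulus" if "m > 0" for m
        using card_dart_colorings_schubert[OF that] card_dart_colorings_link[OF eq] by (simp add: modulus_def)
    qed
  qed
  moreover have "R \<noteq> {}" using assms(5) by blast
  ultimately have "diagram_determinant ` R = {modulus}" by auto
  then have D: "D = modulus" unfolding assms(4) link_determinant_def by (intro the_equality) auto
  obtain x where x: "x \<in> dart_colorings (int modulus) S" and onto: "\<And>r. 0 \<le> r \<Longrightarrow> r < int modulus \<Longrightarrow> \<exists>z\<in>darts S. x z = r"
    using surjective_coloring[OF two] by blast
  obtain f where f: "coloring modulus S f" "\<And>z. z \<in> darts S \<Longrightarrow> int (f (arc_of S z)) = x z"
    using coloring_from_dart_coloring[OF x] two by auto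
  have all: "f ` arcs S = {0..<modulus}"
  proof
    show "f ` arcs S \<subseteq> {0..<modulus}" using f(1) by (simp add: coloring_def)
    show "{0..<modulus} \<subseteq> f ` arcs S"
    proof
      fix r assume "r \<in> {0..<modulus}"
      then obtain z where z: "z \<in> darts S" "x z = int r" using onto[of "int r"] by auto
      then have "f (arc_of S z) = r" using f(2)[OF z(1)] by simp
      then show "r \<in> f ` arcs S" using arc_of_in[OF z(1)] by blast
    qed
  qed
  moreover have "nontrivial_coloring S f"
  proof -
    have "0 \<in> f ` arcs S" "1 \<in> f ` arcs S" using all two by auto
    then show ?thesis unfolding nontrivial_coloring_def by (metis imageE zero_neq_one)
  qed
  ultimately show ?thesis using f(1) D by blast
qed

end
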